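(* Let $m\in\mathbb{N}$ and let the domain $\Omega\subseteq\mathbb{R}^N$ have finite width. Let $H_0^m(\Omega)$ be equipped with the norm $$|u|_{H^m(\Omega)}=\Big(\sum_{|\alpha|=m}\|D^\alpha u\|_{L_2(\Omega)}^2\Big)^{1/2}$$ and corresponding inner product $\langle u,v\rangle_{H^m(\Omega)}=\sum_{|\alpha|=m}\langle D^\alpha u,D^\alpha v\rangle_{L_2(\Omega)}$. Assume that $$B:H^{2m}(\Omega)\cap H_0^m(\Omega)\to L_2(\Omega),\qquad z\mapsto(-1)^m\sum_{|\alpha|=m}D^{2\alpha}z$$ has a complete orthonormal eigensystem $(\lambda_k,u_k)_{k\in\mathbb{N}}$, and let $E_{m,0}:H_0^m(\Omega)\to L_2(\Omega)$ denote the embedding operator. Then for each $u\in L_2(\Omega)$ there holds $$E_{m,0}^*u=B^{-1}u=\sum_{k\in\mathbb{N}}\frac1{\lambda_k}\langle u,u_k\rangle_{L_2(\Omega)}u_k.$$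
   Context: $\Omega$ is nonempty and open; it has finite width if it lies between two parallel hyperplanes (planes of dimension $N-1$). $L_2(\Omega)$ carries $\langle u,v\rangle_{L_2(\Omega)}=\int_\Omega u\overline v\,dx$; $H^m(\Omega)$ is the space of $u\in L_2(\Omega)$ with weak derivatives $D^\alpha u\in L_2(\Omega)$, $0\le|\alpha|\le m$, with standard norm $(\sum_{0\le|\alpha|\le m}\|D^\alpha u\|^2_{L_2(\Omega)})^{1/2}$; $H_0^m(\Omega)$ is the closure of $C_0^\infty(\Omega)$ in $H^m(\Omega)$. On a domain of finite width the seminorm $|\cdot|_{H^m(\Omega)}$ is a norm on $H_0^m(\Omega)$ equivalent to the standard one. The embedding is $E_{m,0}u:=u$, and its adjoint $E_{m,0}^*:L_2(\Omega)\to H_0^m(\Omega)$ is defined by $\langle E_{m,0}^*u,v\rangle_{H^m(\Omega)}=\langle u,v\rangle_{L_2(\Omega)}$ for all $u\in L_2(\Omega)$, $v\in H_0^m(\Omega)$ (with the inner product of the claim). A complete orthonormal eigensystem $(\lambda_k,u_k)_{k\in\mathbb{N}}$ of $B$ means that each $u_k\in H^{2m}(\Omega)\cap H_0^m(\Omega)$ satisfies $Bu_k=\lambda_ku_k$ and $\{u_k\}_{k\in\mathbb{N}}$ is an orthonormal basis of $L_2(\Omega)$.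
   Formalization: Since B on H^{2m}(Ω) ∩ H_0^m(Ω) need not be onto L_2(Ω) under the stated hypotheses, B^{-1} is taken to be the inverse of the L_2-closure of B; it agrees with the literal inverse of B for every u in the range of B. *)

theory Defs
  imports "HOL-Analysis.Analysis"
begin

text \<open>Elements of \<open>L\<^sub>2(\<Omega>)\<close> are represented by functions on the whole space, of which only the
  restriction to \<open>\<Omega>\<close> matters; equality in \<open>L\<^sub>2(\<Omega>)\<close> is the relation \<open>ae_eq \<Omega>\<close>.\<close>

definition L2_space :: "(real^'n) set \<Rightarrow> (real^'n \<Rightarrow> complex) set" where
  "L2_space \<Omega> = {f \<in> borel_measurable (lebesgue_on \<Omega>).
                    integrable (lebesgue_on \<Omega>) (\<lambda>x. (cmod (f x))\<^sup>2)}"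

abbreviation ae_eq ::
    "(real^'n) set \<Rightarrow> (real^'n \<Rightarrow> complex) \<Rightarrow> (real^'n \<Rightarrow> complex) \<Rightarrow> bool" where
  "ae_eq \<Omega> f g \<equiv> (AE x in lebesgue_on \<Omega>. f x = g x)"

definition L2_inner ::
    "(real^'n) set \<Rightarrow> (real^'n \<Rightarrow> complex) \<Rightarrow> (real^'n \<Rightarrow> complex) \<Rightarrow> complex" where
  "L2_inner \<Omega> u v = (LINT x|lebesgue_on \<Omega>. u x * cnj (v x))"

definition L2_norm :: "(real^'n) set \<Rightarrow> (real^'n \<Rightarrow> complex) \<Rightarrow> real" where
  "L2_norm \<Omega> u = sqrt (LINT x|lebesgue_on \<Omega>. (cmod (u x))\<^sup>2)"

definition finite_width :: "(real^'n) set \<Rightarrow> bool" where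
  "finite_width \<Omega> \<longleftrightarrow> (\<exists>a b c. a \<noteq> 0 \<and> (\<forall>x\<in>\<Omega>. b \<le> a \<bullet> x \<and> a \<bullet> x \<le> c))"

subsection \<open>Test functions\<close>

definition partial_deriv :: "'n \<Rightarrow> (real^'n \<Rightarrow> complex) \<Rightarrow> real^'n \<Rightarrow> complex" where
  "partial_deriv i f x = frechet_derivative f (at x) (axis i 1)"

definition smooth :: "(real^'n \<Rightarrow> complex) \<Rightarrow> bool" where
  "smooth f \<longleftrightarrow> (\<forall>is x. foldr partial_deriv is f differentiable (at x))"

definition test_functions :: "(real^'n) set \<Rightarrow> (real^'n \<Rightarrow> complex) set" where
  "test_functions \<Omega> = {\<phi>. smooth \<phi> \<and> compact (closure {x. \<phi> x \<noteq> 0}) \<and> closure {x. \<phi> x \<noteq> 0} \<subseteq> \<Omega>}"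

text \<open>A multi-index is a function \<open>\<alpha> :: 'n \<Rightarrow> nat\<close>.\<close>

definition mi_order :: "('n::finite \<Rightarrow> nat) \<Rightarrow> nat" where
  "mi_order \<alpha> = (\<Sum>i\<in>UNIV. \<alpha> i)"

lemma finite_mi_order_le: "finite {\<alpha> :: 'n::finite \<Rightarrow> nat. mi_order \<alpha> \<le> m}"
proof (rule finite_subset)
  show "{\<alpha> :: 'n \<Rightarrow> nat. mi_order \<alpha> \<le> m} \<subseteq> PiE UNIV (\<lambda>_. {..m})"
  proof
    fix \<alpha> :: "'n \<Rightarrow> nat" assume "\<alpha> \<in> {\<alpha>. mi_order \<alpha> \<le> m}"
    moreover have "\<alpha> i \<le> mi_order \<alpha>" for i
      unfolding mi_order_def by (rule member_le_sum) auto
    ultimately show "\<alpha> \<in> PiE UNIV (\<lambda>_. {..m})"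
      using order_trans by (auto simp: PiE_def)
  qed
qed (auto intro: finite_PiE)

text \<open>The index type carries no order, so the order in which the partial derivatives of \<open>D\<^sup>\<alpha>\<close> are
  taken is left to choice; it is irrelevant for smooth functions, the only ones this is used for.\<close>

definition classical_deriv :: "('n \<Rightarrow> nat) \<Rightarrow> (real^'n \<Rightarrow> complex) \<Rightarrow> real^'n \<Rightarrow> complex" where
  "classical_deriv \<alpha> \<phi> = foldr partial_deriv (SOME is. \<forall>i. count_list is i = \<alpha> i) \<phi>"

subsection \<open>Sobolev spaces\<close>

definition is_weak_deriv ::
    "(real^'n) set \<Rightarrow> ('n \<Rightarrow> nat) \<Rightarrow> (real^'n \<Rightarrow> complex) \<Rightarrow> (real^'n \<Rightarrow> complex) \<Rightarrow> bool" where
  "is_weak_deriv \<Omega> \<alpha> u v \<longleftrightarrow> (\<forall>\<phi>\<in>test_functions \<Omega>.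
     (LINT x|lebesgue_on \<Omega>. u x * classical_deriv \<alpha> \<phi> x)
       = (-1) ^ mi_order \<alpha> * (LINT x|lebesgue_on \<Omega>. v x * \<phi> x))"

text \<open>A representative of the weak derivative in \<open>L\<^sub>2(\<Omega>)\<close>, which is unique almost everywhere.\<close>

definition weak_deriv ::
    "(real^'n) set \<Rightarrow> ('n \<Rightarrow> nat) \<Rightarrow> (real^'n \<Rightarrow> complex) \<Rightarrow> real^'n \<Rightarrow> complex" where
  "weak_deriv \<Omega> \<alpha> u = (SOME v. v \<in> L2_space \<Omega> \<and> is_weak_deriv \<Omega> \<alpha> u v)"

definition Hm_space :: "(real^'n) set \<Rightarrow> nat \<Rightarrow> (real^'n \<Rightarrow> complex) set" where
  "Hm_space \<Omega> m = {u \<in> L2_space \<Omega>.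
     \<forall>\<alpha>. mi_order \<alpha> \<le> m \<longrightarrow> (\<exists>v\<in>L2_space \<Omega>. is_weak_deriv \<Omega> \<alpha> u v)}"

definition Hm_norm :: "(real^'n) set \<Rightarrow> nat \<Rightarrow> (real^'n \<Rightarrow> complex) \<Rightarrow> real" where
  "Hm_norm \<Omega> m u = sqrt (\<Sum>\<alpha> | mi_order \<alpha> \<le> m. (L2_norm \<Omega> (weak_deriv \<Omega> \<alpha> u))\<^sup>2)"

definition H0m_space :: "(real^'n) set \<Rightarrow> nat \<Rightarrow> (real^'n \<Rightarrow> complex) set" where
  "H0m_space \<Omega> m = {u \<in> Hm_space \<Omega> m.
     \<forall>\<epsilon>>0. \<exists>\<phi>\<in>test_functions \<Omega>. Hm_norm \<Omega> m (\<lambda>x. u x - \<phi> x) < \<epsilon>}"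

text \<open>The inner product inducing the seminorm \<open>(\<Sum>|\<alpha>|=m. \<parallel>D\<^sup>\<alpha>u\<parallel>\<^sup>2)\<^sup>1\<^sup>/\<^sup>2\<close>, with which
  \<open>H0m_space \<Omega> m\<close> is equipped.\<close>

definition H0m_inner ::
    "(real^'n) set \<Rightarrow> nat \<Rightarrow> (real^'n \<Rightarrow> complex) \<Rightarrow> (real^'n \<Rightarrow> complex) \<Rightarrow> complex" where
  "H0m_inner \<Omega> m u v =
     (\<Sum>\<alpha> | mi_order \<alpha> = m. L2_inner \<Omega> (weak_deriv \<Omega> \<alpha> u) (weak_deriv \<Omega> \<alpha> v))"

text \<open>\<open>w\<close> is the value at \<open>u\<close> of the adjoint of the embedding of \<open>H0m_space \<Omega> m\<close> into
  \<open>L2_space \<Omega>\<close>. It is determined up to \<open>ae_eq \<Omega>\<close> when \<open>\<Omega>\<close> has finite width.\<close>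

definition is_embedding_adjoint ::
    "(real^'n) set \<Rightarrow> nat \<Rightarrow> (real^'n \<Rightarrow> complex) \<Rightarrow> (real^'n \<Rightarrow> complex) \<Rightarrow> bool" where
  "is_embedding_adjoint \<Omega> m u w \<longleftrightarrow> w \<in> H0m_space \<Omega> m \<and>
     (\<forall>v\<in>H0m_space \<Omega> m. H0m_inner \<Omega> m w v = L2_inner \<Omega> u v)"

definition embedding_adjoint ::
    "(real^'n) set \<Rightarrow> nat \<Rightarrow> (real^'n \<Rightarrow> complex) \<Rightarrow> real^'n \<Rightarrow> complex" where
  "embedding_adjoint \<Omega> m u = (SOME w. is_embedding_adjoint \<Omega> m u w)"

subsection \<open>The operator B\<close>

definition B_dom :: "(real^'n) set \<Rightarrow> nat \<Rightarrow> (real^'n \<Rightarrow> complex) set" where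
  "B_dom \<Omega> m = Hm_space \<Omega> (2 * m) \<inter> H0m_space \<Omega> m"

definition B_op ::
    "(real^'n) set \<Rightarrow> nat \<Rightarrow> (real^'n \<Rightarrow> complex) \<Rightarrow> real^'n \<Rightarrow> complex" where
  "B_op \<Omega> m z = (\<lambda>x. (-1) ^ m * (\<Sum>\<alpha> | mi_order \<alpha> = m. weak_deriv \<Omega> (\<lambda>i. 2 * \<alpha> i) z x))"

definition orthonormal_basis_L2 :: "(real^'n) set \<Rightarrow> (nat \<Rightarrow> real^'n \<Rightarrow> complex) \<Rightarrow> bool" where
  "orthonormal_basis_L2 \<Omega> e \<longleftrightarrow>
     (\<forall>k. e k \<in> L2_space \<Omega>) \<and>
     (\<forall>j k. L2_inner \<Omega> (e j) (e k) = (if j = k then 1 else 0)) \<and>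
     (\<forall>f\<in>L2_space \<Omega>. \<forall>\<epsilon>>0. \<exists>n c. L2_norm \<Omega> (\<lambda>x. f x - (\<Sum>k<n. c k * e k x)) < \<epsilon>)"

definition complete_orthonormal_eigensystem ::
    "(real^'n) set \<Rightarrow> nat \<Rightarrow> (nat \<Rightarrow> complex) \<Rightarrow> (nat \<Rightarrow> real^'n \<Rightarrow> complex) \<Rightarrow> bool" where
  "complete_orthonormal_eigensystem \<Omega> m ev e \<longleftrightarrow>
     (\<forall>k. e k \<in> B_dom \<Omega> m \<and> ae_eq \<Omega> (B_op \<Omega> m (e k)) (\<lambda>x. ev k * e k x)) \<and>
     orthonormal_basis_L2 \<Omega> e"

text \<open>The graph of the \<open>L\<^sub>2(\<Omega>)\<close>-closure of B. For domains with a rough boundary, B itself need not be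
  onto \<open>L\<^sub>2(\<Omega>)\<close> even if it has a complete orthonormal eigensystem: the \<open>H\<^sup>2\<^sup>m\<close> regularity of the
  eigenfunctions need not be inherited by infinite series of them. The operator \<open>B\<^sup>-\<^sup>1\<close> on all of
  \<open>L\<^sub>2(\<Omega>)\<close> is therefore the inverse of the closure, that is, the continuous extension of the
  inverse of B on its (dense) range.\<close>

definition B_closure :: "(real^'n) set \<Rightarrow> nat \<Rightarrow> ((real^'n \<Rightarrow> complex) \<times> (real^'n \<Rightarrow> complex)) set" where
  "B_closure \<Omega> m = {(z, u). z \<in> L2_space \<Omega> \<and> u \<in> L2_space \<Omega> \<and>
     (\<exists>w. (\<forall>n::nat. w n \<in> B_dom \<Omega> m) \<and>
        (\<lambda>n. L2_norm \<Omega> (\<lambda>x. w n x - z x)) \<longlonglongrightarrow> 0 \<and>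
        (\<lambda>n. L2_norm \<Omega> (\<lambda>x. B_op \<Omega> m (w n) x - u x)) \<longlonglongrightarrow> 0)}"

definition B_inverse ::
    "(real^'n) set \<Rightarrow> nat \<Rightarrow> (real^'n \<Rightarrow> complex) \<Rightarrow> real^'n \<Rightarrow> complex" where
  "B_inverse \<Omega> m u = (SOME z. (z, u) \<in> B_closure \<Omega> m)"

end

theory Submission
  imports Defs
begin

text \<open>Write \<open>\<langle>v, w\<rangle>\<^sub>m\<close> for the inner product of \<open>H\<^sub>0\<^sup>m(\<Omega>)\<close>. Green's formula \<open>\<langle>z, v\<rangle>\<^sub>m = \<langle>B z,
  v\<rangle>\<close> for \<open>z\<close> in the domain of \<open>B\<close> and \<open>v \<in> H\<^sub>0\<^sup>m(\<Omega>)\<close> (lemma \<open>green_formula\<close>) says that \<open>z\<close> is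
  the adjoint of the embedding at \<open>B z\<close>. What remains is to extend this from the range of \<open>B\<close> to
  all of \<open>L\<^sub>2(\<Omega>)\<close>. Finite width gives the Poincare inequality (\<open>poincare_H0m\<close>), which bounds all
  derivatives of order at most \<open>m\<close> by the seminorm. With Green's formula it follows that every
  such derivative of \<open>w\<close> is bounded by a multiple of \<open>\<parallel>B w\<parallel>\<close> (\<open>B_a_priori\<close>). Hence all
  eigenvalues are nonzero, and if \<open>B w\<^sub>n\<close> converges to \<open>u\<close> in \<open>L\<^sub>2(\<Omega>)\<close>, then \<open>w\<^sub>n\<close> is a Cauchy
  sequence in \<open>H\<^sup>m(\<Omega>)\<close> whose limit satisfies the equation that defines the adjoint at \<open>u\<close>
  (\<open>B_approximation_converges\<close>).

  For the partial sums \<open>w\<^sub>n = (\<Sum>k<n. \<langle>u, e\<^sub>k\<rangle> / \<lambda>\<^sub>k * e\<^sub>k)\<close> the images \<open>B w\<^sub>n\<close> are the Fourier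
  partial sums of \<open>u\<close>, which converge to \<open>u\<close>. So the series converges to the adjoint at \<open>u\<close>. As
  the same argument applies to every sequence that witnesses an element \<open>(z, u)\<close> of the graph of
  the closure of \<open>B\<close>, the adjoint is also the inverse of that closure.

  The analytic foundations are the completeness of \<open>L\<^sub>2(\<Omega>)\<close>, the equality of mixed partial
  derivatives, integration by parts, and the fundamental lemma of the calculus of variations
  (\<open>fundamental_lemma\<close>), which makes weak derivatives unique almost everywhere.\<close>

section \<open>The pre-Hilbert space of square integrable functions\<close>

lemma L2_measurable: "u \<in> L2_space S \<Longrightarrow> u \<in> borel_measurable (lebesgue_on S)"
  by (simp add: L2_space_def)

lemma L2_integrable_sq: "u \<in> L2_space S \<Longrightarrow> integrable (lebesgue_on S) (\<lambda>x. (cmod (u x))\<^sup>2)"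
  by (simp add: L2_space_def)

lemma L2_mult_integrable:
  assumes "u \<in> L2_space S" "v \<in> L2_space S"
  shows "integrable (lebesgue_on S) (\<lambda>x. u x * v x)"
proof (rule Bochner_Integration.integrable_bound)
  show "integrable (lebesgue_on S) (\<lambda>x. (cmod (u x))\<^sup>2 + (cmod (v x))\<^sup>2)"
    using assms by (auto simp: L2_space_def)
  show "(\<lambda>x. u x * v x) \<in> borel_measurable (lebesgue_on S)"
    using assms by (auto simp: L2_space_def)
  have "cmod (u x) * cmod (v x) \<le> (cmod (u x))\<^sup>2 + (cmod (v x))\<^sup>2" for x
    using sum_squares_bound[of "cmod (u x)" "cmod (v x)"]
      mult_nonneg_nonneg[OF norm_ge_zero[of "u x"] norm_ge_zero[of "v x"]] by linarith
  then show "AE x in lebesgue_on S. norm (u x * v x) \<le> norm ((cmod (u x))\<^sup>2 + (cmod (v x))\<^sup>2)"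
    by (auto simp: norm_mult)
qed

lemma L2_cnj: "u \<in> L2_space S \<Longrightarrow> (\<lambda>x. cnj (u x)) \<in> L2_space S"
  using measurable_compose[of u "lebesgue_on S" borel cnj borel]
  by (simp add: L2_space_def borel_measurable_continuous_onI[OF continuous_on_cnj[OF continuous_on_id]])

lemma L2_inner_integrable:
  assumes "u \<in> L2_space S" "v \<in> L2_space S"
  shows "integrable (lebesgue_on S) (\<lambda>x. u x * cnj (v x))"
  using L2_mult_integrable[OF assms(1) L2_cnj[OF assms(2)]] .

lemma L2_zero: "(\<lambda>x. 0) \<in> L2_space S"
  by (simp add: L2_space_def)

lemma L2_scale: "u \<in> L2_space S \<Longrightarrow> (\<lambda>x. c * u x) \<in> L2_space S"
  by (auto simp: L2_space_def norm_mult power_mult_distrib)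

lemma L2_add:
  assumes "u \<in> L2_space S" "v \<in> L2_space S"
  shows "(\<lambda>x. u x + v x) \<in> L2_space S"
proof -
  have "integrable (lebesgue_on S) (\<lambda>x. (cmod (u x + v x))\<^sup>2)"
  proof (rule Bochner_Integration.integrable_bound)
    show "integrable (lebesgue_on S) (\<lambda>x. 2 * (cmod (u x))\<^sup>2 + 2 * (cmod (v x))\<^sup>2)"
      using assms by (auto simp: L2_space_def)
    show "(\<lambda>x. (cmod (u x + v x))\<^sup>2) \<in> borel_measurable (lebesgue_on S)"
      using assms by (auto simp: L2_space_def)
    have "(cmod (u x + v x))\<^sup>2 \<le> 2 * (cmod (u x))\<^sup>2 + 2 * (cmod (v x))\<^sup>2" for x
    proof -
      have "(cmod (u x + v x))\<^sup>2 \<le> (cmod (u x) + cmod (v x))\<^sup>2"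
        by (simp add: norm_triangle_ineq power_mono)
      also have "\<dots> \<le> 2 * (cmod (u x))\<^sup>2 + 2 * (cmod (v x))\<^sup>2"
        using sum_squares_bound[of "cmod (u x)" "cmod (v x)"] by (simp add: power2_sum)
      finally show ?thesis .
    qed
    then show "AE x in lebesgue_on S. norm ((cmod (u x + v x))\<^sup>2)
        \<le> norm (2 * (cmod (u x))\<^sup>2 + 2 * (cmod (v x))\<^sup>2)"
      by auto
  qed
  with assms show ?thesis by (auto simp: L2_space_def)
qed

lemma L2_diff:
  assumes "u \<in> L2_space S" "v \<in> L2_space S"
  shows "(\<lambda>x. u x - v x) \<in> L2_space S"
  using L2_add[OF assms(1) L2_scale[OF assms(2), of "-1"]] by simp

lemma L2_sum:
  assumes "\<And>i. i \<in> I \<Longrightarrow> f i \<in> L2_space S"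
  shows "(\<lambda>x. \<Sum>i\<in>I. f i x) \<in> L2_space S"
  using assms by (induction I rule: infinite_finite_induct) (auto intro: L2_zero L2_add)

lemma L2_inner_add_left:
  "\<lbrakk>u \<in> L2_space S; v \<in> L2_space S; w \<in> L2_space S\<rbrakk>
    \<Longrightarrow> L2_inner S (\<lambda>x. u x + v x) w = L2_inner S u w + L2_inner S v w"
  by (simp add: L2_inner_def distrib_right L2_inner_integrable)

lemma L2_inner_scale_left: "L2_inner S (\<lambda>x. c * u x) v = c * L2_inner S u v"
  by (simp add: L2_inner_def mult.assoc)

lemma L2_inner_diff_left:
  "\<lbrakk>u \<in> L2_space S; v \<in> L2_space S; w \<in> L2_space S\<rbrakk>
    \<Longrightarrow> L2_inner S (\<lambda>x. u x - v x) w = L2_inner S u w - L2_inner S v w"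
  by (simp add: L2_inner_def left_diff_distrib L2_inner_integrable)

lemma L2_inner_sum_left:
  assumes "\<And>i. i \<in> I \<Longrightarrow> f i \<in> L2_space S" "v \<in> L2_space S"
  shows "L2_inner S (\<lambda>x. \<Sum>i\<in>I. f i x) v = (\<Sum>i\<in>I. L2_inner S (f i) v)"
  using assms by (simp add: L2_inner_def sum_distrib_right L2_inner_integrable)

lemma L2_inner_commute: "L2_inner S v u = cnj (L2_inner S u v)"
proof -
  have "cnj (L2_inner S u v) = (LINT x|lebesgue_on S. cnj (u x * cnj (v x)))"
    unfolding L2_inner_def by (rule Bochner_Integration.integral_cnj[symmetric]) 
  then show ?thesis by (simp add: L2_inner_def mult.commute)
qed

lemma L2_inner_diff_right:
  "\<lbrakk>u \<in> L2_space S; v \<in> L2_space S; w \<in> L2_space S\<rbrakk>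
    \<Longrightarrow> L2_inner S w (\<lambda>x. u x - v x) = L2_inner S w u - L2_inner S w v"
  by (simp add: L2_inner_def right_diff_distrib L2_inner_integrable)

lemma L2_inner_scale_right: "L2_inner S u (\<lambda>x. c * v x) = cnj c * L2_inner S u v"
  by (simp add: L2_inner_def mult.left_commute[of _ "cnj c"])

lemma L2_inner_sum_right:
  assumes "\<And>i. i \<in> I \<Longrightarrow> f i \<in> L2_space S" "v \<in> L2_space S"
  shows "L2_inner S v (\<lambda>x. \<Sum>i\<in>I. f i x) = (\<Sum>i\<in>I. L2_inner S v (f i))"
  using assms by (simp add: L2_inner_def sum_distrib_left L2_inner_integrable)

lemma L2_norm_nonneg [simp]: "0 \<le> L2_norm S u"
  by (simp add: L2_norm_def)

lemma L2_norm_sq: "(L2_norm S u)\<^sup>2 = (LINT x|lebesgue_on S. (cmod (u x))\<^sup>2)"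
  by (simp add: L2_norm_def)

lemma L2_inner_self: "L2_inner S u u = of_real ((L2_norm S u)\<^sup>2)"
  unfolding L2_norm_sq L2_inner_def integral_complex_of_real[symmetric] by (simp only: complex_norm_square)

lemma L2_norm_scale: "L2_norm S (\<lambda>x. c * u x) = cmod c * L2_norm S u"
  by (simp add: L2_norm_def norm_mult power_mult_distrib real_sqrt_mult)

lemma L2_norm_zero [simp]: "L2_norm S (\<lambda>x. 0) = 0"
  by (simp add: L2_norm_def)

lemma L2_norm_minus_commute: "L2_norm S (\<lambda>x. u x - v x) = L2_norm S (\<lambda>x. v x - u x)"
  by (simp add: L2_norm_def norm_minus_commute)

lemma L2_norm_eq_0_iff:
  assumes "u \<in> L2_space S"
  shows "L2_norm S u = 0 \<longleftrightarrow> ae_eq S u (\<lambda>x. 0)"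
  using assms integral_nonneg_eq_0_iff_AE[of "lebesgue_on S" "\<lambda>x. (cmod (u x))\<^sup>2"]
  by (simp add: L2_norm_def L2_space_def)

lemma L2_norm_diff_eq_0_iff:
  assumes "u \<in> L2_space S" "v \<in> L2_space S"
  shows "L2_norm S (\<lambda>x. u x - v x) = 0 \<longleftrightarrow> ae_eq S u v"
  using L2_norm_eq_0_iff[OF L2_diff[OF assms]] by simp

lemma L2_norm_cong_ae:
  assumes "u \<in> L2_space S" "v \<in> L2_space S" "ae_eq S u v"
  shows "L2_norm S u = L2_norm S v"
proof -
  have "(LINT x|lebesgue_on S. (cmod (u x))\<^sup>2) = (LINT x|lebesgue_on S. (cmod (v x))\<^sup>2)"
    using assms by (intro integral_cong_AE) (auto simp: L2_space_def)
  then show ?thesis by (simp add: L2_norm_def)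
qed

lemma L2_inner_cong_ae:
  assumes "u \<in> L2_space S" "u' \<in> L2_space S" "v \<in> L2_space S" "v' \<in> L2_space S"
    and "ae_eq S u u'" "ae_eq S v v'"
  shows "L2_inner S u v = L2_inner S u' v'"
  unfolding L2_inner_def using assms
  by (intro integral_cong_AE borel_measurable_integrable[OF L2_inner_integrable]) auto

lemma L2_Cauchy_Schwarz:
  assumes "u \<in> L2_space S" "v \<in> L2_space S"
  shows "cmod (L2_inner S u v) \<le> L2_norm S u * L2_norm S v"
proof (cases "L2_norm S v = 0")
  case True
  then have "ae_eq S v (\<lambda>x. 0)" using L2_norm_eq_0_iff assms by blast
  then have "L2_inner S u v = L2_inner S u (\<lambda>x. 0)"
    using assms by (intro L2_inner_cong_ae) (auto intro: L2_zero)
  then show ?thesis by (simp add: L2_inner_def)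
next
  case False
  let ?n = "of_real ((L2_norm S v)\<^sup>2) :: complex"
  define c where "c = L2_inner S u v / ?n"
  have cv: "(\<lambda>x. c * v x) \<in> L2_space S" using assms by (simp add: L2_scale)
  have n0: "?n \<noteq> 0" using False by simp
  have *: "L2_inner S (\<lambda>x. u x - c * v x) (\<lambda>x. u x - c * v x)
      = of_real ((L2_norm S u)\<^sup>2) - of_real ((cmod (L2_inner S u v))\<^sup>2) / ?n"
  proof -
    have "L2_inner S (\<lambda>x. u x - c * v x) v = L2_inner S u v - c * ?n"
      by (simp only: L2_inner_diff_left[OF assms(1) cv assms(2)] L2_inner_scale_left L2_inner_self)
    also have "\<dots> = 0" using n0 by (simp add: c_def)
    finally have "L2_inner S (\<lambda>x. u x - c * v x) (\<lambda>x. u x - c * v x) = L2_inner S (\<lambda>x. u x - c * v x) u"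
      by (simp add: L2_inner_diff_right assms cv L2_diff L2_inner_scale_right)
    also have "\<dots> = of_real ((L2_norm S u)\<^sup>2) - c * cnj (L2_inner S u v)"
      by (simp add: L2_inner_diff_left assms cv L2_inner_scale_left L2_inner_self
          L2_inner_commute[of S v u])
    also have "c * cnj (L2_inner S u v) = of_real ((cmod (L2_inner S u v))\<^sup>2) / ?n"
      by (simp only: c_def times_divide_eq_left complex_norm_square)
    finally show ?thesis .
  qed
  have "0 \<le> (L2_norm S u)\<^sup>2 - (cmod (L2_inner S u v))\<^sup>2 / (L2_norm S v)\<^sup>2"
  proof -
    have "of_real ((L2_norm S (\<lambda>x. u x - c * v x))\<^sup>2)
        = (of_real ((L2_norm S u)\<^sup>2 - (cmod (L2_inner S u v))\<^sup>2 / (L2_norm S v)\<^sup>2) :: complex)"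
      using * unfolding L2_inner_self by simp
    then have "(L2_norm S (\<lambda>x. u x - c * v x))\<^sup>2
        = (L2_norm S u)\<^sup>2 - (cmod (L2_inner S u v))\<^sup>2 / (L2_norm S v)\<^sup>2"
      by (simp only: of_real_eq_iff)
    then show ?thesis by (metis zero_le_power2)
  qed
  then have "(cmod (L2_inner S u v))\<^sup>2 \<le> (L2_norm S u * L2_norm S v)\<^sup>2"
    using False by (simp add: field_simps power_mult_distrib)
  then show ?thesis by (rule power2_le_imp_le) simp
qed

lemma L2_norm_triangle:
  assumes "u \<in> L2_space S" "v \<in> L2_space S"
  shows "L2_norm S (\<lambda>x. u x + v x) \<le> L2_norm S u + L2_norm S v"
proof (rule power2_le_imp_le)
  have uv: "(\<lambda>x. u x + v x) \<in> L2_space S" using assms by (rule L2_add)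
  have "(L2_norm S (\<lambda>x. u x + v x))\<^sup>2 = Re (L2_inner S (\<lambda>x. u x + v x) (\<lambda>x. u x + v x))"
    by (simp add: L2_inner_self)
  also have "\<dots> = Re (L2_inner S u (\<lambda>x. u x + v x)) + Re (L2_inner S v (\<lambda>x. u x + v x))"
    by (simp add: L2_inner_add_left assms uv)
  also have "\<dots> \<le> L2_norm S u * L2_norm S (\<lambda>x. u x + v x) + L2_norm S v * L2_norm S (\<lambda>x. u x + v x)"
    using L2_Cauchy_Schwarz[OF assms(1) uv] L2_Cauchy_Schwarz[OF assms(2) uv]
    by (intro add_mono) (meson complex_Re_le_cmod order_trans)+
  finally have *: "(L2_norm S (\<lambda>x. u x + v x))\<^sup>2
      \<le> (L2_norm S u + L2_norm S v) * L2_norm S (\<lambda>x. u x + v x)"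
    by (simp add: distrib_right)
  show "(L2_norm S (\<lambda>x. u x + v x))\<^sup>2 \<le> (L2_norm S u + L2_norm S v)\<^sup>2"
  proof (cases "L2_norm S (\<lambda>x. u x + v x) = 0")
    case False
    with * have "L2_norm S (\<lambda>x. u x + v x) \<le> L2_norm S u + L2_norm S v"
      by (metis L2_norm_nonneg mult_right_le_imp_le order_le_imp_less_or_eq power2_eq_square)
    then show ?thesis by (simp add: power_mono)
  qed simp
qed simp

lemma L2_norm_triangle_diff:
  assumes "u \<in> L2_space S" "v \<in> L2_space S" "w \<in> L2_space S"
  shows "L2_norm S (\<lambda>x. u x - w x) \<le> L2_norm S (\<lambda>x. u x - v x) + L2_norm S (\<lambda>x. v x - w x)"
  using L2_norm_triangle[OF L2_diff[OF assms(1,2)] L2_diff[OF assms(2,3)]] by simp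

lemma L2_norm_diff_le:
  assumes "u \<in> L2_space S" "v \<in> L2_space S"
  shows "\<bar>L2_norm S u - L2_norm S v\<bar> \<le> L2_norm S (\<lambda>x. u x - v x)"
  using L2_norm_triangle[OF L2_diff[OF assms] assms(2)]
    L2_norm_triangle[OF L2_diff[OF assms(2,1)] assms(1)]
  by (simp add: L2_norm_minus_commute[of S v])

lemma L2_limit_norm:
  assumes "\<And>n. f n \<in> L2_space S" "g \<in> L2_space S" "(\<lambda>n. L2_norm S (\<lambda>x. f n x - g x)) \<longlonglongrightarrow> 0"
  shows "(\<lambda>n. L2_norm S (f n)) \<longlonglongrightarrow> L2_norm S g"
proof (rule LIM_zero_cancel, rule tendsto_rabs_zero_cancel, rule tendsto_sandwich[OF _ _ tendsto_const assms(3)])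
  show "\<forall>\<^sub>F n in sequentially. \<bar>L2_norm S (f n) - L2_norm S g\<bar> \<le> L2_norm S (\<lambda>x. f n x - g x)"
    by (intro always_eventually allI L2_norm_diff_le assms)
qed simp

lemma L2_limit_inner:
  assumes "\<And>n. f n \<in> L2_space S" "g \<in> L2_space S" "(\<lambda>n. L2_norm S (\<lambda>x. f n x - g x)) \<longlonglongrightarrow> 0"
    and v: "v \<in> L2_space S"
  shows "(\<lambda>n. L2_inner S (f n) v) \<longlonglongrightarrow> L2_inner S g v"
proof (rule LIM_zero_cancel, rule tendsto_norm_zero_cancel, rule tendsto_sandwich[OF _ _ tendsto_const])
  show "\<forall>\<^sub>F n in sequentially. cmod (L2_inner S (f n) v - L2_inner S g v)
      \<le> L2_norm S (\<lambda>x. f n x - g x) * L2_norm S v"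
    using L2_Cauchy_Schwarz[OF L2_diff[OF assms(1,2)] v]
    by (simp add: L2_inner_diff_left assms)
  show "(\<lambda>n. L2_norm S (\<lambda>x. f n x - g x) * L2_norm S v) \<longlonglongrightarrow> 0"
    using tendsto_mult_left_zero[OF assms(3)] .
qed simp_all

lemma L2_limit_inner_right:
  assumes "\<And>n. f n \<in> L2_space S" "g \<in> L2_space S" "(\<lambda>n. L2_norm S (\<lambda>x. f n x - g x)) \<longlonglongrightarrow> 0"
    and v: "v \<in> L2_space S"
  shows "(\<lambda>n. L2_inner S v (f n)) \<longlonglongrightarrow> L2_inner S v g"
  using tendsto_cnj[OF L2_limit_inner[OF assms]] by (simp flip: L2_inner_commute)

lemma L2_limit_unique:
  assumes f: "\<And>n. f n \<in> L2_space S" and g: "g \<in> L2_space S" and h: "h \<in> L2_space S"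
    and fg: "(\<lambda>n. L2_norm S (\<lambda>x. f n x - g x)) \<longlonglongrightarrow> 0"
    and fh: "(\<lambda>n. L2_norm S (\<lambda>x. f n x - h x)) \<longlonglongrightarrow> 0"
  shows "ae_eq S g h"
proof -
  have "(\<lambda>n. L2_norm S (\<lambda>x. f n x - g x) + L2_norm S (\<lambda>x. f n x - h x)) \<longlonglongrightarrow> 0"
    using tendsto_add[OF fg fh] by simp
  moreover have "L2_norm S (\<lambda>x. g x - h x) \<le> L2_norm S (\<lambda>x. f n x - g x) + L2_norm S (\<lambda>x. f n x - h x)" for n
    using L2_norm_triangle_diff[OF g f h, of n] by (simp add: L2_norm_minus_commute[of S g])
  ultimately have "L2_norm S (\<lambda>x. g x - h x) \<le> 0"
    by (intro LIMSEQ_le_const) auto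
  then show ?thesis
    using L2_norm_diff_eq_0_iff[OF g h] by (simp add: order.antisym)
qed

text \<open>Riesz--Fischer. The measure may be infinite, so that square integrable functions need
  not be integrable; multiplication by a positive square integrable weight turns the sequence
  into a Cauchy sequence in \<open>L\<^sub>1\<close>, which has a subsequence that converges almost everywhere.\<close>

lemma L2_complete:
  assumes S: "S \<in> sets lebesgue" and f: "\<And>n. f n \<in> L2_space S"
    and cauchy: "\<And>\<epsilon>. \<epsilon> > 0 \<Longrightarrow> \<exists>N. \<forall>i\<ge>N. \<forall>j\<ge>N. L2_norm S (\<lambda>x. f i x - f j x) < \<epsilon>"
  obtains g where "g \<in> L2_space S" "(\<lambda>n. L2_norm S (\<lambda>x. f n x - g x)) \<longlonglongrightarrow> 0"
proof -
  let ?M = "lebesgue_on S"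
  obtain p :: "real^'a \<Rightarrow> real" where p: "p \<in> borel_measurable lborel" "\<And>x. p x > 0" "integrable lborel p"
    using sigma_finite_measure.obtain_positive_integrable_function[OF lborel.sigma_finite_measure_axioms]
    by metis
  define q where "q x = complex_of_real (sqrt (p x))" for x
  have pM: "integrable ?M p"
    using integrable_mult_indicator[OF S, of p] p(3) p(1) S
    by (simp add: integrable_completion integrable_restrict_space)
  have q: "q \<in> L2_space S"
    using pM p(2) unfolding L2_space_def q_def by (auto simp: less_imp_le)
  have q0: "q x \<noteq> 0" for x using p(2)[of x] by (simp add: q_def)
  define s where "s n x = q x * f n x" for n x
  have s_int: "integrable ?M (s n)" for n
    unfolding s_def by (intro L2_mult_integrable q f)
  have s_le: "(LINT x|?M. norm (s i x - s j x)) \<le> L2_norm S q * L2_norm S (\<lambda>x. f i x - f j x)" for i j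
  proof -
    define a where "a x = complex_of_real (cmod (q x))" for x
    define b where "b x = complex_of_real (cmod (f i x - f j x))" for x
    have ab: "a \<in> L2_space S" "b \<in> L2_space S"
      using q L2_diff[OF f f, of i j] unfolding a_def b_def L2_space_def by auto
    have "L2_inner S a b = of_real (LINT x|?M. norm (s i x - s j x))"
      unfolding L2_inner_def integral_complex_of_real[symmetric]
      by (simp add: a_def b_def s_def norm_mult flip: right_diff_distrib)
    moreover have "(LINT x|?M. norm (s i x - s j x)) \<ge> 0" by simp
    ultimately have "(LINT x|?M. norm (s i x - s j x)) = cmod (L2_inner S a b)" by simp
    also have "\<dots> \<le> L2_norm S a * L2_norm S b" by (rule L2_Cauchy_Schwarz[OF ab])
    also have "\<dots> = L2_norm S q * L2_norm S (\<lambda>x. f i x - f j x)"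
      by (simp add: L2_norm_def a_def b_def)
    finally show ?thesis .
  qed
  have s_cauchy: "\<exists>N. \<forall>i\<ge>N. \<forall>j\<ge>N. (LINT x|?M. norm (s i x - s j x)) < \<epsilon>" if "\<epsilon> > 0" for \<epsilon> :: real
  proof -
    have pos: "\<epsilon> / (L2_norm S q + 1) > 0" using that by (simp add: add_nonneg_pos)
    obtain N where N: "\<And>i j. i \<ge> N \<Longrightarrow> j \<ge> N \<Longrightarrow> L2_norm S (\<lambda>x. f i x - f j x) < \<epsilon> / (L2_norm S q + 1)"
      using cauchy[OF pos] by blast
    have "(LINT x|?M. norm (s i x - s j x)) < \<epsilon>" if "i \<ge> N" "j \<ge> N" for i j
    proof -
      have "(LINT x|?M. norm (s i x - s j x)) \<le> (L2_norm S q + 1) * L2_norm S (\<lambda>x. f i x - f j x)"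
        using s_le[of i j] by (simp add: distrib_right add_increasing2)
      also have "\<dots> < \<epsilon>"
        using N[OF that] by (simp add: pos_less_divide_eq add_nonneg_pos mult.commute)
      finally show ?thesis .
    qed
    then show ?thesis by blast
  qed
  obtain r where r: "strict_mono r" "AE x in ?M. Cauchy (\<lambda>i. s (r i) x)"
    using cauchy_L1_AE_cauchy_subseq[of ?M s, OF s_int s_cauchy] by blast
  define g where "g x = lim (\<lambda>i. f (r i) x)" for x
  have gm: "g \<in> borel_measurable ?M"
    unfolding g_def using f by (intro borel_measurable_lim_metric) (auto simp: L2_space_def)
  have conv: "AE x in ?M. (\<lambda>i. f (r i) x) \<longlonglongrightarrow> g x"
  proof (rule AE_mp[OF r(2)], intro AE_I2 impI)
    fix x assume "Cauchy (\<lambda>i. s (r i) x)"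
    then have "convergent (\<lambda>i. s (r i) x)" by (simp add: Cauchy_convergent_iff)
    then have "convergent (\<lambda>i. inverse (q x) * s (r i) x)" by (intro convergent_mult convergent_const)
    then have "convergent (\<lambda>i. f (r i) x)" using q0[of x] by (simp add: s_def mult.assoc[symmetric])
    then show "(\<lambda>i. f (r i) x) \<longlonglongrightarrow> g x" by (simp add: g_def convergent_LIMSEQ_iff)
  qed
  have fatou: "integrable ?M (\<lambda>x. (cmod (f n x - g x))\<^sup>2) \<and> L2_norm S (\<lambda>x. f n x - g x) \<le> \<epsilon>"
    if \<epsilon>: "\<epsilon> > 0" and N: "\<And>i j. i \<ge> N \<Longrightarrow> j \<ge> N \<Longrightarrow> L2_norm S (\<lambda>x. f i x - f j x) < \<epsilon>" and n: "n \<ge> N"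
    for \<epsilon> n N
  proof -
    have meas: "(\<lambda>x. (cmod (f n x - f k x))\<^sup>2) \<in> borel_measurable ?M" for k
      using L2_measurable[OF f] by measurable
    have measg: "(\<lambda>x. (cmod (f n x - g x))\<^sup>2) \<in> borel_measurable ?M"
      using gm L2_measurable[OF f] by measurable
    have "(\<integral>\<^sup>+x. ennreal ((cmod (f n x - g x))\<^sup>2) \<partial>?M)
        = (\<integral>\<^sup>+x. liminf (\<lambda>i. ennreal ((cmod (f n x - f (r i) x))\<^sup>2)) \<partial>?M)"
    proof (rule nn_integral_cong_AE, rule AE_mp[OF conv], intro AE_I2 impI)
      fix x assume "(\<lambda>i. f (r i) x) \<longlonglongrightarrow> g x"
      then have "(\<lambda>i. ennreal ((cmod (f n x - f (r i) x))\<^sup>2)) \<longlonglongrightarrow> ennreal ((cmod (f n x - g x))\<^sup>2)"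
        by (intro tendsto_intros)
      then show "ennreal ((cmod (f n x - g x))\<^sup>2) = liminf (\<lambda>i. ennreal ((cmod (f n x - f (r i) x))\<^sup>2))"
        by (intro lim_imp_Liminf[symmetric] trivial_limit_sequentially)
    qed
    also have "\<dots> \<le> liminf (\<lambda>i. \<integral>\<^sup>+x. ennreal ((cmod (f n x - f (r i) x))\<^sup>2) \<partial>?M)"
      using meas by (intro nn_integral_liminf) auto
    also have "\<dots> \<le> ennreal (\<epsilon>\<^sup>2)"
    proof -
      have "(\<integral>\<^sup>+x. ennreal ((cmod (f n x - f (r i) x))\<^sup>2) \<partial>?M) \<le> ennreal (\<epsilon>\<^sup>2)" if "i \<ge> N" for i
      proof -
        have "r i \<ge> N" using that seq_suble[OF r(1), of i] by linarith
        then have "(L2_norm S (\<lambda>x. f n x - f (r i) x))\<^sup>2 \<le> \<epsilon>\<^sup>2"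
          using N[OF n] by (intro power_mono) (auto simp: less_imp_le)
        then show ?thesis
          unfolding L2_norm_sq
          using L2_integrable_sq[OF L2_diff[OF f f], of n "r i"] \<epsilon>
          by (subst nn_integral_eq_integral) auto
      qed
      then show ?thesis
        by (intro Liminf_le) (auto simp: eventually_sequentially)
    qed
    finally have le: "(\<integral>\<^sup>+x. ennreal ((cmod (f n x - g x))\<^sup>2) \<partial>?M) \<le> ennreal (\<epsilon>\<^sup>2)" .
    have int: "integrable ?M (\<lambda>x. (cmod (f n x - g x))\<^sup>2)"
      using measg le by (intro integrableI_nonneg) (auto simp: less_top[symmetric] top_unique)
    have "(L2_norm S (\<lambda>x. f n x - g x))\<^sup>2 \<le> \<epsilon>\<^sup>2"
      using le unfolding L2_norm_sq
      by (subst (asm) nn_integral_eq_integral[OF int]) auto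
    then have "L2_norm S (\<lambda>x. f n x - g x) \<le> \<epsilon>"
      using \<epsilon> by (auto intro: power2_le_imp_le[of _ \<epsilon>])
    with int show ?thesis by blast
  qed
  have g: "g \<in> L2_space S"
  proof -
    obtain N where "\<And>i j. i \<ge> N \<Longrightarrow> j \<ge> N \<Longrightarrow> L2_norm S (\<lambda>x. f i x - f j x) < 1"
      using cauchy[of 1] by auto
    then have "integrable ?M (\<lambda>x. (cmod (f N x - g x))\<^sup>2)" using fatou[of 1 N N] by auto
    then have "(\<lambda>x. f N x - g x) \<in> L2_space S"
      using gm L2_measurable[OF f] by (simp add: L2_space_def)
    from L2_diff[OF f[of N] this] show ?thesis by simp
  qed
  have "(\<lambda>n. L2_norm S (\<lambda>x. f n x - g x)) \<longlonglongrightarrow> 0"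
  proof (rule LIMSEQ_I)
    fix \<epsilon> :: real assume "\<epsilon> > 0"
    then obtain N where "\<And>i j. i \<ge> N \<Longrightarrow> j \<ge> N \<Longrightarrow> L2_norm S (\<lambda>x. f i x - f j x) < \<epsilon>/2"
      using cauchy[of "\<epsilon>/2"] by auto
    then show "\<exists>N. \<forall>n\<ge>N. norm (L2_norm S (\<lambda>x. f n x - g x) - 0) < \<epsilon>"
      using fatou[of "\<epsilon>/2" N] \<open>\<epsilon> > 0\<close> by (intro exI[of _ N]) fastforce
  qed
  with g that show ?thesis by blast
qed

section \<open>Calculus of smooth functions\<close>

lemma partial_derivI: "(f has_derivative f') (at x) \<Longrightarrow> partial_deriv i f x = f' (axis i 1)"
  by (simp add: partial_deriv_def flip: frechet_derivative_at)

lemma has_derivative_frechet: "f differentiable (at x) \<Longrightarrow> (f has_derivative frechet_derivative f (at x)) (at x)"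
  by (simp add: frechet_derivative_works)

text \<open>\<open>Ck k f\<close>: all partial derivatives of \<open>f\<close> of order at most \<open>k\<close> exist and are
  differentiable. This form of finite smoothness admits induction on \<open>k\<close>.\<close>

primrec Ck :: "nat \<Rightarrow> (real^'n \<Rightarrow> complex) \<Rightarrow> bool" where
  "Ck 0 f \<longleftrightarrow> (\<forall>x. f differentiable (at x))"
| "Ck (Suc k) f \<longleftrightarrow> (\<forall>x. f differentiable (at x)) \<and> (\<forall>i. Ck k (partial_deriv i f))"

lemma Ck_differentiable: "Ck k f \<Longrightarrow> f differentiable (at x)"
  by (cases k) auto

lemma Ck_Suc_D: "Ck (Suc k) f \<Longrightarrow> Ck k f"
  by (induction k arbitrary: f) auto

lemma Ck_foldr:
  assumes "Ck k f" "length is \<le> k"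
  shows "foldr partial_deriv is f differentiable (at x)"
  using assms
proof (induction "is" arbitrary: f k rule: rev_induct)
  case Nil
  then show ?case by (simp add: Ck_differentiable)
next
  case (snoc i "is")
  then obtain l where "k = Suc l" by (cases k) auto
  with snoc show ?case by auto
qed

lemma smooth_iff_Ck: "smooth f \<longleftrightarrow> (\<forall>k. Ck k f)"
proof
  assume "\<forall>k. Ck k f"
  then show "smooth f" unfolding smooth_def using Ck_foldr by blast
next
  assume "smooth f"
  have "Ck k g" if "\<forall>is x. foldr partial_deriv is g differentiable (at x)" for k g
    using that
  proof (induction k arbitrary: g)
    case 0
    then show ?case using spec[OF 0, of "[]"] by simp
  next
    case (Suc k)
    have "foldr partial_deriv is (partial_deriv i g) differentiable (at x)" for i "is" x
      using Suc.prems[rule_format, of "is @ [i]" x] by simp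
    then show ?case using Suc.IH spec[OF Suc.prems, of "[]"] by simp
  qed
  with \<open>smooth f\<close> show "\<forall>k. Ck k f" unfolding smooth_def by blast
qed

lemma smooth_differentiable: "smooth f \<Longrightarrow> f differentiable (at x)"
  using smooth_iff_Ck Ck_differentiable by blast

lemma smooth_continuous_on: "smooth f \<Longrightarrow> continuous_on A f"
  by (meson continuous_at_imp_continuous_on differentiable_imp_continuous_within smooth_differentiable)

lemma smooth_partial_deriv: "smooth f \<Longrightarrow> smooth (partial_deriv i f)"
  by (meson Ck.simps(2) smooth_iff_Ck)

lemma smooth_foldr: "smooth f \<Longrightarrow> smooth (foldr partial_deriv is f)"
  by (induction "is") (auto simp: smooth_partial_deriv)

lemma partial_deriv_const: "partial_deriv i (\<lambda>x. c) = (\<lambda>x. 0)"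
  by (simp add: fun_eq_iff partial_deriv_def)

lemma partial_deriv_add:
  assumes "\<And>x. f differentiable (at x)" "\<And>x. g differentiable (at x)"
  shows "partial_deriv i (\<lambda>x. f x + g x) = (\<lambda>x. partial_deriv i f x + partial_deriv i g x)"
proof
  fix x
  show "partial_deriv i (\<lambda>x. f x + g x) x = partial_deriv i f x + partial_deriv i g x"
    using partial_derivI[OF has_derivative_add[OF has_derivative_frechet has_derivative_frechet], OF assms]
    by (simp add: partial_deriv_def)
qed

lemma partial_deriv_mult:
  assumes "\<And>x. f differentiable (at x)" "\<And>x. g differentiable (at x)"
  shows "partial_deriv i (\<lambda>x. f x * g x) = (\<lambda>x. partial_deriv i f x * g x + f x * partial_deriv i g x)"
proof
  fix x
  show "partial_deriv i (\<lambda>x. f x * g x) x = partial_deriv i f x * g x + f x * partial_deriv i g x"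
    using partial_derivI[OF has_derivative_mult[OF has_derivative_frechet has_derivative_frechet], OF assms]
    by (simp add: partial_deriv_def)
qed

lemma partial_deriv_cnj:
  assumes "\<And>x. f differentiable (at x)"
  shows "partial_deriv i (\<lambda>x. cnj (f x)) = (\<lambda>x. cnj (partial_deriv i f x))"
proof
  fix x
  show "partial_deriv i (\<lambda>x. cnj (f x)) x = cnj (partial_deriv i f x)"
    using partial_derivI[OF bounded_linear.has_derivative[OF bounded_linear_cnj has_derivative_frechet], OF assms]
    by (simp add: partial_deriv_def)
qed

lemma Ck_const: "Ck k (\<lambda>x. c)"
  by (induction k arbitrary: c) (auto simp: partial_deriv_const)

lemma Ck_add: "Ck k f \<Longrightarrow> Ck k g \<Longrightarrow> Ck k (\<lambda>x. f x + g x)"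
  by (induction k arbitrary: f g) (auto simp: partial_deriv_add)

lemma Ck_mult: "Ck k f \<Longrightarrow> Ck k g \<Longrightarrow> Ck k (\<lambda>x. f x * g x)"
proof (induction k arbitrary: f g)
  case (Suc k)
  then have "Ck k f" "Ck k g" by (blast intro: Ck_Suc_D)+
  with Suc show ?case by (auto simp: partial_deriv_mult intro!: Ck_add)
qed auto

lemma differentiable_cnj:
  "f differentiable (at x) \<Longrightarrow> (\<lambda>x. cnj (f x)) differentiable (at x)"
  unfolding differentiable_def by (blast intro: bounded_linear.has_derivative[OF bounded_linear_cnj])

lemma Ck_cnj: "Ck k f \<Longrightarrow> Ck k (\<lambda>x. cnj (f x))"
  by (induction k arbitrary: f) (auto simp: partial_deriv_cnj differentiable_cnj)

lemma smooth_const: "smooth (\<lambda>x. c)"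
  by (simp add: smooth_iff_Ck Ck_const)

lemma smooth_add: "smooth f \<Longrightarrow> smooth g \<Longrightarrow> smooth (\<lambda>x. f x + g x)"
  by (simp add: smooth_iff_Ck Ck_add)

lemma smooth_mult: "smooth f \<Longrightarrow> smooth g \<Longrightarrow> smooth (\<lambda>x. f x * g x)"
  by (simp add: smooth_iff_Ck Ck_mult)

lemma smooth_cnj: "smooth f \<Longrightarrow> smooth (\<lambda>x. cnj (f x))"
  by (simp add: smooth_iff_Ck Ck_cnj)

lemma smooth_scale: "smooth f \<Longrightarrow> smooth (\<lambda>x. c * f x)"
  by (simp add: smooth_mult smooth_const)

lemma smooth_diff: "smooth f \<Longrightarrow> smooth g \<Longrightarrow> smooth (\<lambda>x. f x - g x)"
  using smooth_add[of f "\<lambda>x. -1 * g x"] smooth_scale[of g "-1"] by simp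

lemma smooth_power: "smooth f \<Longrightarrow> smooth (\<lambda>x. f x ^ n)"
  by (induction n) (auto simp: smooth_const smooth_mult)

lemma smooth_prod:
  assumes "\<And>i. i \<in> I \<Longrightarrow> smooth (f i)"
  shows "smooth (\<lambda>x. \<Prod>i\<in>I. f i x)"
  using assms by (induction I rule: infinite_finite_induct) (auto simp: smooth_const smooth_mult)

lemma partial_deriv_affine:
  "partial_deriv i (\<lambda>x. of_real (a \<bullet> x + b)) = (\<lambda>x. of_real (a $ i))"
proof
  fix x
  have "((\<lambda>x. complex_of_real (a \<bullet> x + b)) has_derivative (\<lambda>h. complex_of_real (a \<bullet> h))) (at x)"
    by (auto intro!: derivative_eq_intros)
  from partial_derivI[OF this] show "partial_deriv i (\<lambda>x. complex_of_real (a \<bullet> x + b)) x = of_real (a $ i)"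
    by (simp add: inner_axis)
qed

lemma smooth_affine: "smooth (\<lambda>x. of_real (a \<bullet> x + b))"
proof -
  have "(\<lambda>x. complex_of_real (a \<bullet> x + b)) differentiable (at x)" for x
    unfolding differentiable_def by (auto intro!: derivative_eq_intros)
  then have "Ck k (\<lambda>x. complex_of_real (a \<bullet> x + b))" for k
    by (cases k) (auto simp: partial_deriv_affine Ck_const simp del: of_real_add)
  then show ?thesis by (simp add: smooth_iff_Ck)
qed

lemma foldr_partial_deriv_cnj:
  "smooth f \<Longrightarrow> foldr partial_deriv is (\<lambda>x. cnj (f x)) = (\<lambda>x. cnj (foldr partial_deriv is f x))"
  by (induction "is") (auto simp: partial_deriv_cnj smooth_foldr smooth_differentiable)

subsection \<open>Symmetry of mixed derivatives\<close>

lemma line_has_vector_derivative: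
  assumes "smooth f"
  shows "((\<lambda>s. f (y + s *\<^sub>R axis i 1)) has_vector_derivative partial_deriv i f (y + s *\<^sub>R axis i 1)) (at s)"
proof -
  have "((\<lambda>s. f (y + s *\<^sub>R axis i 1)) has_derivative
      (\<lambda>h. frechet_derivative f (at (y + s *\<^sub>R axis i 1)) (h *\<^sub>R axis i 1))) (at s)"
    by (rule has_derivative_compose[where f = "\<lambda>s. y + s *\<^sub>R axis i 1"])
       (auto intro!: derivative_eq_intros has_derivative_frechet smooth_differentiable assms)
  moreover have "frechet_derivative f (at z) (h *\<^sub>R axis i 1) = h *\<^sub>R partial_deriv i f z" for h z
    unfolding partial_deriv_def
    by (rule linear_scale[OF linear_frechet_derivative[OF smooth_differentiable[OF assms]]])
  ultimately show ?thesis by (simp add: has_vector_derivative_def)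
qed

lemma line_has_real_derivative:
  assumes "smooth f" "bounded_linear \<rho>"
  shows "((\<lambda>s. \<rho> (f (y + s *\<^sub>R axis i 1))) has_real_derivative \<rho> (partial_deriv i f (y + s *\<^sub>R axis i 1))) (at s)"
  using bounded_linear.has_vector_derivative[OF assms(2) line_has_vector_derivative[OF assms(1)]]
  by (simp add: has_real_derivative_iff_has_vector_derivative)

text \<open>The mean value theorem, applied first in the direction \<open>i\<close> and then in the direction
  \<open>j\<close>. The functional \<open>\<rho>\<close> stands for \<open>Re\<close> or \<open>Im\<close>, as the theorem fails for complex-valued
  functions.\<close>

lemma second_difference:
  fixes f :: "real^'n \<Rightarrow> complex" and h :: real
  assumes f: "smooth f" and \<rho>: "bounded_linear \<rho>" and h: "h > 0"
  shows "\<exists>s t. 0 < s \<and> s < h \<and> 0 < t \<and> t < h \<and>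
    \<rho> (f (x + h *\<^sub>R axis i 1 + h *\<^sub>R axis j 1)) - \<rho> (f (x + h *\<^sub>R axis i 1))
      - \<rho> (f (x + h *\<^sub>R axis j 1)) + \<rho> (f x)
    = h\<^sup>2 * \<rho> (partial_deriv j (partial_deriv i f) (x + s *\<^sub>R axis i 1 + t *\<^sub>R axis j 1))"
proof -
  let ?a = "axis i (1::real) :: real^'n" and ?b = "axis j (1::real) :: real^'n"
  define F where "F s = \<rho> (f ((x + h *\<^sub>R ?b) + s *\<^sub>R ?a)) - \<rho> (f (x + s *\<^sub>R ?a))" for s
  define F' where "F' s = \<rho> (partial_deriv i f ((x + h *\<^sub>R ?b) + s *\<^sub>R ?a)) - \<rho> (partial_deriv i f (x + s *\<^sub>R ?a))" for s
  have "(F has_real_derivative F' s) (at s)" for s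
    unfolding F_def F'_def by (intro DERIV_diff line_has_real_derivative f \<rho>)
  from MVT2[OF h this] obtain s where s: "0 < s" "s < h" "F h - F 0 = h * F' s" by auto
  let ?y = "x + s *\<^sub>R ?a"
  have "((\<lambda>t. \<rho> (partial_deriv i f (?y + t *\<^sub>R ?b))) has_real_derivative
      \<rho> (partial_deriv j (partial_deriv i f) (?y + t *\<^sub>R ?b))) (at t)" for t
    by (intro line_has_real_derivative smooth_partial_deriv f \<rho>)
  from MVT2[OF h this] obtain t where t: "0 < t" "t < h"
    "\<rho> (partial_deriv i f (?y + h *\<^sub>R ?b)) - \<rho> (partial_deriv i f (?y + 0 *\<^sub>R ?b))
      = h * \<rho> (partial_deriv j (partial_deriv i f) (?y + t *\<^sub>R ?b))" by auto
  have "F' s = h * \<rho> (partial_deriv j (partial_deriv i f) (?y + t *\<^sub>R ?b))"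
    using t(3) by (simp add: F'_def algebra_simps)
  then have "F h - F 0 = h\<^sup>2 * \<rho> (partial_deriv j (partial_deriv i f) (?y + t *\<^sub>R ?b))"
    using s(3) by (simp add: power2_eq_square)
  moreover have "F h - F 0 = \<rho> (f (x + h *\<^sub>R ?a + h *\<^sub>R ?b)) - \<rho> (f (x + h *\<^sub>R ?a))
      - \<rho> (f (x + h *\<^sub>R ?b)) + \<rho> (f x)"
    by (simp add: F_def algebra_simps)
  ultimately show ?thesis using s t by (intro exI[of _ s] exI[of _ t]) auto
qed

lemma second_difference_limit:
  fixes f :: "real^'n \<Rightarrow> complex"
  assumes f: "smooth f" and \<rho>: "bounded_linear \<rho>"
  defines "h n \<equiv> inverse (real (Suc n))"
  shows "(\<lambda>n. (\<rho> (f (x + h n *\<^sub>R axis i 1 + h n *\<^sub>R axis j 1)) - \<rho> (f (x + h n *\<^sub>R axis i 1))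
      - \<rho> (f (x + h n *\<^sub>R axis j 1)) + \<rho> (f x)) / (h n)\<^sup>2)
    \<longlonglongrightarrow> \<rho> (partial_deriv j (partial_deriv i f) x)"
proof -
  let ?a = "axis i (1::real) :: real^'n" and ?b = "axis j (1::real) :: real^'n"
  let ?D = "\<lambda>n. \<rho> (f (x + h n *\<^sub>R ?a + h n *\<^sub>R ?b)) - \<rho> (f (x + h n *\<^sub>R ?a))
      - \<rho> (f (x + h n *\<^sub>R ?b)) + \<rho> (f x)"
  let ?g = "partial_deriv j (partial_deriv i f)"
  have h: "h n > 0" for n by (simp add: h_def)
  have "\<forall>n. \<exists>st. 0 < fst st \<and> fst st < h n \<and> 0 < snd st \<and> snd st < h n \<and>
      ?D n = (h n)\<^sup>2 * \<rho> (?g (x + fst st *\<^sub>R ?a + snd st *\<^sub>R ?b))"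
    using second_difference[OF f \<rho> h] by simp
  then obtain st where st: "\<And>n. 0 < fst (st n) \<and> fst (st n) < h n \<and> 0 < snd (st n) \<and> snd (st n) < h n \<and>
      ?D n = (h n)\<^sup>2 * \<rho> (?g (x + fst (st n) *\<^sub>R ?a + snd (st n) *\<^sub>R ?b))"
    by metis
  have h0: "h \<longlonglongrightarrow> 0" unfolding h_def by (rule LIMSEQ_inverse_real_of_nat)
  have s0: "(\<lambda>n. fst (st n)) \<longlonglongrightarrow> 0"
    by (rule tendsto_sandwich[OF _ _ tendsto_const h0]) (use st in \<open>auto intro!: always_eventually less_imp_le\<close>)
  have t0: "(\<lambda>n. snd (st n)) \<longlonglongrightarrow> 0"
    by (rule tendsto_sandwich[OF _ _ tendsto_const h0]) (use st in \<open>auto intro!: always_eventually less_imp_le\<close>)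
  have "(\<lambda>n. x + fst (st n) *\<^sub>R ?a + snd (st n) *\<^sub>R ?b) \<longlonglongrightarrow> x + 0 *\<^sub>R ?a + 0 *\<^sub>R ?b"
    by (intro tendsto_intros s0 t0)
  then have "(\<lambda>n. ?g (x + fst (st n) *\<^sub>R ?a + snd (st n) *\<^sub>R ?b)) \<longlonglongrightarrow> ?g x"
    using smooth_differentiable[OF smooth_partial_deriv[OF smooth_partial_deriv[OF f]], THEN differentiable_imp_continuous_within]
    by (intro isCont_tendsto_compose[where g = ?g]) auto
  then have "(\<lambda>n. \<rho> (?g (x + fst (st n) *\<^sub>R ?a + snd (st n) *\<^sub>R ?b))) \<longlonglongrightarrow> \<rho> (?g x)"
    by (rule bounded_linear.tendsto[OF \<rho>])
  moreover have "?D n / (h n)\<^sup>2 = \<rho> (?g (x + fst (st n) *\<^sub>R ?a + snd (st n) *\<^sub>R ?b))" for n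
    using st[of n] h[of n] by simp
  ultimately show ?thesis by simp
qed

text \<open>Schwarz: both mixed derivatives are limits of the same second difference quotients.\<close>

lemma partial_deriv_commute:
  assumes "smooth f"
  shows "partial_deriv i (partial_deriv j f) = partial_deriv j (partial_deriv i f)"
proof
  fix x
  have "\<rho> (partial_deriv i (partial_deriv j f) x) = \<rho> (partial_deriv j (partial_deriv i f) x)"
    if "bounded_linear \<rho>" for \<rho> :: "complex \<Rightarrow> real"
    by (rule LIMSEQ_unique[OF second_difference_limit[OF assms that]])
       (use second_difference_limit[OF assms that, of x i j] in \<open>simp add: algebra_simps\<close>)
  from this[OF bounded_linear_Re] this[OF bounded_linear_Im]
  show "partial_deriv i (partial_deriv j f) x = partial_deriv j (partial_deriv i f) x"
    by (simp add: complex_eq_iff)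
qed

lemma partial_deriv_foldr_commute:
  "smooth f \<Longrightarrow> partial_deriv i (foldr partial_deriv is f) = foldr partial_deriv is (partial_deriv i f)"
  by (induction "is") (auto simp: partial_deriv_commute[OF smooth_foldr])

text \<open>Iterated partial derivatives depend only on how often each direction occurs. In
  particular the choice in the definition of \<open>classical_deriv\<close> is immaterial.\<close>

lemma foldr_partial_deriv_cong:
  assumes "smooth f" "\<And>i. count_list is i = count_list js i"
  shows "foldr partial_deriv is f = foldr partial_deriv js f"
  using assms(2)
proof (induction "is" arbitrary: js)
  case Nil
  then have "\<forall>i. i \<notin> set js" by (simp flip: count_list_0_iff)
  then show ?case by (cases js) auto
next
  case (Cons i "is")
  then have "i \<in> set js"
    by (metis count_list_0_iff list.set_intros(1))
  then obtain as bs where js: "js = as @ i # bs" by (meson split_list)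
  have "count_list is k = count_list (as @ bs) k" for k
    using Cons.prems[of k] by (auto simp: js split: if_splits)
  then have "foldr partial_deriv is f = foldr partial_deriv (as @ bs) f" by (rule Cons.IH)
  then show ?case
    using partial_deriv_foldr_commute[OF smooth_foldr[OF assms(1)]] by (simp add: js)
qed

lemma mi_list_exists:
  fixes \<alpha> :: "'n::finite \<Rightarrow> nat"
  shows "\<exists>is. \<forall>i. count_list is i = \<alpha> i"
proof -
  have repl: "count_list (replicate n a) i = (if i = a then n else 0)" for n and a i :: 'n
    by (induction n) auto
  have "\<exists>is. \<forall>i. count_list is i = (if i \<in> A then \<alpha> i else 0)" for A :: "'n set"
    using finite[of A]
  proof (induction A rule: finite_induct)
    case empty
    then show ?case by (intro exI[of _ "[]"]) simp
  next
    case (insert a A)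
    then obtain "is" where "\<forall>i. count_list is i = (if i \<in> A then \<alpha> i else 0)" by blast
    with insert.hyps show ?case by (intro exI[of _ "replicate (\<alpha> a) a @ is"]) (simp add: repl)
  qed
  from this[of UNIV] show ?thesis by simp
qed

lemma mi_order_eq_length: "(\<And>i. count_list is i = \<alpha> i) \<Longrightarrow> mi_order \<alpha> = length is"
  using sum_count_set[of "is" UNIV] by (simp add: mi_order_def)

lemma classical_deriv_list:
  obtains "is" where "\<And>i. count_list is i = \<alpha> i" "length is = mi_order \<alpha>"
    "classical_deriv \<alpha> = foldr partial_deriv is"
proof -
  let ?is = "SOME is. \<forall>i. count_list is i = \<alpha> i"
  have *: "count_list ?is i = \<alpha> i" for i
    using someI_ex[OF mi_list_exists[of \<alpha>]] by blast
  show ?thesis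
    by (rule that[OF *]) (auto simp: mi_order_eq_length[OF *] classical_deriv_def)
qed

lemma classical_deriv_eq:
  assumes "smooth f" "\<And>i. count_list is i = \<alpha> i"
  shows "classical_deriv \<alpha> f = foldr partial_deriv is f"
proof (rule classical_deriv_list[of \<alpha>])
  fix js assume "\<And>i. count_list js i = \<alpha> i" "classical_deriv \<alpha> = foldr partial_deriv js"
  then show ?thesis using foldr_partial_deriv_cong[OF assms(1), of js "is"] assms(2) by simp
qed

lemma classical_deriv_cnj:
  "smooth f \<Longrightarrow> classical_deriv \<alpha> (\<lambda>x. cnj (f x)) = (\<lambda>x. cnj (classical_deriv \<alpha> f x))"
  by (simp add: classical_deriv_def foldr_partial_deriv_cnj)

lemma classical_deriv_double:
  assumes "smooth f"
  shows "classical_deriv \<alpha> (classical_deriv \<alpha> f) = classical_deriv (\<lambda>i. 2 * \<alpha> i) f"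
proof (rule classical_deriv_list[of \<alpha>])
  fix "is" assume *: "\<And>i. count_list is i = \<alpha> i" "classical_deriv \<alpha> = foldr partial_deriv is"
  have "classical_deriv (\<lambda>i. 2 * \<alpha> i) f = foldr partial_deriv (is @ is) f"
    by (rule classical_deriv_eq[OF assms]) (simp add: *(1))
  then show ?thesis by (simp add: *(2))
qed

lemma classical_deriv_zero_index: "smooth f \<Longrightarrow> classical_deriv (\<lambda>i. 0) f = f"
  using classical_deriv_eq[of f "[]"] by simp

section \<open>Test functions\<close>

lemma test_functionsI:
  assumes "smooth f" "compact K" "K \<subseteq> \<Omega>" "\<And>x. x \<notin> K \<Longrightarrow> f x = 0"
  shows "f \<in> test_functions \<Omega>"
proof -
  have "closure {x. f x \<noteq> 0} \<subseteq> K"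
    using assms(4) by (intro closure_minimal compact_imp_closed assms(2)) auto
  moreover from this have "compact (closure {x. f x \<noteq> 0})"
    using compact_Int_closed[OF assms(2) closed_closure, of "{x. f x \<noteq> 0}"] by (simp add: Int_absorb1)
  ultimately show ?thesis using assms by (auto simp: test_functions_def)
qed

lemma test_functionsE:
  assumes "f \<in> test_functions \<Omega>"
  obtains K where "compact K" "K \<subseteq> \<Omega>" "\<And>x. x \<notin> K \<Longrightarrow> f x = 0"
  by (rule that[of "closure {x. f x \<noteq> 0}"])
     (use assms closure_subset[of "{x. f x \<noteq> 0}"] in \<open>auto simp: test_functions_def\<close>)

lemma test_smooth: "f \<in> test_functions \<Omega> \<Longrightarrow> smooth f"
  by (simp add: test_functions_def)

lemma test_functions_mono: "\<Omega> \<subseteq> \<Omega>' \<Longrightarrow> test_functions \<Omega> \<subseteq> test_functions \<Omega>'"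
  by (auto simp: test_functions_def)

lemma test_partial_deriv:
  assumes "f \<in> test_functions \<Omega>"
  shows "partial_deriv i f \<in> test_functions \<Omega>"
proof -
  obtain K where K: "compact K" "K \<subseteq> \<Omega>" "\<And>x. x \<notin> K \<Longrightarrow> f x = 0"
    using test_functionsE[OF assms] by blast
  have "partial_deriv i f x = 0" if "x \<notin> K" for x
  proof -
    have "(f has_derivative (\<lambda>h. 0)) (at x)"
      by (rule has_derivative_transform_within_open[of "\<lambda>x. 0" _ _ _ "- K"])
         (use that K compact_imp_closed[OF K(1)] in auto)
    from partial_derivI[OF this] show ?thesis .
  qed
  then show ?thesis
    using K smooth_partial_deriv[OF test_smooth[OF assms]] by (intro test_functionsI)
qed

lemma test_foldr:
  "f \<in> test_functions \<Omega> \<Longrightarrow> foldr partial_deriv is f \<in> test_functions \<Omega>"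
  by (induction "is") (auto simp: test_partial_deriv)

lemma test_classical_deriv:
  "f \<in> test_functions \<Omega> \<Longrightarrow> classical_deriv \<alpha> f \<in> test_functions \<Omega>"
  by (simp add: classical_deriv_def test_foldr)

lemma test_mult_smooth:
  assumes "smooth g" "f \<in> test_functions \<Omega>"
  shows "(\<lambda>x. g x * f x) \<in> test_functions \<Omega>"
  by (rule test_functionsE[OF assms(2)], rule test_functionsI)
     (auto simp: assms(1) smooth_mult test_smooth[OF assms(2)])

lemma test_zero: "(\<lambda>x. 0) \<in> test_functions \<Omega>"
  by (rule test_functionsI[of _ "{}"]) (auto simp: smooth_const)

lemma test_add:
  assumes "f \<in> test_functions \<Omega>" "g \<in> test_functions \<Omega>"
  shows "(\<lambda>x. f x + g x) \<in> test_functions \<Omega>"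
proof -
  obtain K where K: "compact K" "K \<subseteq> \<Omega>" "\<And>x. x \<notin> K \<Longrightarrow> f x = 0"
    using test_functionsE[OF assms(1)] by blast
  obtain L where L: "compact L" "L \<subseteq> \<Omega>" "\<And>x. x \<notin> L \<Longrightarrow> g x = 0"
    using test_functionsE[OF assms(2)] by blast
  show ?thesis
    by (rule test_functionsI[of _ "K \<union> L"])
       (use K L assms in \<open>auto simp: smooth_add test_smooth\<close>)
qed

lemma test_scale: "f \<in> test_functions \<Omega> \<Longrightarrow> (\<lambda>x. c * f x) \<in> test_functions \<Omega>"
  by (simp add: test_mult_smooth smooth_const)

lemma test_cnj:
  assumes "f \<in> test_functions \<Omega>"
  shows "(\<lambda>x. cnj (f x)) \<in> test_functions \<Omega>"
  by (rule test_functionsE[OF assms], rule test_functionsI)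
     (auto simp: smooth_cnj test_smooth[OF assms])

subsection \<open>Integration by parts\<close>

lemma smooth_borel: "smooth f \<Longrightarrow> f \<in> borel_measurable borel"
  by (simp add: borel_measurable_continuous_onI smooth_continuous_on)

lemma test_integrable:
  assumes "f \<in> test_functions \<Omega>"
  shows "integrable lborel f"
proof -
  obtain K where K: "compact K" "K \<subseteq> \<Omega>" "\<And>x. x \<notin> K \<Longrightarrow> f x = 0"
    using test_functionsE[OF assms] by blast
  have "integrable lborel (\<lambda>x. indicator K x *\<^sub>R f x)"
    by (rule borel_integrable_compact[OF K(1) smooth_continuous_on[OF test_smooth[OF assms]]])
  moreover have "(\<lambda>x. indicator K x *\<^sub>R f x) = f"
    using K(3) by (auto simp: fun_eq_iff indicator_def)
  ultimately show ?thesis by simp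
qed

lemma test_bounded:
  assumes "f \<in> test_functions \<Omega>"
  obtains B where "\<And>x. cmod (f x) \<le> B"
proof -
  obtain K where K: "compact K" "K \<subseteq> \<Omega>" "\<And>x. x \<notin> K \<Longrightarrow> f x = 0"
    using test_functionsE[OF assms] by blast
  have "bounded (f ` K)"
    by (rule compact_imp_bounded[OF compact_continuous_image[OF smooth_continuous_on[OF test_smooth[OF assms]] K(1)]])
  then obtain B where B: "\<And>x. x \<in> K \<Longrightarrow> cmod (f x) \<le> B" by (auto simp: bounded_iff)
  have "cmod (f x) \<le> max B 0" for x
    using B[of x] K(3)[of x] by (cases "x \<in> K") auto
  then show ?thesis by (rule that)
qed

text \<open>The integral is invariant under translations, so the integral of every difference
  quotient vanishes; the quotients converge dominatedly.\<close>

lemma integral_partial_deriv_eq_0: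
  fixes f :: "real^'n \<Rightarrow> complex"
  assumes "f \<in> test_functions \<Omega>"
  shows "(LINT x|lborel. partial_deriv i f x) = 0"
proof -
  let ?a = "axis i (1::real) :: real^'n"
  define h where "h n = inverse (real (Suc n))" for n
  define q where "q n x = (f (x + h n *\<^sub>R ?a) - f x) / of_real (h n)" for n x
  have h: "h n > 0" "h n \<le> 1" for n by (auto simp: h_def inverse_le_1_iff)
  have h0: "h \<longlonglongrightarrow> 0" unfolding h_def by (rule LIMSEQ_inverse_real_of_nat)
  have sm: "smooth f" using assms by (rule test_smooth)
  obtain K where K: "compact K" "K \<subseteq> \<Omega>" "\<And>x. x \<notin> K \<Longrightarrow> f x = 0"
    using test_functionsE[OF assms] by blast
  obtain R where R: "\<And>x. x \<in> K \<Longrightarrow> norm x \<le> R"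
    using compact_imp_bounded[OF K(1)] by (auto simp: bounded_iff)
  obtain B where B: "\<And>x. cmod (partial_deriv i f x) \<le> B"
    using test_bounded[OF test_partial_deriv[OF assms]] by blast
  have shift: "integrable lborel (\<lambda>x. f (x + c)) \<and> (LINT x|lborel. f (x + c)) = (LINT x|lborel. f x)" for c
  proof -
    have [measurable]: "f \<in> borel_measurable borel" using sm by (rule smooth_borel)
    have "integrable (distr lborel borel ((+) c)) f"
      using test_integrable[OF assms] by (simp add: lborel_distr_plus)
    then have "integrable lborel (\<lambda>x. f (c + x))"
      by (subst (asm) integrable_distr_eq) auto
    moreover have "(LINT x|lborel. f (c + x)) = (LINT x|distr lborel borel ((+) c). f x)"
      by (rule integral_distr[symmetric]) auto
    ultimately show ?thesis by (simp add: lborel_distr_plus add.commute)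
  qed
  have q0: "(LINT x|lborel. q n x) = 0" for n
    unfolding q_def using shift test_integrable[OF assms] by simp
  have lim: "(\<lambda>n. q n x) \<longlonglongrightarrow> partial_deriv i f x" for x
  proof -
    have "(\<lambda>n. (\<rho> (f (x + h n *\<^sub>R ?a)) - \<rho> (f x)) / h n) \<longlonglongrightarrow> \<rho> (partial_deriv i f x)"
      if "bounded_linear \<rho>" for \<rho> :: "complex \<Rightarrow> real"
    proof -
      have "(\<lambda>s. (\<rho> (f (x + s *\<^sub>R ?a)) - \<rho> (f x)) / s) \<midarrow>0\<rightarrow> \<rho> (partial_deriv i f x)"
        using line_has_real_derivative[OF sm that, of x i 0] by (simp add: DERIV_def)
      then show ?thesis
        by (rule filterlim_compose) (use h h0 in \<open>auto simp: filterlim_at less_imp_neq[symmetric]\<close>)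
    qed
    from this[OF bounded_linear_Re] this[OF bounded_linear_Im] show ?thesis
      by (simp add: tendsto_complex_iff q_def)
  qed
  have bound: "cmod (q n x) \<le> indicator (cball 0 (R + 1)) x * B" for n x
  proof (cases "norm x \<le> R + 1")
    case False
    have "x \<notin> K" using R[of x] False by auto
    moreover have "norm x \<le> norm (x + h n *\<^sub>R ?a) + h n"
      using norm_triangle_ineq4[of "x + h n *\<^sub>R ?a" "h n *\<^sub>R ?a"] h[of n] by simp
    then have "x + h n *\<^sub>R ?a \<notin> K" using R[of "x + h n *\<^sub>R ?a"] False h(2)[of n] by auto
    ultimately show ?thesis using K(3) False by (simp add: q_def)
  next
    case True
    have "cmod (f (x + h n *\<^sub>R ?a) - f (x + 0 *\<^sub>R ?a)) \<le> B * h n - B * 0"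
      by (rule differentiable_bound_general[where f = "\<lambda>s. f (x + s *\<^sub>R ?a)" and \<phi> = "\<lambda>s. B * s"
            and f' = "\<lambda>s. partial_deriv i f (x + s *\<^sub>R ?a)" and \<phi>' = "\<lambda>s. B"])
         (use h B in \<open>auto intro!: line_has_vector_derivative[OF sm] derivative_eq_intros
            continuous_intros continuous_on_compose2[OF smooth_continuous_on[OF sm, of UNIV]]
            simp: has_real_derivative_iff_has_vector_derivative[symmetric]\<close>)
    then show ?thesis using True h[of n]
      by (simp add: q_def norm_divide divide_le_eq mult.commute)
  qed
  have "(\<lambda>n. LINT x|lborel. q n x) \<longlonglongrightarrow> (LINT x|lborel. partial_deriv i f x)"
  proof (rule integral_dominated_convergence[where w = "\<lambda>x. indicator (cball 0 (R + 1)) x * B"])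
    show "partial_deriv i f \<in> borel_measurable lborel"
      using smooth_borel[OF smooth_partial_deriv[OF sm]] by simp
    have [measurable]: "f \<in> borel_measurable borel" using sm by (rule smooth_borel)
    show "q n \<in> borel_measurable lborel" for n unfolding q_def by measurable
    show "integrable lborel (\<lambda>x. indicator (cball 0 (R + 1)) x * B)"
      by (intro integrable_mult_left integrable_real_indicator emeasure_bounded_finite) auto
  qed (use lim bound in auto)
  then show ?thesis by (simp add: q0 LIMSEQ_const_iff)
qed

lemma integration_by_parts:
  assumes "smooth f" "g \<in> test_functions \<Omega>"
  shows "(LINT x|lborel. partial_deriv i f x * g x) = - (LINT x|lborel. f x * partial_deriv i g x)"
proof -
  have fg: "(\<lambda>x. f x * g x) \<in> test_functions \<Omega>" using assms by (rule test_mult_smooth)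
  have "integrable lborel (\<lambda>x. partial_deriv i f x * g x)" "integrable lborel (\<lambda>x. f x * partial_deriv i g x)"
    using assms by (auto intro!: test_integrable test_mult_smooth smooth_partial_deriv test_partial_deriv)
  then have "(LINT x|lborel. partial_deriv i f x * g x) + (LINT x|lborel. f x * partial_deriv i g x)
      = (LINT x|lborel. partial_deriv i f x * g x + f x * partial_deriv i g x)"
    by simp
  also have "\<dots> = (LINT x|lborel. partial_deriv i (\<lambda>x. f x * g x) x)"
    using assms by (simp add: partial_deriv_mult smooth_differentiable test_smooth)
  also have "\<dots> = 0" by (rule integral_partial_deriv_eq_0[OF fg])
  finally show ?thesis by (simp add: eq_neg_iff_add_eq_0)
qed

lemma integration_by_parts_foldr:
  assumes "smooth f" "g \<in> test_functions \<Omega>"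
  shows "(LINT x|lborel. foldr partial_deriv is f x * g x)
    = (-1) ^ length is * (LINT x|lborel. f x * foldr partial_deriv (rev is) g x)"
  using assms(2)
proof (induction "is" arbitrary: g)
  case (Cons i "is")
  then show ?case
    using integration_by_parts[OF smooth_foldr[OF assms(1)] Cons.prems, of i "is"]
      Cons.IH[OF test_partial_deriv[OF Cons.prems, of i]] by simp
qed simp

lemma integration_by_parts_classical:
  assumes "smooth f" "g \<in> test_functions \<Omega>"
  shows "(LINT x|lborel. classical_deriv \<alpha> f x * g x)
    = (-1) ^ mi_order \<alpha> * (LINT x|lborel. f x * classical_deriv \<alpha> g x)"
proof (rule classical_deriv_list[of \<alpha>])
  fix "is" assume *: "\<And>i. count_list is i = \<alpha> i" "length is = mi_order \<alpha>"
    "classical_deriv \<alpha> = foldr partial_deriv is"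
  have "foldr partial_deriv (rev is) g = foldr partial_deriv is g"
    by (rule foldr_partial_deriv_cong[OF test_smooth[OF assms(2)]]) simp
  with integration_by_parts_foldr[OF assms, of "is"] show ?thesis by (simp add: *)
qed

lemma integral_lebesgue_on_eq:
  fixes f :: "real^'n \<Rightarrow> complex"
  assumes "open \<Omega>" "f \<in> borel_measurable borel" "\<And>x. x \<notin> \<Omega> \<Longrightarrow> f x = 0"
  shows "(LINT x|lebesgue_on \<Omega>. f x) = (LINT x|lborel. f x)"
proof -
  have "(LINT x|lebesgue_on \<Omega>. f x) = (LINT x|lebesgue. indicator \<Omega> x *\<^sub>R f x)"
    using assms(1) by (subst integral_restrict_space) auto
  also have "(\<lambda>x. indicator \<Omega> x *\<^sub>R f x) = f"
    using assms(3) by (auto simp: fun_eq_iff indicator_def)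
  also have "(LINT x|lebesgue. f x) = (LINT x|lborel. f x)"
    using assms(2) by (simp add: integral_completion)
  finally show ?thesis .
qed

lemma test_integral_lebesgue_on:
  assumes "open \<Omega>" "f \<in> test_functions \<Omega>"
  shows "(LINT x|lebesgue_on \<Omega>. f x) = (LINT x|lborel. f x)"
  by (rule test_functionsE[OF assms(2)], rule integral_lebesgue_on_eq)
     (auto intro: assms smooth_borel test_smooth[OF assms(2)])

lemma test_L2:
  assumes "open \<Omega>" "f \<in> test_functions \<Omega>"
  shows "f \<in> L2_space \<Omega>"
proof -
  have 1: "f \<in> borel_measurable (lebesgue_on \<Omega>)"
    using smooth_borel[OF test_smooth[OF assms(2)]]
    by (intro measurable_restrict_space1 measurable_completion) simp
  have "integrable lborel (\<lambda>x. cnj (f x) * f x)"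
    by (rule test_integrable[OF test_mult_smooth[OF smooth_cnj[OF test_smooth[OF assms(2)]] assms(2)]])
  then have "integrable lborel (\<lambda>x. Re (cnj (f x) * f x))" by (rule integrable_Re)
  moreover have "Re (cnj (f x) * f x) = (cmod (f x))\<^sup>2" for x
    unfolding cmod_power2 by (simp add: power2_eq_square)
  ultimately have "integrable lborel (\<lambda>x. (cmod (f x))\<^sup>2)" by simp
  then have "integrable lebesgue (\<lambda>x. (cmod (f x))\<^sup>2)"
    by (subst integrable_completion) (use smooth_borel[OF test_smooth[OF assms(2)]] in measurable)
  then have "integrable (lebesgue_on \<Omega>) (\<lambda>x. (cmod (f x))\<^sup>2)"
    using assms(1) integrable_mult_indicator[of \<Omega> lebesgue "\<lambda>x. (cmod (f x))\<^sup>2"]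
    by (simp add: integrable_restrict_space)
  with 1 show ?thesis by (simp add: L2_space_def)
qed

subsection \<open>Bump functions\<close>

text \<open>The functions \<open>exp (- 1 / t) / t ^ n\<close>, extended by \<open>0\<close> to \<open>t \<le> 0\<close>. The family is indexed
  by \<open>n\<close> because it is closed under differentiation up to linear combinations.\<close>

definition flat :: "nat \<Rightarrow> real \<Rightarrow> real" where
  "flat n t = (if t > 0 then exp (- 1 / t) / t ^ n else 0)"

text \<open>The quadratic bound makes \<open>flat n\<close> differentiable at \<open>0\<close>. It comes from \<open>exp s \<ge> (s / k)
  ^ k\<close> with \<open>s = 1 / t\<close> and \<open>k = n + 2\<close>.\<close>

lemma flat_le: "\<bar>flat n t\<bar> \<le> real (n + 2) ^ (n + 2) * t\<^sup>2"
proof (cases "t > 0")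
  case True
  let ?k = "n + 2"
  have "(1 / (real ?k * t)) ^ ?k \<le> exp (1 / t / real ?k) ^ ?k"
    using True exp_ge_add_one_self[of "1 / t / real ?k"]
    by (intro power_mono) (auto simp: field_simps simp del: exp_ge_add_one_self)
  also have "\<dots> = exp (1 / t)" by (rule exp_divide_power_eq) simp
  finally have "inverse (exp (1 / t)) \<le> inverse ((1 / (real ?k * t)) ^ ?k)"
    using True by (intro le_imp_inverse_le) auto
  moreover have "inverse ((1 / a) ^ ?k) = a ^ ?k" for a :: real
    by (simp add: power_divide)
  moreover have "inverse (exp (1 / t)) = exp (- 1 / t)" by (simp flip: exp_minus)
  ultimately have "exp (- 1 / t) \<le> (real ?k * t) ^ ?k" by metis
  also have "\<dots> = (real ?k ^ ?k * t\<^sup>2) * t ^ n"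
    by (simp add: power_mult_distrib power_add power2_eq_square)
  finally show ?thesis using True by (simp add: flat_def divide_le_eq)
qed (simp add: flat_def)

lemma flat_has_derivative:
  "(flat n has_real_derivative (flat (n + 2) t - real n * flat (n + 1) t)) (at t)"
proof -
  consider "t > 0" | "t < 0" | "t = 0" by linarith
  then show ?thesis
  proof cases
    case 1
    have "((\<lambda>t. exp (- 1 / t) * inverse (t ^ n)) has_real_derivative
        (flat (n + 2) t - real n * flat (n + 1) t)) (at t)"
      using 1 by (auto intro!: derivative_eq_intros simp: flat_def field_simps power2_eq_square)
         (cases n; simp add: field_simps)
    then show ?thesis
      by (rule has_field_derivative_transform_within_open[of _ _ _ "{0<..}"])
         (use 1 in \<open>auto simp: flat_def divide_inverse\<close>)
  next
    case 2
    have "(flat n has_real_derivative 0) (at t)"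
      by (rule has_field_derivative_transform_within_open[of "\<lambda>t. 0" _ _ "{..<0}"])
         (use 2 in \<open>auto simp: flat_def\<close>)
    with 2 show ?thesis by (simp add: flat_def)
  next
    case 3
    let ?C = "real (n + 2) ^ (n + 2)"
    have "\<bar>flat n h / h\<bar> \<le> ?C * \<bar>h\<bar>" for h
      using flat_le[of n h] by (cases "h = 0") (auto simp: divide_le_eq power2_eq_square mult.assoc)
    then have "\<forall>\<^sub>F h in at 0. norm (flat n h / h) \<le> ?C * \<bar>h\<bar>"
      by (intro always_eventually allI) (simp only: real_norm_def)
    moreover have "(\<lambda>h. ?C * \<bar>h\<bar>) \<midarrow>0\<rightarrow> 0"
      by (rule tendsto_mult_right_zero[OF tendsto_rabs_zero[OF tendsto_ident_at]])
    ultimately have "(\<lambda>h. flat n h / h) \<midarrow>0\<rightarrow> 0" by (rule Lim_null_comparison)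
    with 3 show ?thesis by (simp add: DERIV_def flat_def)
  qed
qed

text \<open>A smooth function that, for \<open>r \<ge> 0\<close>, is positive on the open ball of radius \<open>r\<close> around
  \<open>c\<close> and vanishes elsewhere.\<close>

definition bump :: "real^'n \<Rightarrow> real \<Rightarrow> nat \<Rightarrow> real^'n \<Rightarrow> complex" where
  "bump c r n x = of_real (flat n (r\<^sup>2 - (x - c) \<bullet> (x - c)))"

lemma bump_has_derivative:
  "(bump c r n has_derivative (\<lambda>h. (bump c r (n + 2) x - of_nat n * bump c r (n + 1) x)
      * of_real (- 2 * ((x - c) \<bullet> h)))) (at x)"
proof -
  let ?q = "\<lambda>x. r\<^sup>2 - (x - c) \<bullet> (x - c)"
  have "(?q has_derivative (\<lambda>h. - 2 * ((x - c) \<bullet> h))) (at x)"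
    by (auto intro!: derivative_eq_intros simp: inner_commute)
  from has_derivative_compose[OF this flat_has_derivative[of n "?q x", unfolded has_field_derivative_def]]
  have "((\<lambda>x. flat n (?q x)) has_derivative
      (\<lambda>h. (flat (n + 2) (?q x) - real n * flat (n + 1) (?q x)) * (- 2 * ((x - c) \<bullet> h)))) (at x)"
    by simp
  from bounded_linear.has_derivative[OF bounded_linear_of_real this]
  show ?thesis by (simp add: bump_def[abs_def])
qed

lemma smooth_bump: "smooth (bump c r n)"
proof -
  have d: "bump c r n differentiable (at x)" for n x
    using bump_has_derivative unfolding differentiable_def by blast
  have pd: "partial_deriv i (bump c r n) = (\<lambda>x. (bump c r (n + 2) x + (- of_nat n) * bump c r (n + 1) x)
      * ((-2) * of_real (axis i 1 \<bullet> x + (- (c $ i)))))" for i n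
  proof
    fix x
    show "partial_deriv i (bump c r n) x = (bump c r (n + 2) x + (- of_nat n) * bump c r (n + 1) x)
      * ((-2) * of_real (axis i 1 \<bullet> x + (- (c $ i))))"
      using partial_derivI[OF bump_has_derivative[of c r n x], of i] by (simp add: inner_axis inner_axis')
  qed
  have "Ck k (bump c r n)" for k n
  proof (induction k arbitrary: n)
    case (Suc k)
    have "Ck k (\<lambda>x. complex_of_real (axis i 1 \<bullet> x + (- (c $ i))))" for i
      using smooth_affine smooth_iff_Ck by blast
    then show ?case
      using Suc d by (simp only: Ck.simps pd) (intro conjI allI Ck_mult Ck_add Ck_const; simp)
  qed (simp add: d)
  then show ?thesis by (simp add: smooth_iff_Ck)
qed

subsection \<open>The fundamental lemma of the calculus of variations\<close>

lemma flat_0_bounds: "0 \<le> flat 0 t" "flat 0 t \<le> 1" "flat 0 t > 0 \<longleftrightarrow> t > 0"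
  by (auto simp: flat_def)

text \<open>If \<open>b\<^sub>0, b\<^sub>1, \<dots>\<close> are bump functions for balls that exhaust \<open>U\<close>, then the test functions
  \<open>1 - (\<Prod>i<n. (1 - b\<^sub>i) ^ n)\<close> converge to the indicator function of \<open>U\<close>.\<close>

lemma indicator_open_approx:
  fixes U :: "(real^'n) set"
  assumes "open U" "U \<noteq> {}"
  obtains p :: "nat \<Rightarrow> real^'n \<Rightarrow> real" where
    "\<And>n. (\<lambda>x. complex_of_real (p n x)) \<in> test_functions U"
    "\<And>n x. 0 \<le> p n x \<and> p n x \<le> indicator U x" "\<And>x. (\<lambda>n. p n x) \<longlonglongrightarrow> indicator U x"
proof -
  define F where "F = {ball c r |c r. r > 0 \<and> cball c r \<subseteq> U}"
  have "\<Union>F = U"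
  proof
    show "U \<subseteq> \<Union>F"
    proof
      fix x assume "x \<in> U"
      then obtain r where "r > 0" "cball x r \<subseteq> U" using assms(1) open_contains_cball by blast
      then show "x \<in> \<Union>F" unfolding F_def by (intro UnionI[of "ball x r"]) auto
    qed
  qed (auto simp: F_def)
  moreover have "\<And>B. B \<in> F \<Longrightarrow> open B" by (auto simp: F_def)
  ultimately obtain F' where F': "F' \<subseteq> F" "countable F'" "\<Union>F' = U"
    using Lindelof[of F] by metis
  have "F' \<noteq> {}" using F'(3) assms(2) by auto
  have "from_nat_into F' i \<in> F" for i
    using from_nat_into[OF \<open>F' \<noteq> {}\<close>] F'(1) by blast
  then have "\<forall>i. \<exists>cr. from_nat_into F' i = ball (fst cr) (snd cr) \<and> snd cr > 0 \<and> cball (fst cr) (snd cr) \<subseteq> U"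
    unfolding F_def by fastforce
  then obtain cr where cr: "\<And>i. from_nat_into F' i = ball (fst (cr i)) (snd (cr i))"
    "\<And>i. snd (cr i) > 0" "\<And>i. cball (fst (cr i)) (snd (cr i)) \<subseteq> U" by metis
  define c where "c i = fst (cr i)" for i
  define r where "r i = snd (cr i)" for i
  have r: "r i > 0" "cball (c i) (r i) \<subseteq> U" for i using cr by (auto simp: c_def r_def)
  have cover: "\<exists>i. x \<in> ball (c i) (r i)" if "x \<in> U" for x
  proof -
    obtain B where B: "B \<in> F'" "x \<in> B" using \<open>x \<in> U\<close> F'(3) by blast
    then have "from_nat_into F' (to_nat_on F' B) = B" using F'(2) by simp
    with cr(1)[of "to_nat_on F' B"] B(2) show ?thesis unfolding c_def r_def by metis
  qed
  define b where "b i x = flat 0 ((r i)\<^sup>2 - (x - c i) \<bullet> (x - c i))" for i x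
  have b: "0 \<le> b i x" "b i x \<le> 1" for i x unfolding b_def by (rule flat_0_bounds)+
  have b_pos: "b i x > 0 \<longleftrightarrow> x \<in> ball (c i) (r i)" for i x
  proof -
    have "b i x > 0 \<longleftrightarrow> (norm (x - c i))\<^sup>2 < (r i)\<^sup>2"
      by (simp add: b_def flat_0_bounds(3) power2_norm_eq_inner)
    also have "\<dots> \<longleftrightarrow> norm (x - c i) < r i"
      using r(1)[of i] by (meson norm_ge_zero power2_less_imp_less power_strict_mono less_imp_le zero_less_numeral)
    finally show ?thesis by (simp add: dist_norm norm_minus_commute)
  qed
  define P where "P n x = (\<Prod>i<n. (1 - b i x) ^ n)" for n x
  have P: "0 \<le> P n x" "P n x \<le> 1" for n x
    unfolding P_def using b by (auto intro!: prod_nonneg prod_le_1 power_le_one)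
  have P_outside: "P n x = 1" if "\<And>i. i < n \<Longrightarrow> x \<notin> ball (c i) (r i)" for n x
  proof -
    have "b i x = 0" if "i < n" for i
      using that \<open>\<And>i. i < n \<Longrightarrow> x \<notin> ball (c i) (r i)\<close> b_pos[of i x] b(1)[of i x] by fastforce
    then show ?thesis by (simp add: P_def)
  qed
  show ?thesis
  proof (rule that[of "\<lambda>n x. 1 - P n x"])
    fix n
    show "(\<lambda>x. complex_of_real (1 - P n x)) \<in> test_functions U"
    proof (rule test_functionsI)
      have "smooth (\<lambda>x. 1 - (\<Prod>i<n. (1 - bump (c i) (r i) 0 x) ^ n))"
        by (intro smooth_diff smooth_const smooth_prod smooth_power smooth_bump)
      then show "smooth (\<lambda>x. complex_of_real (1 - P n x))"
        by (simp add: P_def b_def bump_def)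
      show "compact (\<Union>i<n. cball (c i) (r i))" by (intro compact_UN) auto
      show "(\<Union>i<n. cball (c i) (r i)) \<subseteq> U" using r(2) by blast
      show "complex_of_real (1 - P n x) = 0" if "x \<notin> (\<Union>i<n. cball (c i) (r i))" for x
        using P_outside[of n x] that by force
    qed
  next
    fix n x
    show "0 \<le> 1 - P n x \<and> 1 - P n x \<le> indicator U x"
    proof (cases "x \<in> U")
      case False
      then have "P n x = 1" using r(2) ball_subset_cball by (intro P_outside) blast
      then show ?thesis by simp
    qed (use P in auto)
  next
    fix x
    show "(\<lambda>n. 1 - P n x) \<longlonglongrightarrow> indicator U x"
    proof (cases "x \<in> U")
      case False
      then have "P n x = 1" for n using r(2) ball_subset_cball by (intro P_outside) blast
      with False show ?thesis by simp
    next
      case True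
      then obtain k where "x \<in> ball (c k) (r k)" using cover by blast
      then have k: "b k x > 0" by (simp add: b_pos)
      have "P n x \<le> (1 - b k x) ^ n" if "n > k" for n
      proof -
        have "P n x = (1 - b k x) ^ n * (\<Prod>i\<in>{..<n}-{k}. (1 - b i x) ^ n)"
          unfolding P_def using that by (subst prod.remove[of _ k]) auto
        also have "\<dots> \<le> (1 - b k x) ^ n * 1"
          using b by (intro mult_left_mono prod_le_1) (auto intro!: power_le_one)
        finally show ?thesis by simp
      qed
      then have "\<forall>\<^sub>F n in sequentially. P n x \<le> (1 - b k x) ^ n"
        by (auto simp: eventually_sequentially intro!: exI[of _ "Suc k"])
      moreover have "(\<lambda>n. (1 - b k x) ^ n) \<longlonglongrightarrow> 0"
        using k b[of k x] by (intro LIMSEQ_realpow_zero) auto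
      ultimately have "(\<lambda>n. P n x) \<longlonglongrightarrow> 0"
        using tendsto_sandwich[of "\<lambda>n. 0" "\<lambda>n. P n x" sequentially "\<lambda>n. (1 - b k x) ^ n" 0] P
        by simp
      from tendsto_diff[OF tendsto_const[of 1] this] True show ?thesis by simp
    qed
  qed
qed

lemma L2_indicator:
  assumes "A \<in> sets lebesgue" "bounded A" "\<Omega> \<in> sets lebesgue"
  shows "(\<lambda>x. indicator A x) \<in> L2_space \<Omega>"
proof -
  have "emeasure lebesgue A < \<infinity>"
    using fmeasurableD2[OF bounded_set_imp_lmeasurable[OF assms(2,1)]] by (simp add: less_top)
  then have "integrable lebesgue (indicat_real A)" using assms(1) by simp
  then have "integrable (lebesgue_on \<Omega>) (indicat_real A)"
    using assms(3) integrable_mult_indicator[of \<Omega> lebesgue "indicat_real A"]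
    by (simp add: integrable_restrict_space)
  moreover have "(\<lambda>x. (cmod (indicator A x))\<^sup>2) = indicat_real A"
    by (auto simp: indicator_def)
  moreover have "(\<lambda>x. indicator A x :: complex) \<in> borel_measurable (lebesgue_on \<Omega>)"
    using assms(1) by (intro measurable_restrict_space1) simp
  ultimately show ?thesis by (simp add: L2_space_def)
qed

lemma integral_open_eq_0:
  assumes \<Omega>: "open \<Omega>" and g: "g \<in> L2_space \<Omega>"
    and orth: "\<And>\<phi>. \<phi> \<in> test_functions \<Omega> \<Longrightarrow> (LINT x|lebesgue_on \<Omega>. g x * \<phi> x) = 0"
    and U: "open U" "U \<subseteq> \<Omega>" "bounded U"
  shows "(LINT x|lebesgue_on \<Omega>. g x * indicator U x) = 0"
proof (cases "U = {}")
  case False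
  obtain p :: "nat \<Rightarrow> real^'a \<Rightarrow> real" where p:
    "\<And>n. (\<lambda>x. complex_of_real (p n x)) \<in> test_functions U"
    "\<And>n x. 0 \<le> p n x \<and> p n x \<le> indicator U x" "\<And>x. (\<lambda>n. p n x) \<longlonglongrightarrow> indicator U x"
    using indicator_open_approx[OF U(1) False] by metis
  have test: "(\<lambda>x. complex_of_real (p n x)) \<in> test_functions \<Omega>" for n
    using p(1) test_functions_mono[OF U(2)] by blast
  have int: "integrable (lebesgue_on \<Omega>) (\<lambda>x. g x * indicator U x)"
    using g U \<Omega> by (intro L2_mult_integrable L2_indicator) auto
  have "(\<lambda>n. LINT x|lebesgue_on \<Omega>. g x * complex_of_real (p n x))
      \<longlonglongrightarrow> (LINT x|lebesgue_on \<Omega>. g x * indicator U x)"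
  proof (rule integral_dominated_convergence[where w = "\<lambda>x. norm (g x * indicator U x)"])
    show "integrable (lebesgue_on \<Omega>) (\<lambda>x. norm (g x * indicator U x))"
      using int by (rule integrable_norm)
    show "(\<lambda>x. g x * complex_of_real (p n x)) \<in> borel_measurable (lebesgue_on \<Omega>)" for n
      using L2_mult_integrable[OF g test_L2[OF \<Omega> test]] by (rule borel_measurable_integrable)
    show "AE x in lebesgue_on \<Omega>. (\<lambda>n. g x * complex_of_real (p n x)) \<longlonglongrightarrow> g x * indicator U x"
    proof (rule AE_I2)
      fix x
      have "(\<lambda>n. complex_of_real (p n x)) \<longlonglongrightarrow> complex_of_real (indicator U x)"
        using p(3) by (rule tendsto_of_real)
      moreover have "complex_of_real (indicator U x) = indicator U x" by (simp add: indicator_def)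
      ultimately show "(\<lambda>n. g x * complex_of_real (p n x)) \<longlonglongrightarrow> g x * indicator U x"
        by (intro tendsto_mult_left) simp
    qed
    show "AE x in lebesgue_on \<Omega>. norm (g x * complex_of_real (p n x)) \<le> norm (g x * indicator U x)" for n
    proof (rule AE_I2)
      fix x
      have "\<bar>p n x\<bar> \<le> cmod (indicator U x)" using p(2)[of n x] by (auto simp: indicator_def)
      then show "norm (g x * complex_of_real (p n x)) \<le> norm (g x * indicator U x)"
        by (simp add: norm_mult mult_left_mono)
    qed
  qed (use int borel_measurable_integrable in blast)
  then show ?thesis by (simp add: orth[OF test] LIMSEQ_const_iff)
qed simp

text \<open>A Lebesgue set differs by a null set from a countable intersection of open sets, and the
  intersection may be taken to be decreasing.\<close>

lemma integral_measurable_eq_0: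
  assumes \<Omega>: "open \<Omega>" and g: "g \<in> L2_space \<Omega>"
    and orth: "\<And>\<phi>. \<phi> \<in> test_functions \<Omega> \<Longrightarrow> (LINT x|lebesgue_on \<Omega>. g x * \<phi> x) = 0"
    and A: "A \<in> sets lebesgue" "A \<subseteq> \<Omega>" "bounded A"
  shows "(LINT x|lebesgue_on \<Omega>. g x * indicator A x) = 0"
proof -
  obtain R where R: "\<And>x. x \<in> A \<Longrightarrow> norm x < R"
    using A(3) by (metis bounded_pos gt_ex le_less_trans)
  define W where "W = \<Omega> \<inter> ball 0 R"
  have W: "open W" "bounded W" "A \<subseteq> W" using \<Omega> A(2) R by (auto simp: W_def)
  obtain C T where C: "gdelta C" "T \<in> null_sets lebesgue" "A \<union> T = C" "disjnt A T"
    using lebesgue_set_almost_gdelta[OF A(1)] by blast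
  from C(1) obtain F :: "nat \<Rightarrow> _" where F: "\<And>n. open (F n)" "C = \<Inter>(range F)"
    by (auto elim: gdelta.cases)
  define U where "U n = W \<inter> (\<Inter>i\<le>n. F i)" for n
  have U: "open (U n)" "U n \<subseteq> \<Omega>" "bounded (U n)" for n
    using W F(1) by (auto simp: U_def W_def intro!: open_INT)
  have WC: "W \<inter> C \<in> sets lebesgue"
    using C(2) A(1) W(1) by (metis C(3) borel_open null_setsD2 sets.Int sets.Un sets_completionI_sets sets_lborel)
  have int: "integrable (lebesgue_on \<Omega>) (\<lambda>x. g x * indicator B x)"
    if "B \<in> sets lebesgue" "bounded B" for B
    using g that \<Omega> by (intro L2_mult_integrable L2_indicator) auto
  have "(\<lambda>n. LINT x|lebesgue_on \<Omega>. g x * indicator (U n) x)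
      \<longlonglongrightarrow> (LINT x|lebesgue_on \<Omega>. g x * indicator (W \<inter> C) x)"
  proof (rule integral_dominated_convergence[where w = "\<lambda>x. norm (g x * indicator W x)"])
    show "integrable (lebesgue_on \<Omega>) (\<lambda>x. norm (g x * indicator W x))"
      using W by (intro integrable_norm int) auto
    show "AE x in lebesgue_on \<Omega>. (\<lambda>n. g x * indicator (U n) x) \<longlonglongrightarrow> g x * indicator (W \<inter> C) x"
    proof (rule AE_I2, rule tendsto_mult_left)
      fix x
      show "(\<lambda>n. indicator (U n) x) \<longlonglongrightarrow> (indicator (W \<inter> C) x :: complex)"
      proof (cases "x \<in> W \<inter> C")
        case True
        then show ?thesis by (auto simp: U_def F(2) indicator_def)
      next
        case False
        have "\<exists>N. \<forall>n\<ge>N. x \<notin> U n"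
        proof (cases "x \<in> W")
          case True
          with False obtain N where "x \<notin> F N" by (auto simp: F(2))
          then show ?thesis by (intro exI[of _ N]) (auto simp: U_def)
        qed (auto simp: U_def)
        then have "\<forall>\<^sub>F n in sequentially. indicator (U n) x = (indicator (W \<inter> C) x :: complex)"
          using False by (auto simp: eventually_sequentially indicator_def)
        then show ?thesis by (rule tendsto_eventually)
      qed
    qed
    show "AE x in lebesgue_on \<Omega>. norm (g x * indicator (U n) x) \<le> norm (g x * indicator W x)" for n
      by (auto simp: U_def indicator_def)
    show "(\<lambda>x. g x * indicator (U n) x) \<in> borel_measurable (lebesgue_on \<Omega>)" for n
      using U by (intro borel_measurable_integrable[OF int]) auto
    show "(\<lambda>x. g x * indicator (W \<inter> C) x) \<in> borel_measurable (lebesgue_on \<Omega>)"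
      using WC W(2) by (intro borel_measurable_integrable[OF int]) (auto intro: bounded_subset)
  qed
  moreover have "(LINT x|lebesgue_on \<Omega>. g x * indicator (U n) x) = 0" for n
    using integral_open_eq_0[OF \<Omega> g orth U] by blast
  ultimately have "(LINT x|lebesgue_on \<Omega>. g x * indicator (W \<inter> C) x) = 0"
    by (simp add: LIMSEQ_const_iff)
  moreover have "(LINT x|lebesgue_on \<Omega>. g x * indicator A x) = (LINT x|lebesgue_on \<Omega>. g x * indicator (W \<inter> C) x)"
  proof (rule integral_cong_AE)
    have "AE x in lebesgue. x \<notin> T" using C(2) by (rule AE_not_in)
    then have "AE x in lebesgue_on \<Omega>. x \<notin> T" using \<Omega>
      by (auto simp: AE_restrict_space_iff elim: eventually_mono)
    then show "AE x in lebesgue_on \<Omega>. g x * indicator A x = g x * indicator (W \<inter> C) x"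
      by (rule AE_mp) (use C(3) W(3) in \<open>auto simp: indicator_def\<close>)
    show "(\<lambda>x. g x * indicator A x) \<in> borel_measurable (lebesgue_on \<Omega>)"
      using A by (intro borel_measurable_integrable[OF int]) auto
    show "(\<lambda>x. g x * indicator (W \<inter> C) x) \<in> borel_measurable (lebesgue_on \<Omega>)"
      using WC W(2) by (intro borel_measurable_integrable[OF int]) (auto intro: bounded_subset)
  qed
  ultimately show ?thesis by simp
qed

lemma Re_le_0_of_orthogonal:
  assumes \<Omega>: "open \<Omega>" and g: "g \<in> L2_space \<Omega>"
    and orth: "\<And>\<phi>. \<phi> \<in> test_functions \<Omega> \<Longrightarrow> (LINT x|lebesgue_on \<Omega>. g x * \<phi> x) = 0"
  shows "AE x in lebesgue_on \<Omega>. Re (g x) \<le> 0"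
proof -
  have "AE x in lebesgue_on \<Omega>. norm x < real k \<longrightarrow> Re (g x) \<le> 0" for k :: nat
  proof -
    define A where "A = {x \<in> \<Omega>. norm x < real k \<and> Re (g x) > 0}"
    have [measurable]: "g \<in> borel_measurable (lebesgue_on \<Omega>)" using g by (rule L2_measurable)
    have [measurable]: "norm \<in> borel_measurable (lebesgue_on \<Omega>)"
      by (intro measurable_restrict_space1 measurable_completion) simp
    have "{x \<in> space (lebesgue_on \<Omega>). norm x < real k \<and> Re (g x) > 0} \<in> sets (lebesgue_on \<Omega>)"
      by measurable
    then have "A \<in> sets (lebesgue_on \<Omega>)" by (simp add: A_def)
    then have A: "A \<in> sets lebesgue" using \<Omega> by (simp add: sets_restrict_space_iff)
    have A': "A \<subseteq> \<Omega>" "bounded A"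
      unfolding bounded_iff A_def by (auto intro!: exI[of _ "real k"])
    have int: "integrable (lebesgue_on \<Omega>) (\<lambda>x. g x * indicator A x)"
      using g A A' \<Omega> by (intro L2_mult_integrable L2_indicator) auto
    have "(LINT x|lebesgue_on \<Omega>. Re (g x * indicator A x)) = Re (LINT x|lebesgue_on \<Omega>. g x * indicator A x)"
      using int by (rule integral_Re)
    also have "\<dots> = 0" using integral_measurable_eq_0[OF \<Omega> g orth A A'] by simp
    finally have "AE x in lebesgue_on \<Omega>. Re (g x * indicator A x) = 0"
      using integral_nonneg_eq_0_iff_AE[OF integrable_Re[OF int]]
      by (auto simp: A_def indicator_def)
    then show ?thesis
      by (rule AE_mp) (auto simp: A_def indicator_def split: if_splits)
  qed
  then have "AE x in lebesgue_on \<Omega>. \<forall>k::nat. norm x < real k \<longrightarrow> Re (g x) \<le> 0"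
    unfolding AE_all_countable by blast
  then show ?thesis
    by (rule AE_mp) (auto intro: reals_Archimedean2)
qed

lemma fundamental_lemma:
  assumes \<Omega>: "open \<Omega>" and g: "g \<in> L2_space \<Omega>"
    and orth: "\<And>\<phi>. \<phi> \<in> test_functions \<Omega> \<Longrightarrow> (LINT x|lebesgue_on \<Omega>. g x * \<phi> x) = 0"
  shows "ae_eq \<Omega> g (\<lambda>x. 0)"
proof -
  \<comment> \<open>The multiples \<open>c * g\<close> are orthogonal to the test functions as well.\<close>
  have *: "AE x in lebesgue_on \<Omega>. Re (c * g x) \<le> 0" for c
    by (rule Re_le_0_of_orthogonal[OF \<Omega> L2_scale[OF g]]) (simp add: orth mult.assoc)
  have "AE x in lebesgue_on \<Omega>. Re (1 * g x) \<le> 0 \<and> Re (- 1 * g x) \<le> 0 \<and> Re (\<i> * g x) \<le> 0 \<and> Re (- \<i> * g x) \<le> 0"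
    using *[of 1] *[of "- 1"] *[of \<i>] *[of "- \<i>"] by (simp only: AE_conj_iff)
  then show ?thesis by (rule AE_mp) (auto simp: complex_eq_iff)
qed

section \<open>Weak derivatives and Sobolev spaces\<close>

text \<open>Replacing \<open>\<phi>\<close> by its conjugate expresses weak derivatives by inner products.\<close>

lemma is_weak_deriv_iff:
  "is_weak_deriv \<Omega> \<alpha> u v \<longleftrightarrow> (\<forall>\<phi>\<in>test_functions \<Omega>.
     L2_inner \<Omega> u (classical_deriv \<alpha> \<phi>) = (-1) ^ mi_order \<alpha> * L2_inner \<Omega> v \<phi>)"
proof (intro iffI ballI)
  fix \<phi> assume u: "is_weak_deriv \<Omega> \<alpha> u v" and \<phi>: "\<phi> \<in> test_functions \<Omega>"
  from u test_cnj[OF \<phi>]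
  show "L2_inner \<Omega> u (classical_deriv \<alpha> \<phi>) = (-1) ^ mi_order \<alpha> * L2_inner \<Omega> v \<phi>"
    by (auto simp: is_weak_deriv_def L2_inner_def classical_deriv_cnj[OF test_smooth[OF \<phi>]])
next
  assume *: "\<forall>\<phi>\<in>test_functions \<Omega>.
     L2_inner \<Omega> u (classical_deriv \<alpha> \<phi>) = (-1) ^ mi_order \<alpha> * L2_inner \<Omega> v \<phi>"
  show "is_weak_deriv \<Omega> \<alpha> u v"
    unfolding is_weak_deriv_def
  proof
    fix \<phi> assume \<phi>: "\<phi> \<in> test_functions \<Omega>"
    from bspec[OF * test_cnj[OF \<phi>]]
    show "(LINT x|lebesgue_on \<Omega>. u x * classical_deriv \<alpha> \<phi> x)
        = (-1) ^ mi_order \<alpha> * (LINT x|lebesgue_on \<Omega>. v x * \<phi> x)"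
      by (simp add: L2_inner_def classical_deriv_cnj[OF test_smooth[OF \<phi>]])
  qed
qed

lemma Hm_L2: "u \<in> Hm_space \<Omega> m \<Longrightarrow> u \<in> L2_space \<Omega>"
  by (simp add: Hm_space_def)

lemma weak_deriv:
  assumes "u \<in> Hm_space \<Omega> m" "mi_order \<alpha> \<le> m"
  shows weak_deriv_L2: "weak_deriv \<Omega> \<alpha> u \<in> L2_space \<Omega>"
    and is_weak_deriv_weak_deriv: "is_weak_deriv \<Omega> \<alpha> u (weak_deriv \<Omega> \<alpha> u)"
proof -
  have "\<exists>v. v \<in> L2_space \<Omega> \<and> is_weak_deriv \<Omega> \<alpha> u v" using assms by (auto simp: Hm_space_def)
  from someI_ex[OF this] show "weak_deriv \<Omega> \<alpha> u \<in> L2_space \<Omega>"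
    "is_weak_deriv \<Omega> \<alpha> u (weak_deriv \<Omega> \<alpha> u)"
    by (auto simp: weak_deriv_def)
qed

lemma finite_mi_order_eq: "finite {\<alpha> :: 'n::finite \<Rightarrow> nat. mi_order \<alpha> = m}"
  by (rule finite_subset[OF _ finite_mi_order_le[of m]]) auto

lemma mi_order_zero: "mi_order (\<lambda>i. 0) = 0"
  by (simp add: mi_order_def)

lemma mi_order_double: "mi_order (\<lambda>i. 2 * \<alpha> i) = 2 * mi_order \<alpha>"
  by (simp add: mi_order_def sum_distrib_left)

context
  fixes \<Omega> :: "(real^'n) set"
  assumes \<Omega>: "open \<Omega>"
begin

lemma classical_deriv_L2: "\<phi> \<in> test_functions \<Omega> \<Longrightarrow> classical_deriv \<alpha> \<phi> \<in> L2_space \<Omega>"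
  by (rule test_L2[OF \<Omega> test_classical_deriv])

lemma is_weak_deriv_unique:
  assumes "v \<in> L2_space \<Omega>" "v' \<in> L2_space \<Omega>" "is_weak_deriv \<Omega> \<alpha> u v" "is_weak_deriv \<Omega> \<alpha> u v'"
  shows "ae_eq \<Omega> v v'"
proof -
  have "ae_eq \<Omega> (\<lambda>x. v x - v' x) (\<lambda>x. 0)"
  proof (rule fundamental_lemma[OF \<Omega> L2_diff[OF assms(1,2)]])
    fix \<phi> assume \<phi>: "\<phi> \<in> test_functions \<Omega>"
    have "(LINT x|lebesgue_on \<Omega>. v x * \<phi> x) = (LINT x|lebesgue_on \<Omega>. v' x * \<phi> x)"
      using bspec[OF assms(3)[unfolded is_weak_deriv_def] \<phi>]
        bspec[OF assms(4)[unfolded is_weak_deriv_def] \<phi>] by simp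
    then show "(LINT x|lebesgue_on \<Omega>. (v x - v' x) * \<phi> x) = 0"
      using L2_mult_integrable[OF assms(1) test_L2[OF \<Omega> \<phi>]] L2_mult_integrable[OF assms(2) test_L2[OF \<Omega> \<phi>]]
      by (simp add: left_diff_distrib)
  qed
  then show ?thesis by simp
qed

lemma is_weak_deriv_add:
  assumes "u \<in> L2_space \<Omega>" "u' \<in> L2_space \<Omega>" "v \<in> L2_space \<Omega>" "v' \<in> L2_space \<Omega>"
    and "is_weak_deriv \<Omega> \<alpha> u v" "is_weak_deriv \<Omega> \<alpha> u' v'"
  shows "is_weak_deriv \<Omega> \<alpha> (\<lambda>x. u x + u' x) (\<lambda>x. v x + v' x)"
  using assms unfolding is_weak_deriv_iff
  by (simp add: L2_inner_add_left classical_deriv_L2 test_L2[OF \<Omega>] distrib_left)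

lemma is_weak_deriv_scale:
  "is_weak_deriv \<Omega> \<alpha> u v \<Longrightarrow> is_weak_deriv \<Omega> \<alpha> (\<lambda>x. c * u x) (\<lambda>x. c * v x)"
  unfolding is_weak_deriv_iff by (simp add: L2_inner_scale_left)

lemma is_weak_deriv_limit:
  assumes "\<And>n. f n \<in> L2_space \<Omega>" "g \<in> L2_space \<Omega>" "(\<lambda>n. L2_norm \<Omega> (\<lambda>x. f n x - g x)) \<longlonglongrightarrow> 0"
    and "\<And>n. F n \<in> L2_space \<Omega>" "G \<in> L2_space \<Omega>" "(\<lambda>n. L2_norm \<Omega> (\<lambda>x. F n x - G x)) \<longlonglongrightarrow> 0"
    and "\<And>n. is_weak_deriv \<Omega> \<alpha> (f n) (F n)"
  shows "is_weak_deriv \<Omega> \<alpha> g G"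
  unfolding is_weak_deriv_iff
proof
  fix \<phi> assume \<phi>: "\<phi> \<in> test_functions \<Omega>"
  have "(\<lambda>n. L2_inner \<Omega> (f n) (classical_deriv \<alpha> \<phi>)) \<longlonglongrightarrow> L2_inner \<Omega> g (classical_deriv \<alpha> \<phi>)"
    by (rule L2_limit_inner[OF assms(1-3) classical_deriv_L2[OF \<phi>]])
  moreover have "(\<lambda>n. (-1) ^ mi_order \<alpha> * L2_inner \<Omega> (F n) \<phi>) \<longlonglongrightarrow> (-1) ^ mi_order \<alpha> * L2_inner \<Omega> G \<phi>"
    by (rule tendsto_mult_left[OF L2_limit_inner[OF assms(4-6) test_L2[OF \<Omega> \<phi>]]])
  moreover have "L2_inner \<Omega> (f n) (classical_deriv \<alpha> \<phi>) = (-1) ^ mi_order \<alpha> * L2_inner \<Omega> (F n) \<phi>" for n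
    using assms(7)[of n] \<phi> by (simp add: is_weak_deriv_iff)
  ultimately show "L2_inner \<Omega> g (classical_deriv \<alpha> \<phi>) = (-1) ^ mi_order \<alpha> * L2_inner \<Omega> G \<phi>"
    by (simp add: LIMSEQ_unique)
qed

lemma is_weak_deriv_test:
  assumes "\<phi> \<in> test_functions \<Omega>"
  shows "is_weak_deriv \<Omega> \<alpha> \<phi> (classical_deriv \<alpha> \<phi>)"
  unfolding is_weak_deriv_def
proof
  fix \<psi> assume \<psi>: "\<psi> \<in> test_functions \<Omega>"
  have "(LINT x|lebesgue_on \<Omega>. \<phi> x * classical_deriv \<alpha> \<psi> x) = (LINT x|lborel. \<phi> x * classical_deriv \<alpha> \<psi> x)"
    by (rule test_integral_lebesgue_on[OF \<Omega> test_mult_smooth[OF test_smooth[OF assms] test_classical_deriv[OF \<psi>]]])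
  moreover have "(LINT x|lebesgue_on \<Omega>. classical_deriv \<alpha> \<phi> x * \<psi> x) = (LINT x|lborel. classical_deriv \<alpha> \<phi> x * \<psi> x)"
    by (rule test_integral_lebesgue_on[OF \<Omega> test_mult_smooth[OF test_smooth[OF test_classical_deriv[OF assms]] \<psi>]])
  ultimately show "(LINT x|lebesgue_on \<Omega>. \<phi> x * classical_deriv \<alpha> \<psi> x)
      = (-1) ^ mi_order \<alpha> * (LINT x|lebesgue_on \<Omega>. classical_deriv \<alpha> \<phi> x * \<psi> x)"
    by (simp add: integration_by_parts_classical[OF test_smooth[OF assms] \<psi>] flip: power_mult_distrib)
qed

lemma test_Hm: "\<phi> \<in> test_functions \<Omega> \<Longrightarrow> \<phi> \<in> Hm_space \<Omega> m"
  unfolding Hm_space_def using test_L2[OF \<Omega>] classical_deriv_L2 is_weak_deriv_test by blast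

lemma weak_deriv_ae_eq:
  assumes "u \<in> Hm_space \<Omega> m" "mi_order \<alpha> \<le> m" "v \<in> L2_space \<Omega>" "is_weak_deriv \<Omega> \<alpha> u v"
  shows "ae_eq \<Omega> (weak_deriv \<Omega> \<alpha> u) v"
  by (rule is_weak_deriv_unique[OF weak_deriv_L2[OF assms(1,2)] assms(3)
        is_weak_deriv_weak_deriv[OF assms(1,2)] assms(4)])

lemma weak_deriv_zero_index: "u \<in> Hm_space \<Omega> m \<Longrightarrow> ae_eq \<Omega> (weak_deriv \<Omega> (\<lambda>i. 0) u) u"
  by (rule weak_deriv_ae_eq[of _ m])
     (auto simp: mi_order_zero Hm_L2 is_weak_deriv_iff classical_deriv_zero_index test_smooth)

lemma Hm_add:
  assumes "u \<in> Hm_space \<Omega> m" "v \<in> Hm_space \<Omega> m"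
  shows "(\<lambda>x. u x + v x) \<in> Hm_space \<Omega> m"
  unfolding Hm_space_def
  using L2_add[OF Hm_L2[OF assms(1)] Hm_L2[OF assms(2)]]
    is_weak_deriv_add[OF Hm_L2[OF assms(1)] Hm_L2[OF assms(2)]]
    weak_deriv[OF assms(1)] weak_deriv[OF assms(2)] L2_add by blast

lemma Hm_scale:
  assumes "u \<in> Hm_space \<Omega> m"
  shows "(\<lambda>x. c * u x) \<in> Hm_space \<Omega> m"
  unfolding Hm_space_def
  using L2_scale[OF Hm_L2[OF assms]] is_weak_deriv_scale weak_deriv[OF assms] L2_scale by blast

lemma weak_deriv_add:
  assumes "u \<in> Hm_space \<Omega> m" "v \<in> Hm_space \<Omega> m" "mi_order \<alpha> \<le> m"
  shows "ae_eq \<Omega> (weak_deriv \<Omega> \<alpha> (\<lambda>x. u x + v x)) (\<lambda>x. weak_deriv \<Omega> \<alpha> u x + weak_deriv \<Omega> \<alpha> v x)"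
  using assms
  by (intro weak_deriv_ae_eq[of _ m] Hm_add L2_add is_weak_deriv_add weak_deriv[of _ _ m]) (auto intro: Hm_L2)

lemma weak_deriv_scale:
  assumes "u \<in> Hm_space \<Omega> m" "mi_order \<alpha> \<le> m"
  shows "ae_eq \<Omega> (weak_deriv \<Omega> \<alpha> (\<lambda>x. c * u x)) (\<lambda>x. c * weak_deriv \<Omega> \<alpha> u x)"
  using assms
  by (intro weak_deriv_ae_eq[of _ m] Hm_scale L2_scale is_weak_deriv_scale weak_deriv[of _ _ m])

lemma Hm_diff:
  assumes "u \<in> Hm_space \<Omega> m" "v \<in> Hm_space \<Omega> m"
  shows "(\<lambda>x. u x - v x) \<in> Hm_space \<Omega> m"
  using Hm_add[OF assms(1) Hm_scale[OF assms(2), of "-1"]] by simp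

lemma weak_deriv_diff:
  assumes "u \<in> Hm_space \<Omega> m" "v \<in> Hm_space \<Omega> m" "mi_order \<alpha> \<le> m"
  shows "ae_eq \<Omega> (weak_deriv \<Omega> \<alpha> (\<lambda>x. u x - v x)) (\<lambda>x. weak_deriv \<Omega> \<alpha> u x - weak_deriv \<Omega> \<alpha> v x)"
proof -
  have "ae_eq \<Omega> (weak_deriv \<Omega> \<alpha> (\<lambda>x. u x + (-1) * v x))
      (\<lambda>x. weak_deriv \<Omega> \<alpha> u x + weak_deriv \<Omega> \<alpha> (\<lambda>x. (-1) * v x) x)"
    by (rule weak_deriv_add[OF assms(1) Hm_scale[OF assms(2)] assms(3)])
  from this[simplified] weak_deriv_scale[OF assms(2,3), of "-1", simplified]
  show ?thesis by eventually_elim simp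
qed

lemma weak_deriv_test:
  "\<phi> \<in> test_functions \<Omega> \<Longrightarrow> ae_eq \<Omega> (weak_deriv \<Omega> \<alpha> \<phi>) (classical_deriv \<alpha> \<phi>)"
  by (rule weak_deriv_ae_eq[OF test_Hm order_refl classical_deriv_L2 is_weak_deriv_test])

lemma norm_weak_deriv_diff_test:
  assumes "u \<in> Hm_space \<Omega> m" "\<phi> \<in> test_functions \<Omega>" "mi_order \<alpha> \<le> m"
  shows "L2_norm \<Omega> (weak_deriv \<Omega> \<alpha> (\<lambda>x. u x - \<phi> x)) = L2_norm \<Omega> (\<lambda>x. weak_deriv \<Omega> \<alpha> u x - classical_deriv \<alpha> \<phi> x)"
proof (rule L2_norm_cong_ae)
  show "weak_deriv \<Omega> \<alpha> (\<lambda>x. u x - \<phi> x) \<in> L2_space \<Omega>"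
    by (rule weak_deriv_L2[OF Hm_diff[OF assms(1) test_Hm[OF assms(2)]] assms(3)])
  show "(\<lambda>x. weak_deriv \<Omega> \<alpha> u x - classical_deriv \<alpha> \<phi> x) \<in> L2_space \<Omega>"
    using assms by (intro L2_diff weak_deriv_L2[of _ _ m] classical_deriv_L2)
  show "ae_eq \<Omega> (weak_deriv \<Omega> \<alpha> (\<lambda>x. u x - \<phi> x)) (\<lambda>x. weak_deriv \<Omega> \<alpha> u x - classical_deriv \<alpha> \<phi> x)"
    using weak_deriv_diff[OF assms(1) test_Hm[OF assms(2)] assms(3)] weak_deriv_test[OF assms(2), of \<alpha>]
    by eventually_elim simp
qed

subsection \<open>Approximation by test functions\<close>

lemma H0m_Hm: "u \<in> H0m_space \<Omega> m \<Longrightarrow> u \<in> Hm_space \<Omega> m"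
  by (simp add: H0m_space_def)

lemma H0m_approx:
  assumes "u \<in> H0m_space \<Omega> m" "\<epsilon> > 0"
  obtains \<phi> where "\<phi> \<in> test_functions \<Omega>"
    "\<And>\<alpha>. mi_order \<alpha> \<le> m \<Longrightarrow> L2_norm \<Omega> (\<lambda>x. weak_deriv \<Omega> \<alpha> u x - classical_deriv \<alpha> \<phi> x) < \<epsilon>"
proof -
  obtain \<phi> where \<phi>: "\<phi> \<in> test_functions \<Omega>" "Hm_norm \<Omega> m (\<lambda>x. u x - \<phi> x) < \<epsilon>"
    using assms by (auto simp: H0m_space_def)
  have "L2_norm \<Omega> (\<lambda>x. weak_deriv \<Omega> \<alpha> u x - classical_deriv \<alpha> \<phi> x) < \<epsilon>" if "mi_order \<alpha> \<le> m" for \<alpha>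
  proof -
    have "(L2_norm \<Omega> (weak_deriv \<Omega> \<alpha> (\<lambda>x. u x - \<phi> x)))\<^sup>2
        \<le> (\<Sum>\<alpha> | mi_order \<alpha> \<le> m. (L2_norm \<Omega> (weak_deriv \<Omega> \<alpha> (\<lambda>x. u x - \<phi> x)))\<^sup>2)"
      using that by (intro member_le_sum finite_mi_order_le) auto
    then have "L2_norm \<Omega> (weak_deriv \<Omega> \<alpha> (\<lambda>x. u x - \<phi> x)) \<le> Hm_norm \<Omega> m (\<lambda>x. u x - \<phi> x)"
      unfolding Hm_norm_def by (rule real_le_rsqrt)
    with \<phi>(2) show ?thesis
      by (simp add: norm_weak_deriv_diff_test[OF H0m_Hm[OF assms(1)] \<phi>(1) that])
  qed
  with \<phi>(1) show ?thesis by (rule that)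
qed

lemma H0m_seq:
  assumes "u \<in> H0m_space \<Omega> m"
  obtains \<phi> where "\<And>n. \<phi> n \<in> test_functions \<Omega>"
    "\<And>\<alpha>. mi_order \<alpha> \<le> m \<Longrightarrow>
      (\<lambda>n. L2_norm \<Omega> (\<lambda>x. weak_deriv \<Omega> \<alpha> u x - classical_deriv \<alpha> (\<phi> n) x)) \<longlonglongrightarrow> 0"
proof -
  have "\<exists>\<phi>. \<phi> \<in> test_functions \<Omega> \<and> (\<forall>\<alpha>. mi_order \<alpha> \<le> m \<longrightarrow>
      L2_norm \<Omega> (\<lambda>x. weak_deriv \<Omega> \<alpha> u x - classical_deriv \<alpha> \<phi> x) < inverse (real (Suc n)))" for n
    by (rule H0m_approx[OF assms, of "inverse (real (Suc n))"]) auto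
  then obtain \<phi> where \<phi>: "\<And>n. \<phi> n \<in> test_functions \<Omega>" "\<And>n \<alpha>. mi_order \<alpha> \<le> m \<Longrightarrow>
      L2_norm \<Omega> (\<lambda>x. weak_deriv \<Omega> \<alpha> u x - classical_deriv \<alpha> (\<phi> n) x) < inverse (real (Suc n))"
    by metis
  show ?thesis
  proof (rule that[OF \<phi>(1)])
    fix \<alpha> :: "'n \<Rightarrow> nat" assume \<alpha>: "mi_order \<alpha> \<le> m"
    show "(\<lambda>n. L2_norm \<Omega> (\<lambda>x. weak_deriv \<Omega> \<alpha> u x - classical_deriv \<alpha> (\<phi> n) x)) \<longlonglongrightarrow> 0"
      by (rule tendsto_sandwich[OF _ _ tendsto_const LIMSEQ_inverse_real_of_nat])
         (use less_imp_le[OF \<phi>(2)[OF \<alpha>]] in auto)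
  qed
qed

lemma H0m_I:
  assumes u: "u \<in> Hm_space \<Omega> m" and \<phi>: "\<And>n. \<phi> n \<in> test_functions \<Omega>"
    and lim: "\<And>\<alpha>. mi_order \<alpha> \<le> m \<Longrightarrow>
      (\<lambda>n. L2_norm \<Omega> (\<lambda>x. weak_deriv \<Omega> \<alpha> u x - classical_deriv \<alpha> (\<phi> n) x)) \<longlonglongrightarrow> 0"
  shows "u \<in> H0m_space \<Omega> m"
proof -
  have "(\<lambda>n. \<Sum>\<alpha> | mi_order \<alpha> \<le> m. (L2_norm \<Omega> (weak_deriv \<Omega> \<alpha> (\<lambda>x. u x - \<phi> n x)))\<^sup>2)
      \<longlonglongrightarrow> (\<Sum>\<alpha>\<in>{\<alpha>::'n \<Rightarrow> nat. mi_order \<alpha> \<le> m}. 0\<^sup>2)"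
  proof (intro tendsto_sum tendsto_power)
    fix \<alpha> :: "'n \<Rightarrow> nat" assume "\<alpha> \<in> {\<alpha>. mi_order \<alpha> \<le> m}"
    with lim[of \<alpha>] show "(\<lambda>n. L2_norm \<Omega> (weak_deriv \<Omega> \<alpha> (\<lambda>x. u x - \<phi> n x))) \<longlonglongrightarrow> 0"
      by (simp add: norm_weak_deriv_diff_test[OF u \<phi>])
  qed
  from tendsto_real_sqrt[OF this] have *: "(\<lambda>n. Hm_norm \<Omega> m (\<lambda>x. u x - \<phi> n x)) \<longlonglongrightarrow> 0"
    by (simp add: Hm_norm_def)
  have "\<exists>\<phi>\<in>test_functions \<Omega>. Hm_norm \<Omega> m (\<lambda>x. u x - \<phi> x) < \<epsilon>" if "\<epsilon> > 0" for \<epsilon>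
    using order_tendstoD(2)[OF * that] \<phi> by (auto simp: eventually_sequentially)
  with u show ?thesis by (simp add: H0m_space_def)
qed

text \<open>Closedness of \<open>H\<^sub>0\<^sup>m\<close> in the form needed here: a limit in \<open>H\<^sup>m\<close> of elements of \<open>H\<^sub>0\<^sup>m\<close>
  belongs to \<open>H\<^sub>0\<^sup>m\<close>.\<close>

lemma H0m_closed:
  assumes w: "\<And>n. w n \<in> H0m_space \<Omega> m" and u: "u \<in> Hm_space \<Omega> m"
    and lim: "\<And>\<alpha>. mi_order \<alpha> \<le> m \<Longrightarrow>
      (\<lambda>n. L2_norm \<Omega> (\<lambda>x. weak_deriv \<Omega> \<alpha> (w n) x - weak_deriv \<Omega> \<alpha> u x)) \<longlonglongrightarrow> 0"
  shows "u \<in> H0m_space \<Omega> m"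
proof -
  have "\<exists>\<phi>. \<phi> \<in> test_functions \<Omega> \<and> (\<forall>\<alpha>. mi_order \<alpha> \<le> m \<longrightarrow>
      L2_norm \<Omega> (\<lambda>x. weak_deriv \<Omega> \<alpha> (w n) x - classical_deriv \<alpha> \<phi> x) < inverse (real (Suc n)))" for n
    by (rule H0m_approx[OF w[of n], of "inverse (real (Suc n))"]) auto
  then obtain \<phi> where \<phi>: "\<And>n. \<phi> n \<in> test_functions \<Omega>" "\<And>n \<alpha>. mi_order \<alpha> \<le> m \<Longrightarrow>
      L2_norm \<Omega> (\<lambda>x. weak_deriv \<Omega> \<alpha> (w n) x - classical_deriv \<alpha> (\<phi> n) x) < inverse (real (Suc n))"
    by metis
  show ?thesis
  proof (rule H0m_I[OF u \<phi>(1)])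
    fix \<alpha> :: "'n \<Rightarrow> nat" assume \<alpha>: "mi_order \<alpha> \<le> m"
    have le: "L2_norm \<Omega> (\<lambda>x. weak_deriv \<Omega> \<alpha> u x - classical_deriv \<alpha> (\<phi> n) x)
        \<le> L2_norm \<Omega> (\<lambda>x. weak_deriv \<Omega> \<alpha> (w n) x - weak_deriv \<Omega> \<alpha> u x) + inverse (real (Suc n))" for n
      using L2_norm_triangle_diff[OF weak_deriv_L2[OF u \<alpha>] weak_deriv_L2[OF H0m_Hm[OF w[of n]] \<alpha>]
          classical_deriv_L2[OF \<phi>(1)[of n], of \<alpha>]] \<phi>(2)[OF \<alpha>, of n]
      by (simp add: L2_norm_minus_commute[of \<Omega> "weak_deriv \<Omega> \<alpha> u"])
    have "(\<lambda>n. L2_norm \<Omega> (\<lambda>x. weak_deriv \<Omega> \<alpha> (w n) x - weak_deriv \<Omega> \<alpha> u x) + inverse (real (Suc n))) \<longlonglongrightarrow> 0"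
      using tendsto_add[OF lim[OF \<alpha>] LIMSEQ_inverse_real_of_nat] by simp
    then show "(\<lambda>n. L2_norm \<Omega> (\<lambda>x. weak_deriv \<Omega> \<alpha> u x - classical_deriv \<alpha> (\<phi> n) x)) \<longlonglongrightarrow> 0"
      by (rule tendsto_sandwich[OF _ _ tendsto_const, rotated 2]) (use le in auto)
  qed
qed

lemma classical_deriv_add_scale:
  assumes "smooth f" "smooth g"
  shows "classical_deriv \<alpha> (\<lambda>x. f x + c * g x) = (\<lambda>x. classical_deriv \<alpha> f x + c * classical_deriv \<alpha> g x)"
proof -
  have "foldr partial_deriv is (\<lambda>x. f x + c * g x)
      = (\<lambda>x. foldr partial_deriv is f x + c * foldr partial_deriv is g x)" for "is"
  proof (induction "is")
    case (Cons i "is")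
    have 1: "smooth (foldr partial_deriv is f)" "smooth (foldr partial_deriv is g)"
      using assms by (auto intro: smooth_foldr)
    show ?case
      using smooth_differentiable[OF 1(1)] smooth_differentiable[OF 1(2)]
        smooth_differentiable[OF smooth_scale[OF 1(2)]]
      by (simp add: Cons.IH partial_deriv_add partial_deriv_mult partial_deriv_const)
  qed simp
  then show ?thesis by (simp add: classical_deriv_def)
qed

lemma H0m_add_scale:
  assumes u: "u \<in> H0m_space \<Omega> m" and v: "v \<in> H0m_space \<Omega> m"
  shows "(\<lambda>x. u x + c * v x) \<in> H0m_space \<Omega> m"
proof -
  obtain \<phi> where \<phi>: "\<And>n. \<phi> n \<in> test_functions \<Omega>"
    "\<And>\<alpha>. mi_order \<alpha> \<le> m \<Longrightarrow>
      (\<lambda>n. L2_norm \<Omega> (\<lambda>x. weak_deriv \<Omega> \<alpha> u x - classical_deriv \<alpha> (\<phi> n) x)) \<longlonglongrightarrow> 0"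
    using H0m_seq[OF u] by blast
  obtain \<psi> where \<psi>: "\<And>n. \<psi> n \<in> test_functions \<Omega>"
    "\<And>\<alpha>. mi_order \<alpha> \<le> m \<Longrightarrow>
      (\<lambda>n. L2_norm \<Omega> (\<lambda>x. weak_deriv \<Omega> \<alpha> v x - classical_deriv \<alpha> (\<psi> n) x)) \<longlonglongrightarrow> 0"
    using H0m_seq[OF v] by blast
  note uv = H0m_Hm[OF u] H0m_Hm[OF v]
  have sum: "(\<lambda>x. u x + c * v x) \<in> Hm_space \<Omega> m" using uv by (intro Hm_add Hm_scale)
  show ?thesis
  proof (rule H0m_I[OF sum, where \<phi> = "\<lambda>n x. \<phi> n x + c * \<psi> n x"])
    show "(\<lambda>x. \<phi> n x + c * \<psi> n x) \<in> test_functions \<Omega>" for n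
      by (intro test_add test_scale \<phi> \<psi>)
    fix \<alpha> :: "'n \<Rightarrow> nat" assume \<alpha>: "mi_order \<alpha> \<le> m"
    let ?U = "\<lambda>n x. weak_deriv \<Omega> \<alpha> u x - classical_deriv \<alpha> (\<phi> n) x"
    let ?V = "\<lambda>n x. weak_deriv \<Omega> \<alpha> v x - classical_deriv \<alpha> (\<psi> n) x"
    have L2: "?U n \<in> L2_space \<Omega>" "?V n \<in> L2_space \<Omega>" for n
      using uv \<alpha> \<phi>(1) \<psi>(1) by (auto intro!: L2_diff weak_deriv_L2 classical_deriv_L2)
    have ae: "ae_eq \<Omega> (weak_deriv \<Omega> \<alpha> (\<lambda>x. u x + c * v x)) (\<lambda>x. weak_deriv \<Omega> \<alpha> u x + c * weak_deriv \<Omega> \<alpha> v x)"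
      using weak_deriv_add[OF uv(1) Hm_scale[OF uv(2)] \<alpha>, of c] weak_deriv_scale[OF uv(2) \<alpha>, of c]
      by eventually_elim simp
    have le: "L2_norm \<Omega> (\<lambda>x. weak_deriv \<Omega> \<alpha> (\<lambda>x. u x + c * v x) x - classical_deriv \<alpha> (\<lambda>x. \<phi> n x + c * \<psi> n x) x)
        \<le> L2_norm \<Omega> (?U n) + cmod c * L2_norm \<Omega> (?V n)" for n
    proof -
      have "L2_norm \<Omega> (\<lambda>x. weak_deriv \<Omega> \<alpha> (\<lambda>x. u x + c * v x) x - classical_deriv \<alpha> (\<lambda>x. \<phi> n x + c * \<psi> n x) x)
          = L2_norm \<Omega> (\<lambda>x. ?U n x + c * ?V n x)"
      proof (rule L2_norm_cong_ae)
        show "(\<lambda>x. weak_deriv \<Omega> \<alpha> (\<lambda>x. u x + c * v x) x - classical_deriv \<alpha> (\<lambda>x. \<phi> n x + c * \<psi> n x) x) \<in> L2_space \<Omega>"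
          by (intro L2_diff weak_deriv_L2[OF sum \<alpha>] classical_deriv_L2 test_add test_scale \<phi> \<psi>)
        show "(\<lambda>x. ?U n x + c * ?V n x) \<in> L2_space \<Omega>" by (intro L2_add L2_scale L2)
        show "ae_eq \<Omega> (\<lambda>x. weak_deriv \<Omega> \<alpha> (\<lambda>x. u x + c * v x) x - classical_deriv \<alpha> (\<lambda>x. \<phi> n x + c * \<psi> n x) x)
            (\<lambda>x. ?U n x + c * ?V n x)"
          using ae by eventually_elim
            (simp add: classical_deriv_add_scale[OF test_smooth[OF \<phi>(1)] test_smooth[OF \<psi>(1)]] algebra_simps)
      qed
      also have "\<dots> \<le> L2_norm \<Omega> (?U n) + L2_norm \<Omega> (\<lambda>x. c * ?V n x)"
        by (intro L2_norm_triangle L2_scale L2)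
      finally show ?thesis by (simp only: L2_norm_scale)
    qed
    have "(\<lambda>n. L2_norm \<Omega> (?U n) + cmod c * L2_norm \<Omega> (?V n)) \<longlonglongrightarrow> 0"
      using tendsto_add[OF \<phi>(2)[OF \<alpha>] tendsto_mult_right_zero[OF \<psi>(2)[OF \<alpha>]]] by simp
    then show "(\<lambda>n. L2_norm \<Omega> (\<lambda>x. weak_deriv \<Omega> \<alpha> (\<lambda>x. u x + c * v x) x - classical_deriv \<alpha> (\<lambda>x. \<phi> n x + c * \<psi> n x) x)) \<longlonglongrightarrow> 0"
      by (rule tendsto_sandwich[OF _ _ tendsto_const, rotated 2]) (use le in auto)
  qed
qed

lemma H0m_zero: "(\<lambda>x. 0) \<in> H0m_space \<Omega> m"
proof (rule H0m_I[OF test_Hm[OF test_zero], where \<phi> = "\<lambda>n x. 0"])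
  fix \<alpha> :: "'n \<Rightarrow> nat"
  have "L2_norm \<Omega> (\<lambda>x. weak_deriv \<Omega> \<alpha> (\<lambda>x. 0) x - classical_deriv \<alpha> (\<lambda>x. 0) x) = 0"
    using L2_norm_diff_eq_0_iff[OF weak_deriv_L2[OF test_Hm[OF test_zero] order_refl]
        classical_deriv_L2[OF test_zero]] weak_deriv_test[OF test_zero] by simp
  then show "(\<lambda>n. L2_norm \<Omega> (\<lambda>x. weak_deriv \<Omega> \<alpha> (\<lambda>x. 0) x - classical_deriv \<alpha> (\<lambda>x. 0) x)) \<longlonglongrightarrow> 0"
    by simp
qed (rule test_zero)

lemma H0m_diff:
  "u \<in> H0m_space \<Omega> m \<Longrightarrow> v \<in> H0m_space \<Omega> m \<Longrightarrow> (\<lambda>x. u x - v x) \<in> H0m_space \<Omega> m"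
  using H0m_add_scale[of u m v "-1"] by simp

end

section \<open>The Poincare inequality\<close>

text \<open>On a domain between two hyperplanes with normal \<open>a\<close>, choose \<open>i\<close> with \<open>a\<^sub>i \<noteq> 0\<close>. The
  integral of \<open>\<partial>\<^sub>i (\<theta> \<bar>\<phi>\<bar>\<^sup>2)\<close> vanishes for \<open>\<theta> x = a \<bullet> x - b\<close>, and \<open>\<partial>\<^sub>i \<theta> = a\<^sub>i\<close>.\<close>

lemma poincare_test_partial:
  fixes \<Omega> :: "(real^'n) set"
  assumes \<Omega>: "open \<Omega>" and "finite_width \<Omega>"
  obtains i K where "K \<ge> 1" "\<And>\<phi>. \<phi> \<in> test_functions \<Omega> \<Longrightarrow> L2_norm \<Omega> \<phi> \<le> K * L2_norm \<Omega> (partial_deriv i \<phi>)"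
proof -
  obtain a b c where abc: "a \<noteq> 0" "\<And>x. x \<in> \<Omega> \<Longrightarrow> b \<le> a \<bullet> x \<and> a \<bullet> x \<le> c"
    using assms(2) by (auto simp: finite_width_def)
  obtain i where i: "a $ i \<noteq> 0" using abc(1) by (auto simp: vec_eq_iff)
  define \<theta> where "\<theta> x = complex_of_real (a \<bullet> x + (- b))" for x
  define M where "M = \<bar>c - b\<bar>"
  have \<theta>: "smooth \<theta>" unfolding \<theta>_def by (rule smooth_affine)
  have \<theta>_le: "cmod (\<theta> x) \<le> M" if "x \<in> \<Omega>" for x
    using abc(2)[OF that] unfolding \<theta>_def norm_of_real M_def by linarith
  have le: "\<bar>a $ i\<bar> * L2_norm \<Omega> \<phi> \<le> 2 * M * L2_norm \<Omega> (partial_deriv i \<phi>)"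
    if \<phi>: "\<phi> \<in> test_functions \<Omega>" for \<phi>
  proof -
    let ?d = "partial_deriv i \<phi>"
    have sm: "smooth \<phi>" "smooth ?d" "smooth (\<lambda>x. cnj (\<phi> x))"
      using test_smooth[OF \<phi>] by (auto intro: smooth_partial_deriv smooth_cnj)
    have d: "?d \<in> test_functions \<Omega>" by (rule test_partial_deriv[OF \<phi>])
    have \<theta>d: "(\<lambda>x. \<theta> x * ?d x) \<in> test_functions \<Omega>" by (rule test_mult_smooth[OF \<theta> d])
    note L2 = test_L2[OF \<Omega> \<phi>] test_L2[OF \<Omega> d] test_L2[OF \<Omega> \<theta>d]
    define X where "X = L2_inner \<Omega> (\<lambda>x. \<theta> x * ?d x) \<phi>"
    have prod: "(\<lambda>x. \<theta> x * (cnj (\<phi> x) * \<phi> x)) \<in> test_functions \<Omega>"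
      by (intro test_mult_smooth \<theta> sm(3) \<phi>)
    have pd: "partial_deriv i (\<lambda>x. \<theta> x * (cnj (\<phi> x) * \<phi> x)) x
        = of_real (a $ i) * (\<phi> x * cnj (\<phi> x)) + ((\<theta> x * ?d x) * cnj (\<phi> x) + cnj ((\<theta> x * ?d x) * cnj (\<phi> x)))" for x
    proof -
      have "partial_deriv i \<theta> = (\<lambda>x. of_real (a $ i))"
        unfolding \<theta>_def by (rule partial_deriv_affine)
      moreover have "cnj (\<theta> x) = \<theta> x" by (simp add: \<theta>_def)
      ultimately show ?thesis
        using smooth_differentiable[OF \<theta>] smooth_differentiable[OF sm(1)] smooth_differentiable[OF sm(3)]
          smooth_differentiable[OF smooth_mult[OF sm(3) sm(1)]]
        by (simp add: partial_deriv_mult partial_deriv_cnj algebra_simps)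
    qed
    have "0 = (LINT x|lebesgue_on \<Omega>. partial_deriv i (\<lambda>x. \<theta> x * (cnj (\<phi> x) * \<phi> x)) x)"
      using test_integral_lebesgue_on[OF \<Omega> test_partial_deriv[OF prod]]
        integral_partial_deriv_eq_0[OF prod] by simp
    also have "\<dots> = of_real (a $ i) * L2_inner \<Omega> \<phi> \<phi> + (X + cnj X)"
      unfolding pd X_def L2_inner_def
      using L2_inner_integrable[OF L2(1) L2(1)] L2_inner_integrable[OF L2(3) L2(1)]
        integrable_cnj[OF L2_inner_integrable[OF L2(3) L2(1)]]
      by (simp del: complex_cnj_mult)
    finally have "of_real (a $ i * (L2_norm \<Omega> \<phi>)\<^sup>2) + (X + cnj X) = 0"
      by (simp add: L2_inner_self)
    then have "of_real (a $ i * (L2_norm \<Omega> \<phi>)\<^sup>2) = - (X + cnj X)"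
      by (simp only: eq_neg_iff_add_eq_0)
    then have "cmod (of_real (a $ i * (L2_norm \<Omega> \<phi>)\<^sup>2)) \<le> 2 * cmod X"
      using norm_triangle_ineq[of X "cnj X"] by (simp only: norm_minus_cancel complex_mod_cnj)
    also have "cmod (of_real (a $ i * (L2_norm \<Omega> \<phi>)\<^sup>2)) = \<bar>a $ i\<bar> * (L2_norm \<Omega> \<phi>)\<^sup>2"
      by (simp only: norm_of_real abs_mult abs_power2)
    also have "cmod X \<le> L2_norm \<Omega> (\<lambda>x. \<theta> x * ?d x) * L2_norm \<Omega> \<phi>"
      unfolding X_def by (rule L2_Cauchy_Schwarz[OF L2(3,1)])
    also have "L2_norm \<Omega> (\<lambda>x. \<theta> x * ?d x) \<le> L2_norm \<Omega> (\<lambda>x. of_real M * ?d x)"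
      unfolding L2_norm_def
    proof (intro real_sqrt_le_mono integral_mono)
      show "integrable (lebesgue_on \<Omega>) (\<lambda>x. (cmod (\<theta> x * ?d x))\<^sup>2)"
        "integrable (lebesgue_on \<Omega>) (\<lambda>x. (cmod (of_real M * ?d x))\<^sup>2)"
        by (auto intro!: L2_integrable_sq L2 L2_scale simp del: norm_mult)
      show "(cmod (\<theta> x * ?d x))\<^sup>2 \<le> (cmod (of_real M * ?d x))\<^sup>2" if "x \<in> space (lebesgue_on \<Omega>)" for x
        using \<theta>_le[of x] that by (intro power_mono) (auto simp: norm_mult M_def intro!: mult_right_mono)
    qed
    also have "\<dots> = M * L2_norm \<Omega> ?d"
      by (simp add: L2_norm_scale M_def)
    finally have *: "\<bar>a $ i\<bar> * (L2_norm \<Omega> \<phi>)\<^sup>2 \<le> 2 * (M * L2_norm \<Omega> ?d * L2_norm \<Omega> \<phi>)"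
      by (simp add: mult_right_mono)
    show ?thesis
    proof (cases "L2_norm \<Omega> \<phi> = 0")
      case False
      then have "L2_norm \<Omega> \<phi> > 0" using L2_norm_nonneg[of \<Omega> \<phi>] by linarith
      moreover have "\<bar>a $ i\<bar> * L2_norm \<Omega> \<phi> * L2_norm \<Omega> \<phi> \<le> 2 * M * L2_norm \<Omega> ?d * L2_norm \<Omega> \<phi>"
        using * by (simp add: power2_eq_square mult.assoc)
      ultimately show ?thesis by (rule mult_right_le_imp_le[rotated])
    qed (simp add: M_def)
  qed
  let ?K = "max 1 (2 * M / \<bar>a $ i\<bar>)"
  show ?thesis
  proof (rule that[of ?K i])
    fix \<phi> assume "\<phi> \<in> test_functions \<Omega>"
    from le[OF this] have "L2_norm \<Omega> \<phi> \<le> 2 * M / \<bar>a $ i\<bar> * L2_norm \<Omega> (partial_deriv i \<phi>)"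
      using i by (simp add: field_simps)
    also have "\<dots> \<le> ?K * L2_norm \<Omega> (partial_deriv i \<phi>)"
      by (intro mult_right_mono) auto
    finally show "L2_norm \<Omega> \<phi> \<le> ?K * L2_norm \<Omega> (partial_deriv i \<phi>)" .
  qed simp
qed

text \<open>The inequality is iterated in the one direction \<open>i\<close>, which turns a multi-index \<open>\<alpha>\<close> of
  order at most \<open>m\<close> into one of order exactly \<open>m\<close>. The bound \<open>C \<ge> 1\<close> makes one power of \<open>C\<close>
  serve all \<open>\<alpha>\<close>.\<close>

lemma poincare_test:
  fixes \<Omega> :: "(real^'n) set"
  assumes "open \<Omega>" "finite_width \<Omega>"
  obtains K where "K \<ge> 0" "\<And>\<phi> \<alpha>. \<phi> \<in> test_functions \<Omega> \<Longrightarrow> mi_order \<alpha> \<le> m \<Longrightarrow>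
    (L2_norm \<Omega> (classical_deriv \<alpha> \<phi>))\<^sup>2
      \<le> K * (\<Sum>\<beta> | mi_order \<beta> = m. (L2_norm \<Omega> (classical_deriv \<beta> \<phi>))\<^sup>2)"
proof -
  obtain i C where C: "C \<ge> 1"
    "\<And>\<phi>. \<phi> \<in> test_functions \<Omega> \<Longrightarrow> L2_norm \<Omega> \<phi> \<le> C * L2_norm \<Omega> (partial_deriv i \<phi>)"
    using poincare_test_partial[OF assms] by blast
  have step: "L2_norm \<Omega> (classical_deriv \<alpha> \<phi>) \<le> C ^ k * L2_norm \<Omega> (classical_deriv (\<alpha>(i := \<alpha> i + k)) \<phi>)"
    if \<phi>: "\<phi> \<in> test_functions \<Omega>" for \<phi> k \<alpha>
  proof (induction k)
    case (Suc k)
    let ?\<beta> = "\<alpha>(i := \<alpha> i + k)"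
    obtain "is" where "is": "\<And>j. count_list is j = ?\<beta> j" "classical_deriv ?\<beta> = foldr partial_deriv is"
      by (rule classical_deriv_list[of ?\<beta>]) blast
    have "classical_deriv (\<alpha>(i := \<alpha> i + Suc k)) \<phi> = foldr partial_deriv (i # is) \<phi>"
      by (rule classical_deriv_eq[OF test_smooth[OF \<phi>]]) (use "is"(1) in auto)
    then have "partial_deriv i (classical_deriv ?\<beta> \<phi>) = classical_deriv (\<alpha>(i := \<alpha> i + Suc k)) \<phi>"
      by (simp add: "is"(2))
    with C(2)[OF test_classical_deriv[OF \<phi>], of ?\<beta>]
    have "L2_norm \<Omega> (classical_deriv ?\<beta> \<phi>) \<le> C * L2_norm \<Omega> (classical_deriv (\<alpha>(i := \<alpha> i + Suc k)) \<phi>)"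
      by simp
    then have "C ^ k * L2_norm \<Omega> (classical_deriv ?\<beta> \<phi>)
        \<le> C ^ k * (C * L2_norm \<Omega> (classical_deriv (\<alpha>(i := \<alpha> i + Suc k)) \<phi>))"
      using C(1) by (intro mult_left_mono) auto
    from order_trans[OF Suc this] show ?case by (simp only: power_Suc mult.assoc mult.left_commute)
  qed simp
  show ?thesis
  proof (rule that[of "(C ^ m)\<^sup>2"])
    fix \<phi> and \<alpha> :: "'n \<Rightarrow> nat" assume \<phi>: "\<phi> \<in> test_functions \<Omega>" and \<alpha>: "mi_order \<alpha> \<le> m"
    let ?k = "m - mi_order \<alpha>"
    let ?\<beta> = "\<alpha>(i := \<alpha> i + ?k)"
    have "mi_order ?\<beta> = mi_order \<alpha> + ?k"
      unfolding mi_order_def by (simp add: sum.remove[of UNIV i])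
    then have \<beta>: "mi_order ?\<beta> = m" using le_add_diff_inverse[OF \<alpha>] by (rule trans)
    have "L2_norm \<Omega> (classical_deriv \<alpha> \<phi>) \<le> C ^ ?k * L2_norm \<Omega> (classical_deriv ?\<beta> \<phi>)"
      by (rule step[OF \<phi>])
    also have "\<dots> \<le> C ^ m * L2_norm \<Omega> (classical_deriv ?\<beta> \<phi>)"
      using C(1) by (intro mult_right_mono power_increasing) auto
    finally have "(L2_norm \<Omega> (classical_deriv \<alpha> \<phi>))\<^sup>2 \<le> (C ^ m)\<^sup>2 * (L2_norm \<Omega> (classical_deriv ?\<beta> \<phi>))\<^sup>2"
      by (metis L2_norm_nonneg power_mono power_mult_distrib)
    also have "(L2_norm \<Omega> (classical_deriv ?\<beta> \<phi>))\<^sup>2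
        \<le> (\<Sum>\<beta> | mi_order \<beta> = m. (L2_norm \<Omega> (classical_deriv \<beta> \<phi>))\<^sup>2)"
      by (rule member_le_sum[where f = "\<lambda>\<beta>. (L2_norm \<Omega> (classical_deriv \<beta> \<phi>))\<^sup>2"])
         (intro CollectI \<beta> zero_le_power2 finite_mi_order_eq)+
    finally show "(L2_norm \<Omega> (classical_deriv \<alpha> \<phi>))\<^sup>2
        \<le> (C ^ m)\<^sup>2 * (\<Sum>\<beta> | mi_order \<beta> = m. (L2_norm \<Omega> (classical_deriv \<beta> \<phi>))\<^sup>2)"
      by (simp add: mult_left_mono)
  qed simp
qed

lemma H0m_inner_self:
  "H0m_inner \<Omega> m u u = of_real (\<Sum>\<alpha> | mi_order \<alpha> = m. (L2_norm \<Omega> (weak_deriv \<Omega> \<alpha> u))\<^sup>2)"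
  by (simp add: H0m_inner_def L2_inner_self)

lemma H0m_inner_commute: "H0m_inner \<Omega> m v u = cnj (H0m_inner \<Omega> m u v)"
  unfolding H0m_inner_def cnj_sum by (rule sum.cong[OF refl L2_inner_commute])

lemma test_seq_limit:
  assumes \<Omega>: "open \<Omega>" and u: "u \<in> Hm_space \<Omega> m" and \<phi>: "\<And>n. \<phi> n \<in> test_functions \<Omega>"
    and lim: "(\<lambda>n. L2_norm \<Omega> (\<lambda>x. weak_deriv \<Omega> \<alpha> u x - classical_deriv \<alpha> (\<phi> n) x)) \<longlonglongrightarrow> 0"
    and \<alpha>: "mi_order \<alpha> \<le> m"
  shows "(\<lambda>n. L2_norm \<Omega> (classical_deriv \<alpha> (\<phi> n))) \<longlonglongrightarrow> L2_norm \<Omega> (weak_deriv \<Omega> \<alpha> u)"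
    and "v \<in> L2_space \<Omega> \<Longrightarrow>
      (\<lambda>n. L2_inner \<Omega> v (classical_deriv \<alpha> (\<phi> n))) \<longlonglongrightarrow> L2_inner \<Omega> v (weak_deriv \<Omega> \<alpha> u)"
proof -
  have lim': "(\<lambda>n. L2_norm \<Omega> (\<lambda>x. classical_deriv \<alpha> (\<phi> n) x - weak_deriv \<Omega> \<alpha> u x)) \<longlonglongrightarrow> 0"
    using lim by (simp add: L2_norm_minus_commute[of \<Omega> "weak_deriv \<Omega> \<alpha> u"])
  show "(\<lambda>n. L2_norm \<Omega> (classical_deriv \<alpha> (\<phi> n))) \<longlonglongrightarrow> L2_norm \<Omega> (weak_deriv \<Omega> \<alpha> u)"
    by (rule L2_limit_norm[OF classical_deriv_L2[OF \<Omega> \<phi>] weak_deriv_L2[OF u \<alpha>] lim'])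
  show "(\<lambda>n. L2_inner \<Omega> v (classical_deriv \<alpha> (\<phi> n))) \<longlonglongrightarrow> L2_inner \<Omega> v (weak_deriv \<Omega> \<alpha> u)"
    if "v \<in> L2_space \<Omega>"
    by (rule L2_limit_inner_right[OF classical_deriv_L2[OF \<Omega> \<phi>] weak_deriv_L2[OF u \<alpha>] lim' that])
qed

text \<open>Each side of the inequality is continuous along an approximation by test functions.\<close>

lemma poincare_H0m:
  fixes \<Omega> :: "(real^'n) set"
  assumes \<Omega>: "open \<Omega>" "finite_width \<Omega>"
  obtains K where "K \<ge> 0" "\<And>u \<alpha>. u \<in> H0m_space \<Omega> m \<Longrightarrow> mi_order \<alpha> \<le> m \<Longrightarrow>
    (L2_norm \<Omega> (weak_deriv \<Omega> \<alpha> u))\<^sup>2 \<le> K * Re (H0m_inner \<Omega> m u u)"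
proof -
  obtain K where K: "K \<ge> 0" "\<And>\<phi> \<alpha>. \<phi> \<in> test_functions \<Omega> \<Longrightarrow> mi_order \<alpha> \<le> m \<Longrightarrow>
    (L2_norm \<Omega> (classical_deriv \<alpha> \<phi>))\<^sup>2
      \<le> K * (\<Sum>\<beta> | mi_order \<beta> = m. (L2_norm \<Omega> (classical_deriv \<beta> \<phi>))\<^sup>2)"
    using poincare_test[OF assms, of m] by blast
  show ?thesis
  proof (rule that[OF K(1)])
    fix u and \<alpha> :: "'n \<Rightarrow> nat" assume u: "u \<in> H0m_space \<Omega> m" and \<alpha>: "mi_order \<alpha> \<le> m"
    obtain \<phi> where \<phi>: "\<And>n. \<phi> n \<in> test_functions \<Omega>"
      "\<And>\<alpha>. mi_order \<alpha> \<le> m \<Longrightarrow>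
        (\<lambda>n. L2_norm \<Omega> (\<lambda>x. weak_deriv \<Omega> \<alpha> u x - classical_deriv \<alpha> (\<phi> n) x)) \<longlonglongrightarrow> 0"
      using H0m_seq[OF \<Omega>(1) u] by blast
    have lim: "(\<lambda>n. L2_norm \<Omega> (classical_deriv \<beta> (\<phi> n))) \<longlonglongrightarrow> L2_norm \<Omega> (weak_deriv \<Omega> \<beta> u)"
      if "mi_order \<beta> \<le> m" for \<beta>
      by (rule test_seq_limit(1)[OF \<Omega>(1) H0m_Hm[OF \<Omega>(1) u] \<phi>(1) \<phi>(2)[OF that] that])
    have "(\<lambda>n. (L2_norm \<Omega> (classical_deriv \<alpha> (\<phi> n)))\<^sup>2) \<longlonglongrightarrow> (L2_norm \<Omega> (weak_deriv \<Omega> \<alpha> u))\<^sup>2"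
      by (rule tendsto_power[OF lim[OF \<alpha>]])
    moreover have "(\<lambda>n. K * (\<Sum>\<beta> | mi_order \<beta> = m. (L2_norm \<Omega> (classical_deriv \<beta> (\<phi> n)))\<^sup>2))
        \<longlonglongrightarrow> K * (\<Sum>\<beta> | mi_order \<beta> = m. (L2_norm \<Omega> (weak_deriv \<Omega> \<beta> u))\<^sup>2)"
      by (intro tendsto_mult_left tendsto_sum tendsto_power lim) auto
    ultimately have "(L2_norm \<Omega> (weak_deriv \<Omega> \<alpha> u))\<^sup>2
        \<le> K * (\<Sum>\<beta> | mi_order \<beta> = m. (L2_norm \<Omega> (weak_deriv \<Omega> \<beta> u))\<^sup>2)"
      by (rule LIMSEQ_le) (use K(2)[OF \<phi>(1) \<alpha>] in blast)
    then show "(L2_norm \<Omega> (weak_deriv \<Omega> \<alpha> u))\<^sup>2 \<le> K * Re (H0m_inner \<Omega> m u u)"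
      by (simp add: H0m_inner_self)
  qed
qed

section \<open>The operator \<open>B\<close>\<close>

lemma B_op_L2:
  assumes "z \<in> Hm_space \<Omega> (2 * m)"
  shows "B_op \<Omega> m z \<in> L2_space \<Omega>"
  unfolding B_op_def
  by (intro L2_scale L2_sum weak_deriv_L2[OF assms]) (simp add: mi_order_double)

text \<open>Green's formula. For a test function \<open>v\<close> it is the definition of weak derivatives,
  because \<open>D\<^sup>\<alpha> (D\<^sup>\<alpha> v) = D\<^sup>2\<^sup>\<alpha> v\<close>.\<close>

lemma green_formula:
  fixes \<Omega> :: "(real^'n) set"
  assumes \<Omega>: "open \<Omega>" and z: "z \<in> Hm_space \<Omega> (2 * m)" and v: "v \<in> H0m_space \<Omega> m"
  shows "H0m_inner \<Omega> m z v = L2_inner \<Omega> (B_op \<Omega> m z) v"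
proof -
  have test: "(\<Sum>\<alpha> | mi_order \<alpha> = m. L2_inner \<Omega> (weak_deriv \<Omega> \<alpha> z) (classical_deriv \<alpha> \<phi>))
      = L2_inner \<Omega> (B_op \<Omega> m z) \<phi>" if \<phi>: "\<phi> \<in> test_functions \<Omega>" for \<phi>
  proof -
    have "L2_inner \<Omega> (weak_deriv \<Omega> \<alpha> z) (classical_deriv \<alpha> \<phi>)
        = (-1) ^ m * L2_inner \<Omega> (weak_deriv \<Omega> (\<lambda>i. 2 * \<alpha> i) z) \<phi>" if \<alpha>: "mi_order \<alpha> = m" for \<alpha> :: "'n \<Rightarrow> nat"
    proof -
      have 1: "is_weak_deriv \<Omega> \<alpha> z (weak_deriv \<Omega> \<alpha> z)"
        by (rule is_weak_deriv_weak_deriv[OF z]) (simp add: \<alpha>)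
      have 2: "is_weak_deriv \<Omega> (\<lambda>i. 2 * \<alpha> i) z (weak_deriv \<Omega> (\<lambda>i. 2 * \<alpha> i) z)"
        by (rule is_weak_deriv_weak_deriv[OF z]) (simp add: \<alpha> mi_order_double)
      have "(-1) ^ m * L2_inner \<Omega> (weak_deriv \<Omega> \<alpha> z) (classical_deriv \<alpha> \<phi>)
          = L2_inner \<Omega> z (classical_deriv \<alpha> (classical_deriv \<alpha> \<phi>))"
        using 1 test_classical_deriv[OF \<phi>] by (simp add: is_weak_deriv_iff \<alpha>)
      also have "\<dots> = L2_inner \<Omega> (weak_deriv \<Omega> (\<lambda>i. 2 * \<alpha> i) z) \<phi>"
        using 2 \<phi> by (simp add: is_weak_deriv_iff \<alpha> mi_order_double classical_deriv_double[OF test_smooth[OF \<phi>]])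
      finally show ?thesis
        by (metis (no_types, lifting) left_minus_one_mult_self)
    qed
    then have "(\<Sum>\<alpha> | mi_order \<alpha> = m. L2_inner \<Omega> (weak_deriv \<Omega> \<alpha> z) (classical_deriv \<alpha> \<phi>))
        = (-1) ^ m * (\<Sum>\<alpha> | mi_order \<alpha> = m. L2_inner \<Omega> (weak_deriv \<Omega> (\<lambda>i. 2 * \<alpha> i) z) \<phi>)"
      by (simp add: sum_distrib_left)
    also have "\<dots> = L2_inner \<Omega> (B_op \<Omega> m z) \<phi>"
      unfolding B_op_def L2_inner_scale_left
      by (subst L2_inner_sum_left) (auto intro!: weak_deriv_L2[OF z] test_L2[OF \<Omega> \<phi>] simp: mi_order_double)
    finally show ?thesis .
  qed
  obtain \<phi> where \<phi>: "\<And>n. \<phi> n \<in> test_functions \<Omega>"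
    "\<And>\<alpha>. mi_order \<alpha> \<le> m \<Longrightarrow>
      (\<lambda>n. L2_norm \<Omega> (\<lambda>x. weak_deriv \<Omega> \<alpha> v x - classical_deriv \<alpha> (\<phi> n) x)) \<longlonglongrightarrow> 0"
    using H0m_seq[OF \<Omega> v] by blast
  have lim: "(\<lambda>n. L2_inner \<Omega> f (classical_deriv \<alpha> (\<phi> n))) \<longlonglongrightarrow> L2_inner \<Omega> f (weak_deriv \<Omega> \<alpha> v)"
    if "mi_order \<alpha> \<le> m" "f \<in> L2_space \<Omega>" for \<alpha> f
    by (rule test_seq_limit(2)[OF \<Omega> H0m_Hm[OF \<Omega> v] \<phi>(1) \<phi>(2)[OF that(1)] that])
  have "(\<lambda>n. \<Sum>\<alpha> | mi_order \<alpha> = m. L2_inner \<Omega> (weak_deriv \<Omega> \<alpha> z) (classical_deriv \<alpha> (\<phi> n)))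
      \<longlonglongrightarrow> H0m_inner \<Omega> m z v"
    unfolding H0m_inner_def by (intro tendsto_sum lim weak_deriv_L2[OF z]) auto
  moreover have "(\<lambda>n. L2_inner \<Omega> (B_op \<Omega> m z) (\<phi> n)) \<longlonglongrightarrow> L2_inner \<Omega> (B_op \<Omega> m z) (weak_deriv \<Omega> (\<lambda>i. 0) v)"
    using lim[of "\<lambda>i. 0" "B_op \<Omega> m z"] B_op_L2[OF z]
    by (simp add: mi_order_zero classical_deriv_zero_index[OF test_smooth[OF \<phi>(1)]])
  moreover have "L2_inner \<Omega> (B_op \<Omega> m z) (weak_deriv \<Omega> (\<lambda>i. 0) v) = L2_inner \<Omega> (B_op \<Omega> m z) v"
    using B_op_L2[OF z] H0m_Hm[OF \<Omega> v] weak_deriv_zero_index[OF \<Omega> H0m_Hm[OF \<Omega> v]]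
    by (intro L2_inner_cong_ae) (auto intro: Hm_L2 weak_deriv_L2[of _ _ m] simp: mi_order_zero)
  ultimately show ?thesis by (simp add: test[OF \<phi>(1)] LIMSEQ_unique)
qed

lemma B_dom_D: "z \<in> B_dom \<Omega> m \<Longrightarrow> z \<in> Hm_space \<Omega> (2 * m) \<and> z \<in> H0m_space \<Omega> m \<and> z \<in> L2_space \<Omega>"
  by (auto simp: B_dom_def Hm_L2)

lemma B_dom_add_scale:
  assumes "open \<Omega>" "y \<in> B_dom \<Omega> m" "z \<in> B_dom \<Omega> m"
  shows "(\<lambda>x. y x + c * z x) \<in> B_dom \<Omega> m"
  using assms by (auto simp: B_dom_def intro: Hm_add Hm_scale H0m_add_scale)

lemma B_dom_diff:
  "open \<Omega> \<Longrightarrow> y \<in> B_dom \<Omega> m \<Longrightarrow> z \<in> B_dom \<Omega> m \<Longrightarrow> (\<lambda>x. y x - z x) \<in> B_dom \<Omega> m"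
  using B_dom_add_scale[of \<Omega> y m z "-1"] by simp

lemma B_op_add_scale:
  fixes \<Omega> :: "(real^'n) set"
  assumes \<Omega>: "open \<Omega>" and y: "y \<in> Hm_space \<Omega> (2 * m)" and z: "z \<in> Hm_space \<Omega> (2 * m)"
  shows "ae_eq \<Omega> (B_op \<Omega> m (\<lambda>x. y x + c * z x)) (\<lambda>x. B_op \<Omega> m y x + c * B_op \<Omega> m z x)"
proof -
  have "ae_eq \<Omega> (weak_deriv \<Omega> \<alpha> (\<lambda>x. y x + c * z x)) (\<lambda>x. weak_deriv \<Omega> \<alpha> y x + c * weak_deriv \<Omega> \<alpha> z x)"
    if "mi_order \<alpha> \<le> 2 * m" for \<alpha>
    using weak_deriv_add[OF \<Omega> y Hm_scale[OF \<Omega> z] that, of c] weak_deriv_scale[OF \<Omega> z that, of c]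
    by eventually_elim simp
  then have "AE x in lebesgue_on \<Omega>. \<forall>\<alpha>\<in>{\<alpha>. mi_order \<alpha> = m}.
      weak_deriv \<Omega> (\<lambda>i. 2 * \<alpha> i) (\<lambda>x. y x + c * z x) x
        = weak_deriv \<Omega> (\<lambda>i. 2 * \<alpha> i) y x + c * weak_deriv \<Omega> (\<lambda>i. 2 * \<alpha> i) z x"
    by (intro AE_finite_allI finite_mi_order_eq) (simp add: mi_order_double)
  then show ?thesis
    by eventually_elim (simp add: B_op_def sum.distrib sum_distrib_left algebra_simps)
qed

lemma B_op_diff:
  assumes "open \<Omega>" "y \<in> Hm_space \<Omega> (2 * m)" "z \<in> Hm_space \<Omega> (2 * m)"
  shows "ae_eq \<Omega> (B_op \<Omega> m (\<lambda>x. y x - z x)) (\<lambda>x. B_op \<Omega> m y x - B_op \<Omega> m z x)"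
  using B_op_add_scale[OF assms, of "-1"] by simp

text \<open>By Green's formula the square of the seminorm of \<open>w\<close> is \<open>\<langle>B w, w\<rangle> \<le> \<parallel>B w\<parallel> \<parallel>w\<parallel>\<close>, and by
  the Poincare inequality it dominates the square of \<open>\<parallel>w\<parallel>\<close>. So \<open>B\<close> controls all derivatives up
  to order \<open>m\<close>, in particular it is injective with a bounded inverse.\<close>

lemma B_a_priori:
  fixes \<Omega> :: "(real^'n) set"
  assumes \<Omega>: "open \<Omega>" "finite_width \<Omega>"
  obtains K where "K \<ge> 0" "\<And>w \<alpha>. w \<in> B_dom \<Omega> m \<Longrightarrow> mi_order \<alpha> \<le> m \<Longrightarrow>
    L2_norm \<Omega> (weak_deriv \<Omega> \<alpha> w) \<le> K * L2_norm \<Omega> (B_op \<Omega> m w)"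
proof -
  obtain K where K: "K \<ge> 0" "\<And>u \<alpha>. u \<in> H0m_space \<Omega> m \<Longrightarrow> mi_order \<alpha> \<le> m \<Longrightarrow>
    (L2_norm \<Omega> (weak_deriv \<Omega> \<alpha> u))\<^sup>2 \<le> K * Re (H0m_inner \<Omega> m u u)"
    using poincare_H0m[OF assms, of m] by blast
  show ?thesis
  proof (rule that[OF K(1)])
    fix w and \<alpha> :: "'n \<Rightarrow> nat" assume w: "w \<in> B_dom \<Omega> m" and \<alpha>: "mi_order \<alpha> \<le> m"
    have w': "w \<in> Hm_space \<Omega> (2 * m)" "w \<in> H0m_space \<Omega> m" "w \<in> L2_space \<Omega>"
      using B_dom_D[OF w] by auto
    let ?B = "L2_norm \<Omega> (B_op \<Omega> m w)"
    have q: "Re (H0m_inner \<Omega> m w w) \<le> ?B * L2_norm \<Omega> w"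
      unfolding green_formula[OF \<Omega>(1) w'(1,2)]
      using L2_Cauchy_Schwarz[OF B_op_L2[OF w'(1)] w'(3)] complex_Re_le_cmod order_trans by blast
    have "L2_norm \<Omega> (weak_deriv \<Omega> (\<lambda>i. 0) w) = L2_norm \<Omega> w"
      using weak_deriv_zero_index[OF \<Omega>(1) w'(1)] w'(3) weak_deriv_L2[OF w'(1), of "\<lambda>i. 0"]
      by (intro L2_norm_cong_ae) (auto simp: mi_order_zero)
    with K(2)[OF w'(2), of "\<lambda>i. 0"] have "(L2_norm \<Omega> w)\<^sup>2 \<le> K * Re (H0m_inner \<Omega> m w w)"
      by (simp add: mi_order_zero)
    also have "\<dots> \<le> K * (?B * L2_norm \<Omega> w)" using q K(1) by (rule mult_left_mono)
    finally have *: "L2_norm \<Omega> w * L2_norm \<Omega> w \<le> K * ?B * L2_norm \<Omega> w"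
      by (simp add: power2_eq_square mult.assoc)
    have w_le: "L2_norm \<Omega> w \<le> K * ?B"
    proof (cases "L2_norm \<Omega> w = 0")
      case False
      then have "L2_norm \<Omega> w > 0" using L2_norm_nonneg[of \<Omega> w] by linarith
      with * show ?thesis by (rule mult_right_le_imp_le)
    qed (simp add: K(1))
    have "(L2_norm \<Omega> (weak_deriv \<Omega> \<alpha> w))\<^sup>2 \<le> K * Re (H0m_inner \<Omega> m w w)"
      by (rule K(2)[OF w'(2) \<alpha>])
    also have "\<dots> \<le> K * (?B * (K * ?B))"
      using q w_le K(1) by (intro mult_left_mono order_trans[OF q]) auto
    finally have "(L2_norm \<Omega> (weak_deriv \<Omega> \<alpha> w))\<^sup>2 \<le> (K * ?B)\<^sup>2"
      by (simp add: power2_eq_square mult_ac)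
    then show "L2_norm \<Omega> (weak_deriv \<Omega> \<alpha> w) \<le> K * ?B"
      by (rule power2_le_imp_le) (simp add: K(1))
  qed
qed

section \<open>The adjoint of the embedding\<close>

text \<open>The a priori estimate turns convergence of \<open>B w\<^sub>n\<close> in \<open>L\<^sub>2\<close> into convergence of \<open>w\<^sub>n\<close> in
  \<open>H\<^sup>m\<close>. This also yields the existence of the adjoint at \<open>u\<close>, without an appeal to the Riesz
  representation theorem.\<close>

lemma B_approximation_converges:
  fixes \<Omega> :: "(real^'n) set"
  assumes \<Omega>: "open \<Omega>" "finite_width \<Omega>" and w: "\<And>n. w n \<in> B_dom \<Omega> m" and u: "u \<in> L2_space \<Omega>"
    and lim: "(\<lambda>n. L2_norm \<Omega> (\<lambda>x. B_op \<Omega> m (w n) x - u x)) \<longlonglongrightarrow> 0"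
  obtains z where "is_embedding_adjoint \<Omega> m u z" "(\<lambda>n. L2_norm \<Omega> (\<lambda>x. w n x - z x)) \<longlonglongrightarrow> 0"
proof -
  obtain K where K: "K \<ge> 0" "\<And>w \<alpha>. w \<in> B_dom \<Omega> m \<Longrightarrow> mi_order \<alpha> \<le> m \<Longrightarrow>
    L2_norm \<Omega> (weak_deriv \<Omega> \<alpha> w) \<le> K * L2_norm \<Omega> (B_op \<Omega> m w)"
    using B_a_priori[OF \<Omega>, of m] by blast
  have wH: "w n \<in> Hm_space \<Omega> (2 * m)" "w n \<in> H0m_space \<Omega> m" "w n \<in> L2_space \<Omega>" "w n \<in> Hm_space \<Omega> m" for n
    using B_dom_D[OF w] H0m_Hm[OF \<Omega>(1)] by blast+
  have Bw: "B_op \<Omega> m (w n) \<in> L2_space \<Omega>" for n by (rule B_op_L2[OF wH(1)])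
  have diff: "L2_norm \<Omega> (\<lambda>x. weak_deriv \<Omega> \<alpha> (w i) x - weak_deriv \<Omega> \<alpha> (w j) x)
      \<le> K * (L2_norm \<Omega> (\<lambda>x. B_op \<Omega> m (w i) x - u x) + L2_norm \<Omega> (\<lambda>x. B_op \<Omega> m (w j) x - u x))"
    if \<alpha>: "mi_order \<alpha> \<le> m" for \<alpha> i j
  proof -
    have dij: "(\<lambda>x. w i x - w j x) \<in> B_dom \<Omega> m" by (rule B_dom_diff[OF \<Omega>(1) w w])
    have "L2_norm \<Omega> (\<lambda>x. weak_deriv \<Omega> \<alpha> (w i) x - weak_deriv \<Omega> \<alpha> (w j) x)
        = L2_norm \<Omega> (weak_deriv \<Omega> \<alpha> (\<lambda>x. w i x - w j x))"
      by (rule L2_norm_cong_ae[symmetric, OF weak_deriv_L2[OF Hm_diff[OF \<Omega>(1) wH(4) wH(4)] \<alpha>]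
            L2_diff[OF weak_deriv_L2[OF wH(4) \<alpha>] weak_deriv_L2[OF wH(4) \<alpha>]]
            weak_deriv_diff[OF \<Omega>(1) wH(4) wH(4) \<alpha>]])
    also have "\<dots> \<le> K * L2_norm \<Omega> (B_op \<Omega> m (\<lambda>x. w i x - w j x))"
      by (rule K(2)[OF dij \<alpha>])
    also have "L2_norm \<Omega> (B_op \<Omega> m (\<lambda>x. w i x - w j x))
        = L2_norm \<Omega> (\<lambda>x. B_op \<Omega> m (w i) x - B_op \<Omega> m (w j) x)"
      by (rule L2_norm_cong_ae[OF B_op_L2[OF Hm_diff[OF \<Omega>(1) wH(1) wH(1)]] L2_diff[OF Bw Bw]
            B_op_diff[OF \<Omega>(1) wH(1) wH(1)]])
    also have "\<dots> \<le> L2_norm \<Omega> (\<lambda>x. B_op \<Omega> m (w i) x - u x) + L2_norm \<Omega> (\<lambda>x. B_op \<Omega> m (w j) x - u x)"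
      using L2_norm_triangle_diff[OF Bw[of i] u Bw[of j]] by (simp add: L2_norm_minus_commute[of \<Omega> u])
    finally show ?thesis using K(1) by (simp add: mult_left_mono)
  qed
  have "\<exists>g. g \<in> L2_space \<Omega> \<and> (\<lambda>n. L2_norm \<Omega> (\<lambda>x. weak_deriv \<Omega> \<alpha> (w n) x - g x)) \<longlonglongrightarrow> 0"
    if \<alpha>: "mi_order \<alpha> \<le> m" for \<alpha>
  proof -
    have "\<exists>N. \<forall>i\<ge>N. \<forall>j\<ge>N. L2_norm \<Omega> (\<lambda>x. weak_deriv \<Omega> \<alpha> (w i) x - weak_deriv \<Omega> \<alpha> (w j) x) < \<epsilon>"
      if \<epsilon>: "\<epsilon> > 0" for \<epsilon>
    proof -
      define \<delta> where "\<delta> = \<epsilon> / (2 * (K + 1))"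
      have \<delta>: "\<delta> > 0" "2 * (K + 1) * \<delta> = \<epsilon>" using \<epsilon> K(1) by (auto simp: \<delta>_def)
      from order_tendstoD(2)[OF lim \<delta>(1)] obtain N where
        N: "\<And>n. n \<ge> N \<Longrightarrow> L2_norm \<Omega> (\<lambda>x. B_op \<Omega> m (w n) x - u x) < \<delta>"
        by (auto simp: eventually_sequentially)
      have "L2_norm \<Omega> (\<lambda>x. weak_deriv \<Omega> \<alpha> (w i) x - weak_deriv \<Omega> \<alpha> (w j) x) < \<epsilon>"
        if "i \<ge> N" "j \<ge> N" for i j
      proof -
        have "L2_norm \<Omega> (\<lambda>x. weak_deriv \<Omega> \<alpha> (w i) x - weak_deriv \<Omega> \<alpha> (w j) x)
            \<le> K * (\<delta> + \<delta>)"
          using N[OF that(1)] N[OF that(2)] K(1)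
          by (intro order_trans[OF diff[OF \<alpha>]] mult_left_mono) auto
        also have "\<dots> < \<epsilon>" using \<delta> by (simp add: algebra_simps)
        finally show ?thesis .
      qed
      then show ?thesis by blast
    qed
    then obtain g where "g \<in> L2_space \<Omega>" "(\<lambda>n. L2_norm \<Omega> (\<lambda>x. weak_deriv \<Omega> \<alpha> (w n) x - g x)) \<longlonglongrightarrow> 0"
      by (rule L2_complete[rotated 2]) (use \<Omega>(1) weak_deriv_L2[OF wH(4) \<alpha>] in auto)
    then show ?thesis by blast
  qed
  then have "\<forall>\<alpha>. \<exists>g. mi_order \<alpha> \<le> m \<longrightarrow>
      g \<in> L2_space \<Omega> \<and> (\<lambda>n. L2_norm \<Omega> (\<lambda>x. weak_deriv \<Omega> \<alpha> (w n) x - g x)) \<longlonglongrightarrow> 0"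
    by blast
  from choice[OF this] obtain g where g: "\<And>\<alpha>. mi_order \<alpha> \<le> m \<Longrightarrow> g \<alpha> \<in> L2_space \<Omega>"
    "\<And>\<alpha>. mi_order \<alpha> \<le> m \<Longrightarrow> (\<lambda>n. L2_norm \<Omega> (\<lambda>x. weak_deriv \<Omega> \<alpha> (w n) x - g \<alpha> x)) \<longlonglongrightarrow> 0"
    by blast
  define z where "z = g (\<lambda>i. 0)"
  have z: "z \<in> L2_space \<Omega>" unfolding z_def by (rule g(1)) (simp add: mi_order_zero)
  have wz: "(\<lambda>n. L2_norm \<Omega> (\<lambda>x. w n x - z x)) \<longlonglongrightarrow> 0"
  proof -
    have "L2_norm \<Omega> (\<lambda>x. weak_deriv \<Omega> (\<lambda>i. 0) (w n) x - z x) = L2_norm \<Omega> (\<lambda>x. w n x - z x)" for n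
    proof (rule L2_norm_cong_ae)
      show "(\<lambda>x. weak_deriv \<Omega> (\<lambda>i. 0) (w n) x - z x) \<in> L2_space \<Omega>"
        by (rule L2_diff[OF weak_deriv_L2[OF wH(4)] z]) (simp add: mi_order_zero)
      show "(\<lambda>x. w n x - z x) \<in> L2_space \<Omega>" by (rule L2_diff[OF wH(3) z])
      show "ae_eq \<Omega> (\<lambda>x. weak_deriv \<Omega> (\<lambda>i. 0) (w n) x - z x) (\<lambda>x. w n x - z x)"
        using weak_deriv_zero_index[OF \<Omega>(1) wH(4)] by eventually_elim simp
    qed
    with g(2)[of "\<lambda>i. 0"] show ?thesis by (simp add: mi_order_zero z_def)
  qed
  have gz: "is_weak_deriv \<Omega> \<alpha> z (g \<alpha>)" if \<alpha>: "mi_order \<alpha> \<le> m" for \<alpha>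
    by (rule is_weak_deriv_limit[OF \<Omega>(1) wH(3) z wz weak_deriv_L2[OF wH(4) \<alpha>] g(1)[OF \<alpha>] g(2)[OF \<alpha>]
          is_weak_deriv_weak_deriv[OF wH(4) \<alpha>]])
  have zH: "z \<in> Hm_space \<Omega> m"
    using z gz g(1) by (auto simp: Hm_space_def)
  have conv: "(\<lambda>n. L2_norm \<Omega> (\<lambda>x. weak_deriv \<Omega> \<alpha> (w n) x - weak_deriv \<Omega> \<alpha> z x)) \<longlonglongrightarrow> 0"
    if \<alpha>: "mi_order \<alpha> \<le> m" for \<alpha>
  proof -
    have "L2_norm \<Omega> (\<lambda>x. weak_deriv \<Omega> \<alpha> (w n) x - weak_deriv \<Omega> \<alpha> z x)
        = L2_norm \<Omega> (\<lambda>x. weak_deriv \<Omega> \<alpha> (w n) x - g \<alpha> x)" for n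
    proof (rule L2_norm_cong_ae)
      show "ae_eq \<Omega> (\<lambda>x. weak_deriv \<Omega> \<alpha> (w n) x - weak_deriv \<Omega> \<alpha> z x) (\<lambda>x. weak_deriv \<Omega> \<alpha> (w n) x - g \<alpha> x)"
        using weak_deriv_ae_eq[OF \<Omega>(1) zH \<alpha> g(1)[OF \<alpha>] gz[OF \<alpha>]] by eventually_elim simp
    qed (intro L2_diff weak_deriv_L2[OF wH(4) \<alpha>] weak_deriv_L2[OF zH \<alpha>] g(1)[OF \<alpha>])+
    with g(2)[OF \<alpha>] show ?thesis by simp
  qed
  have zH0: "z \<in> H0m_space \<Omega> m" by (rule H0m_closed[OF \<Omega>(1) wH(2) zH conv])
  have "H0m_inner \<Omega> m z v = L2_inner \<Omega> u v" if v: "v \<in> H0m_space \<Omega> m" for v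
  proof -
    have vH: "v \<in> Hm_space \<Omega> m" by (rule H0m_Hm[OF \<Omega>(1) v])
    have "(\<lambda>n. H0m_inner \<Omega> m (w n) v) \<longlonglongrightarrow> H0m_inner \<Omega> m z v"
      unfolding H0m_inner_def
    proof (rule tendsto_sum)
      fix \<alpha> :: "'n \<Rightarrow> nat" assume "\<alpha> \<in> {\<alpha>. mi_order \<alpha> = m}"
      then have \<alpha>: "mi_order \<alpha> \<le> m" by simp
      show "(\<lambda>n. L2_inner \<Omega> (weak_deriv \<Omega> \<alpha> (w n)) (weak_deriv \<Omega> \<alpha> v))
          \<longlonglongrightarrow> L2_inner \<Omega> (weak_deriv \<Omega> \<alpha> z) (weak_deriv \<Omega> \<alpha> v)"
        by (rule L2_limit_inner[OF weak_deriv_L2[OF wH(4) \<alpha>] weak_deriv_L2[OF zH \<alpha>] conv[OF \<alpha>]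
              weak_deriv_L2[OF vH \<alpha>]])
    qed
    moreover have "(\<lambda>n. L2_inner \<Omega> (B_op \<Omega> m (w n)) v) \<longlonglongrightarrow> L2_inner \<Omega> u v"
      by (rule L2_limit_inner[OF Bw u lim Hm_L2[OF vH]])
    ultimately show ?thesis
      by (simp add: green_formula[OF \<Omega>(1) wH(1) v] LIMSEQ_unique)
  qed
  with zH0 wz show ?thesis by (intro that[of z]) (auto simp: is_embedding_adjoint_def)
qed

lemma embedding_adjoint_unique:
  fixes \<Omega> :: "(real^'n) set"
  assumes \<Omega>: "open \<Omega>" "finite_width \<Omega>"
    and "is_embedding_adjoint \<Omega> m u y" "is_embedding_adjoint \<Omega> m u z"
  shows "ae_eq \<Omega> y z"
proof -
  have y: "y \<in> H0m_space \<Omega> m" and z: "z \<in> H0m_space \<Omega> m"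
    using assms by (auto simp: is_embedding_adjoint_def)
  note H = H0m_Hm[OF \<Omega>(1) y] H0m_Hm[OF \<Omega>(1) z]
  let ?d = "\<lambda>x. y x - z x"
  have d: "?d \<in> H0m_space \<Omega> m" by (rule H0m_diff[OF \<Omega>(1) y z])
  have dH: "?d \<in> Hm_space \<Omega> m" by (rule H0m_Hm[OF \<Omega>(1) d])
  have "H0m_inner \<Omega> m ?d ?d = H0m_inner \<Omega> m y ?d - H0m_inner \<Omega> m z ?d"
    unfolding H0m_inner_def sum_subtractf[symmetric]
  proof (rule sum.cong[OF refl])
    fix \<alpha> :: "'n \<Rightarrow> nat" assume "\<alpha> \<in> {\<alpha>. mi_order \<alpha> = m}"
    then have \<alpha>: "mi_order \<alpha> \<le> m" by simp
    note L2 = weak_deriv_L2[OF H(1) \<alpha>] weak_deriv_L2[OF H(2) \<alpha>] weak_deriv_L2[OF dH \<alpha>]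
    have "L2_inner \<Omega> (weak_deriv \<Omega> \<alpha> ?d) (weak_deriv \<Omega> \<alpha> ?d)
        = L2_inner \<Omega> (\<lambda>x. weak_deriv \<Omega> \<alpha> y x - weak_deriv \<Omega> \<alpha> z x) (weak_deriv \<Omega> \<alpha> ?d)"
      by (rule L2_inner_cong_ae[OF L2(3) L2_diff[OF L2(1,2)] L2(3,3) weak_deriv_diff[OF \<Omega>(1) H \<alpha>]]) simp
    then show "L2_inner \<Omega> (weak_deriv \<Omega> \<alpha> ?d) (weak_deriv \<Omega> \<alpha> ?d)
        = L2_inner \<Omega> (weak_deriv \<Omega> \<alpha> y) (weak_deriv \<Omega> \<alpha> ?d) - L2_inner \<Omega> (weak_deriv \<Omega> \<alpha> z) (weak_deriv \<Omega> \<alpha> ?d)"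
      by (simp add: L2_inner_diff_left L2)
  qed
  also have "\<dots> = 0" using assms(3,4) d by (simp add: is_embedding_adjoint_def)
  finally have 0: "H0m_inner \<Omega> m ?d ?d = 0" .
  obtain K where K: "K \<ge> 0" "\<And>u \<alpha>. u \<in> H0m_space \<Omega> m \<Longrightarrow> mi_order \<alpha> \<le> m \<Longrightarrow>
    (L2_norm \<Omega> (weak_deriv \<Omega> \<alpha> u))\<^sup>2 \<le> K * Re (H0m_inner \<Omega> m u u)"
    using poincare_H0m[OF \<Omega>, of m] by blast
  have "(L2_norm \<Omega> (weak_deriv \<Omega> (\<lambda>i. 0) ?d))\<^sup>2 \<le> 0"
    using K(2)[OF d, of "\<lambda>i. 0"] by (simp add: 0 mi_order_zero)
  then have "ae_eq \<Omega> (weak_deriv \<Omega> (\<lambda>i. 0) ?d) (\<lambda>x. 0)"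
    using L2_norm_eq_0_iff[OF weak_deriv_L2[OF dH, of "\<lambda>i. 0"]] by (simp add: mi_order_zero)
  with weak_deriv_zero_index[OF \<Omega>(1) dH] show ?thesis by eventually_elim simp
qed

section \<open>Expansion in an orthonormal basis\<close>

text \<open>Completeness of the system only provides some approximating linear combinations. The
  Fourier partial sum of length \<open>N\<close> is at least as good as every combination of length \<open>n \<le> N\<close>,
  since its remainder is orthogonal to \<open>e k\<close> for \<open>k < N\<close>.\<close>

lemma orthonormal_basis_expansion:
  assumes e: "orthonormal_basis_L2 \<Omega> e" and f: "f \<in> L2_space \<Omega>"
  shows "(\<lambda>n. L2_norm \<Omega> (\<lambda>x. f x - (\<Sum>k<n. L2_inner \<Omega> f (e k) * e k x))) \<longlonglongrightarrow> 0"
proof -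
  have eL: "e k \<in> L2_space \<Omega>" and on: "L2_inner \<Omega> (e j) (e k) = (if j = k then 1 else 0)"
    and dense: "\<epsilon> > 0 \<Longrightarrow> \<exists>n c. L2_norm \<Omega> (\<lambda>x. f x - (\<Sum>k<n. c k * e k x)) < \<epsilon>" for j k \<epsilon>
    using e f by (auto simp: orthonormal_basis_L2_def)
  define P where "P n = (\<lambda>x. \<Sum>k<n. L2_inner \<Omega> f (e k) * e k x)" for n :: nat
  define r where "r n = (\<lambda>x. f x - P n x)" for n
  have span: "(\<lambda>x. \<Sum>k<n. c k * e k x) \<in> L2_space \<Omega>" for n :: nat and c
    by (intro L2_sum L2_scale eL)
  have rL: "r n \<in> L2_space \<Omega>" for n
    unfolding r_def P_def by (intro L2_diff f span)
  have r_orth: "L2_inner \<Omega> (r n) (e j) = 0" if "j < n" for n j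
  proof -
    have "L2_inner \<Omega> (P n) (e j) = (\<Sum>k<n. L2_inner \<Omega> f (e k) * (if k = j then 1 else 0))"
      unfolding P_def by (simp add: L2_inner_sum_left L2_scale eL L2_inner_scale_left on)
    also have "\<dots> = L2_inner \<Omega> f (e j)"
      using that by (simp add: if_distrib[where f = "(*) c" for c] cong: if_cong)
    finally show ?thesis
      unfolding r_def by (subst L2_inner_diff_left) (auto simp: f eL P_def span)
  qed
  have best: "L2_norm \<Omega> (r N) \<le> L2_norm \<Omega> (\<lambda>x. f x - (\<Sum>k<n. c k * e k x))" if "n \<le> N" for n N c
  proof -
    have orth: "L2_inner \<Omega> (r N) (\<lambda>x. f x - (\<Sum>k<l. d k * e k x)) = L2_inner \<Omega> (r N) f" if "l \<le> N" for l d
    proof -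
      have "L2_inner \<Omega> (r N) (\<lambda>x. \<Sum>k<l. d k * e k x) = (\<Sum>k<l. cnj (d k) * L2_inner \<Omega> (r N) (e k))"
        by (simp add: L2_inner_sum_right L2_scale eL rL L2_inner_scale_right)
      also have "\<dots> = 0" using r_orth that by simp
      finally show ?thesis by (simp add: L2_inner_diff_right f span rL)
    qed
    have "L2_inner \<Omega> (r N) (r N) = L2_inner \<Omega> (r N) f"
      using orth[OF order_refl, of "\<lambda>k. L2_inner \<Omega> f (e k)"] by (simp add: r_def P_def)
    then have "L2_inner \<Omega> (r N) (r N) = L2_inner \<Omega> (r N) (\<lambda>x. f x - (\<Sum>k<n. c k * e k x))"
      using orth[OF that, of c] by simp
    then have "(L2_norm \<Omega> (r N))\<^sup>2 = cmod (L2_inner \<Omega> (r N) (\<lambda>x. f x - (\<Sum>k<n. c k * e k x)))"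
      by (metis L2_inner_self norm_of_real abs_power2)
    also have "\<dots> \<le> L2_norm \<Omega> (r N) * L2_norm \<Omega> (\<lambda>x. f x - (\<Sum>k<n. c k * e k x))"
      by (intro L2_Cauchy_Schwarz rL L2_diff f span)
    finally have *: "L2_norm \<Omega> (r N) * L2_norm \<Omega> (r N) \<le> L2_norm \<Omega> (r N) * L2_norm \<Omega> (\<lambda>x. f x - (\<Sum>k<n. c k * e k x))"
      by (simp add: power2_eq_square)
    show ?thesis
    proof (cases "L2_norm \<Omega> (r N) = 0")
      case False
      then have "L2_norm \<Omega> (r N) > 0" using L2_norm_nonneg[of \<Omega> "r N"] by linarith
      with * show ?thesis by (rule mult_left_le_imp_le)
    qed simp
  qed
  have "(\<lambda>n. L2_norm \<Omega> (r n)) \<longlonglongrightarrow> 0"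
  proof (rule LIMSEQ_I)
    fix \<epsilon> :: real assume "\<epsilon> > 0"
    then obtain n c where "L2_norm \<Omega> (\<lambda>x. f x - (\<Sum>k<n. c k * e k x)) < \<epsilon>" using dense by blast
    then have "\<forall>N\<ge>n. norm (L2_norm \<Omega> (r N) - 0) < \<epsilon>" using best[of n _ c] by fastforce
    then show "\<exists>n. \<forall>N\<ge>n. norm (L2_norm \<Omega> (r N) - 0) < \<epsilon>" by blast
  qed
  then show ?thesis by (simp add: r_def P_def)
qed

lemma orthonormal_basis_ae_eqI:
  assumes e: "orthonormal_basis_L2 \<Omega> e" and f: "f \<in> L2_space \<Omega>" and g: "g \<in> L2_space \<Omega>"
    and eq: "\<And>k. L2_inner \<Omega> f (e k) = L2_inner \<Omega> g (e k)"
  shows "ae_eq \<Omega> f g"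
proof -
  have eL: "e k \<in> L2_space \<Omega>" for k using e by (auto simp: orthonormal_basis_L2_def)
  have "L2_inner \<Omega> (\<lambda>x. f x - g x) (e k) = 0" for k
    by (simp add: L2_inner_diff_left f g eL eq)
  with orthonormal_basis_expansion[OF e L2_diff[OF f g]]
  have "L2_norm \<Omega> (\<lambda>x. f x - g x) = 0" by (simp add: LIMSEQ_const_iff)
  then show ?thesis by (simp add: L2_norm_diff_eq_0_iff f g)
qed

lemma B_sum:
  fixes \<Omega> :: "(real^'n) set" and e :: "nat \<Rightarrow> real^'n \<Rightarrow> complex" and n :: nat
  assumes \<Omega>: "open \<Omega>" and e: "\<And>k. e k \<in> B_dom \<Omega> m"
  shows "(\<lambda>x. \<Sum>k<n. c k * e k x) \<in> B_dom \<Omega> m"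
    and "ae_eq \<Omega> (B_op \<Omega> m (\<lambda>x. \<Sum>k<n. c k * e k x)) (\<lambda>x. \<Sum>k<n. c k * B_op \<Omega> m (e k) x)"
proof -
  have dom: "(\<lambda>x. \<Sum>k<n. c k * e k x) \<in> B_dom \<Omega> m" for n
  proof (induction n)
    case 0
    show ?case by (simp add: B_dom_def test_Hm[OF \<Omega> test_zero] H0m_zero[OF \<Omega>])
  next
    case (Suc n)
    from B_dom_add_scale[OF \<Omega> this e[of n], of "c n"] show ?case by simp
  qed
  then show "(\<lambda>x. \<Sum>k<n. c k * e k x) \<in> B_dom \<Omega> m" .
  show "ae_eq \<Omega> (B_op \<Omega> m (\<lambda>x. \<Sum>k<n. c k * e k x)) (\<lambda>x. \<Sum>k<n. c k * B_op \<Omega> m (e k) x)"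
  proof (induction n)
    case 0
    have H: "(\<lambda>x. 0) \<in> Hm_space \<Omega> (2 * m)" by (rule test_Hm[OF \<Omega> test_zero])
    from B_op_diff[OF \<Omega> H H] show ?case by simp
  next
    case (Suc n)
    have "(\<lambda>x. \<Sum>k<n. c k * e k x) \<in> Hm_space \<Omega> (2 * m)" "e n \<in> Hm_space \<Omega> (2 * m)"
      using B_dom_D[OF dom] B_dom_D[OF e] by blast+
    from B_op_add_scale[OF \<Omega> this, of "c n"] Suc show ?case
      by eventually_elim simp
  qed
qed

section \<open>The inverse of \<open>B\<close> and the eigenfunction expansion\<close>

theorem proposition8p2:
  fixes \<Omega> :: "(real^'n) set" and m :: nat
    and ev :: "nat \<Rightarrow> complex" and e :: "nat \<Rightarrow> real^'n \<Rightarrow> complex"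
  assumes "open \<Omega>" and "\<Omega> \<noteq> {}" and "finite_width \<Omega>"
    and "complete_orthonormal_eigensystem \<Omega> m ev e"
  shows "(\<forall>k. ev k \<noteq> 0) \<and>
    (\<forall>u\<in>L2_space \<Omega>.
      \<comment> \<open>both operators are well defined at \<open>u\<close>\<close>
      is_embedding_adjoint \<Omega> m u (embedding_adjoint \<Omega> m u) \<and>
      (B_inverse \<Omega> m u, u) \<in> B_closure \<Omega> m \<and>
      (\<forall>z. (z, u) \<in> B_closure \<Omega> m \<longrightarrow> ae_eq \<Omega> z (B_inverse \<Omega> m u)) \<and>
      (\<forall>z\<in>B_dom \<Omega> m. ae_eq \<Omega> (B_op \<Omega> m z) u \<longleftrightarrow> ae_eq \<Omega> z (B_inverse \<Omega> m u)) \<and>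
      \<comment> \<open>the two equalities\<close>
      ae_eq \<Omega> (embedding_adjoint \<Omega> m u) (B_inverse \<Omega> m u) \<and>
      (\<lambda>n. L2_norm \<Omega> (\<lambda>x. B_inverse \<Omega> m u x
              - (\<Sum>k<n. 1 / ev k * L2_inner \<Omega> u (e k) * e k x))) \<longlonglongrightarrow> 0)"
proof (intro conjI ballI allI)
  note \<Omega> = assms(1,3)
  have e: "e k \<in> B_dom \<Omega> m" and eig: "ae_eq \<Omega> (B_op \<Omega> m (e k)) (\<lambda>x. ev k * e k x)"
    and basis: "orthonormal_basis_L2 \<Omega> e" for k
    using assms(4) by (auto simp: complete_orthonormal_eigensystem_def)
  have eH: "e k \<in> Hm_space \<Omega> (2 * m)" "e k \<in> H0m_space \<Omega> m" "e k \<in> L2_space \<Omega>" for k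
    using B_dom_D[OF e] by blast+
  have e_norm: "L2_norm \<Omega> (e k) = 1" for k
  proof -
    have "L2_inner \<Omega> (e k) (e k) = 1" using basis by (simp add: orthonormal_basis_L2_def)
    then have "complex_of_real ((L2_norm \<Omega> (e k))\<^sup>2) = complex_of_real 1" by (simp only: L2_inner_self of_real_1)
    then have "(L2_norm \<Omega> (e k))\<^sup>2 = 1\<^sup>2" by (simp only: of_real_eq_iff power_one)
    then show ?thesis by (rule power2_eq_imp_eq) simp_all
  qed
  have B_e: "L2_norm \<Omega> (B_op \<Omega> m (e k)) = cmod (ev k)" for k
    using L2_norm_cong_ae[OF B_op_L2[OF eH(1)] L2_scale[OF eH(3)] eig] by (simp add: L2_norm_scale e_norm)
  show ev: "ev k \<noteq> 0" for k
  proof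
    assume 0: "ev k = 0"
    obtain K where K: "K \<ge> 0" "\<And>w \<alpha>. w \<in> B_dom \<Omega> m \<Longrightarrow> mi_order \<alpha> \<le> m \<Longrightarrow>
      L2_norm \<Omega> (weak_deriv \<Omega> \<alpha> w) \<le> K * L2_norm \<Omega> (B_op \<Omega> m w)"
      using B_a_priori[OF \<Omega>, of m] by blast
    have "L2_norm \<Omega> (weak_deriv \<Omega> (\<lambda>i. 0) (e k)) \<le> 0"
      using K(2)[OF e[of k], of "\<lambda>i. 0"] by (simp add: mi_order_zero B_e 0)
    moreover have "L2_norm \<Omega> (weak_deriv \<Omega> (\<lambda>i. 0) (e k)) = L2_norm \<Omega> (e k)"
      by (rule L2_norm_cong_ae[OF weak_deriv_L2[OF eH(1)] eH(3) weak_deriv_zero_index[OF \<Omega>(1) eH(1)]])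
         (simp add: mi_order_zero)
    ultimately show False by (simp add: e_norm)
  qed
  \<comment> \<open>An element of the graph of the closure is the limit of a sequence \<open>w\<^sub>n\<close> for which \<open>B w\<^sub>n\<close>
    converges, hence agrees with the adjoint.\<close>
  have closure_adjoint: "is_embedding_adjoint \<Omega> m u z' \<Longrightarrow> ae_eq \<Omega> z z'" if "(z, u) \<in> B_closure \<Omega> m" for z u z'
  proof -
    assume z': "is_embedding_adjoint \<Omega> m u z'"
    obtain w where w: "\<And>n. w n \<in> B_dom \<Omega> m" "(\<lambda>n. L2_norm \<Omega> (\<lambda>x. w n x - z x)) \<longlonglongrightarrow> 0"
      "(\<lambda>n. L2_norm \<Omega> (\<lambda>x. B_op \<Omega> m (w n) x - u x)) \<longlonglongrightarrow> 0" and L2: "z \<in> L2_space \<Omega>" "u \<in> L2_space \<Omega>"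
      using \<open>(z, u) \<in> B_closure \<Omega> m\<close> by (auto simp: B_closure_def)
    obtain y where y: "is_embedding_adjoint \<Omega> m u y" "(\<lambda>n. L2_norm \<Omega> (\<lambda>x. w n x - y x)) \<longlonglongrightarrow> 0"
      using B_approximation_converges[OF \<Omega> w(1) L2(2) w(3)] by blast
    have yL: "y \<in> L2_space \<Omega>"
      using y(1) by (auto simp: is_embedding_adjoint_def H0m_space_def Hm_L2)
    have wL: "w n \<in> L2_space \<Omega>" for n using B_dom_D[OF w(1)] by blast
    have "ae_eq \<Omega> z y" by (rule L2_limit_unique[OF wL L2(1) yL w(2) y(2)])
    moreover have "ae_eq \<Omega> y z'" by (rule embedding_adjoint_unique[OF \<Omega> y(1) z'])
    ultimately show ?thesis by eventually_elim simp
  qed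
  fix u assume u: "u \<in> L2_space \<Omega>"
  \<comment> \<open>\<open>B\<close> maps the partial sums of the series to the Fourier partial sums of \<open>u\<close>.\<close>
  define w where "w n = (\<lambda>x. \<Sum>k<n. 1 / ev k * L2_inner \<Omega> u (e k) * e k x)" for n
  have w: "w n \<in> B_dom \<Omega> m" for n
    unfolding w_def by (rule B_sum(1)[OF \<Omega>(1) e])
  have wL: "w n \<in> L2_space \<Omega>" for n using B_dom_D[OF w] by blast
  have lim: "(\<lambda>n. L2_norm \<Omega> (\<lambda>x. B_op \<Omega> m (w n) x - u x)) \<longlonglongrightarrow> 0"
  proof -
    have "L2_norm \<Omega> (\<lambda>x. B_op \<Omega> m (w n) x - u x) = L2_norm \<Omega> (\<lambda>x. u x - (\<Sum>k<n. L2_inner \<Omega> u (e k) * e k x))" for n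
    proof -
      have "AE x in lebesgue_on \<Omega>. \<forall>k\<in>{..<n}. B_op \<Omega> m (e k) x = ev k * e k x"
        by (intro AE_finite_allI eig) auto
      with B_sum(2)[OF \<Omega>(1), where e = e and c = "\<lambda>k. 1 / ev k * L2_inner \<Omega> u (e k)" and n = n, OF e]
      have "ae_eq \<Omega> (B_op \<Omega> m (w n)) (\<lambda>x. \<Sum>k<n. L2_inner \<Omega> u (e k) * e k x)"
        by eventually_elim (simp add: w_def ev)
      then have "ae_eq \<Omega> (\<lambda>x. B_op \<Omega> m (w n) x - u x) (\<lambda>x. (\<Sum>k<n. L2_inner \<Omega> u (e k) * e k x) - u x)"
        by eventually_elim simp
      moreover have "(\<lambda>x. B_op \<Omega> m (w n) x - u x) \<in> L2_space \<Omega>"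
        using B_dom_D[OF w] by (intro L2_diff B_op_L2 u) blast
      moreover have "(\<lambda>x. (\<Sum>k<n. L2_inner \<Omega> u (e k) * e k x) - u x) \<in> L2_space \<Omega>"
        by (intro L2_diff L2_sum L2_scale eH u)
      ultimately have "L2_norm \<Omega> (\<lambda>x. B_op \<Omega> m (w n) x - u x)
          = L2_norm \<Omega> (\<lambda>x. (\<Sum>k<n. L2_inner \<Omega> u (e k) * e k x) - u x)"
        by (intro L2_norm_cong_ae)
      then show ?thesis by (simp only: L2_norm_minus_commute[of \<Omega> u])
    qed
    with orthonormal_basis_expansion[OF basis u] show ?thesis by simp
  qed
  obtain y where y: "is_embedding_adjoint \<Omega> m u y" "(\<lambda>n. L2_norm \<Omega> (\<lambda>x. w n x - y x)) \<longlonglongrightarrow> 0"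
    using B_approximation_converges[OF \<Omega> w u lim] by blast
  have yL: "y \<in> L2_space \<Omega>"
    using y(1) by (auto simp: is_embedding_adjoint_def H0m_space_def Hm_L2)
  show adj: "is_embedding_adjoint \<Omega> m u (embedding_adjoint \<Omega> m u)"
    unfolding embedding_adjoint_def by (rule someI[of "is_embedding_adjoint \<Omega> m u", OF y(1)])
  have "(y, u) \<in> B_closure \<Omega> m"
    unfolding B_closure_def using w y(2) lim yL u by blast
  then show inv: "(B_inverse \<Omega> m u, u) \<in> B_closure \<Omega> m"
    unfolding B_inverse_def by (rule someI[of "\<lambda>z. (z, u) \<in> B_closure \<Omega> m"])
  have invL: "B_inverse \<Omega> m u \<in> L2_space \<Omega>" using inv by (simp add: B_closure_def)
  have inv_y: "ae_eq \<Omega> (B_inverse \<Omega> m u) y" by (rule closure_adjoint[OF inv y(1)])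
  have inv_adj: "ae_eq \<Omega> (B_inverse \<Omega> m u) (embedding_adjoint \<Omega> m u)" by (rule closure_adjoint[OF inv adj])
  then show "ae_eq \<Omega> (embedding_adjoint \<Omega> m u) (B_inverse \<Omega> m u)" by eventually_elim simp
  show unique: "(z, u) \<in> B_closure \<Omega> m \<longrightarrow> ae_eq \<Omega> z (B_inverse \<Omega> m u)" for z
  proof
    assume "(z, u) \<in> B_closure \<Omega> m"
    from closure_adjoint[OF this adj] inv_adj show "ae_eq \<Omega> z (B_inverse \<Omega> m u)" by eventually_elim simp
  qed
  show "(\<lambda>n. L2_norm \<Omega> (\<lambda>x. B_inverse \<Omega> m u x - (\<Sum>k<n. 1 / ev k * L2_inner \<Omega> u (e k) * e k x))) \<longlonglongrightarrow> 0"
  proof -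
    have "L2_norm \<Omega> (\<lambda>x. B_inverse \<Omega> m u x - w n x) = L2_norm \<Omega> (\<lambda>x. w n x - y x)" for n
    proof -
      have "L2_norm \<Omega> (\<lambda>x. B_inverse \<Omega> m u x - w n x) = L2_norm \<Omega> (\<lambda>x. y x - w n x)"
        by (rule L2_norm_cong_ae) (use inv_y in \<open>auto intro: L2_diff invL wL yL elim: eventually_mono\<close>)
      then show ?thesis by (simp add: L2_norm_minus_commute[of \<Omega> y])
    qed
    with y(2) show ?thesis by (simp add: w_def)
  qed
  show "ae_eq \<Omega> (B_op \<Omega> m z) u \<longleftrightarrow> ae_eq \<Omega> z (B_inverse \<Omega> m u)" if z: "z \<in> B_dom \<Omega> m" for z
  proof
    have zH: "z \<in> Hm_space \<Omega> (2 * m)" "z \<in> H0m_space \<Omega> m" "z \<in> L2_space \<Omega>"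
      using B_dom_D[OF z] by auto
    note Bz = B_op_L2[OF zH(1)]
    {
      assume "ae_eq \<Omega> (B_op \<Omega> m z) u"
      then have "L2_norm \<Omega> (\<lambda>x. B_op \<Omega> m z x - u x) = 0"
        by (simp add: L2_norm_diff_eq_0_iff Bz u)
      then have "(z, u) \<in> B_closure \<Omega> m"
        unfolding B_closure_def using z zH(3) u by (auto intro!: exI[of _ "\<lambda>n. z"])
      with unique show "ae_eq \<Omega> z (B_inverse \<Omega> m u)" by blast
    }
    assume z_inv: "ae_eq \<Omega> z (B_inverse \<Omega> m u)"
    \<comment> \<open>Symmetry of \<open>B\<close> against \<open>e k\<close> determines the Fourier coefficients of \<open>B z\<close>.\<close>
    show "ae_eq \<Omega> (B_op \<Omega> m z) u"
    proof (rule orthonormal_basis_ae_eqI[OF basis Bz u])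
      fix k
      have yH: "y \<in> H0m_space \<Omega> m" and yadj: "H0m_inner \<Omega> m y (e k) = L2_inner \<Omega> u (e k)"
        using y(1) eH(2) by (auto simp: is_embedding_adjoint_def)
      have green: "H0m_inner \<Omega> m v (e k) = cnj (L2_inner \<Omega> (B_op \<Omega> m (e k)) v)" if "v \<in> H0m_space \<Omega> m" for v
        by (subst H0m_inner_commute) (simp add: green_formula[OF \<Omega>(1) eH(1) that])
      have "ae_eq \<Omega> z y" using z_inv inv_y by eventually_elim simp
      then have "L2_inner \<Omega> (B_op \<Omega> m (e k)) z = L2_inner \<Omega> (B_op \<Omega> m (e k)) y"
        using B_op_L2[OF eH(1)] zH(3) yL by (intro L2_inner_cong_ae) auto
      then have "H0m_inner \<Omega> m z (e k) = H0m_inner \<Omega> m y (e k)"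
        by (simp add: green zH(2) yH)
      then show "L2_inner \<Omega> (B_op \<Omega> m z) (e k) = L2_inner \<Omega> u (e k)"
        by (simp add: yadj green_formula[OF \<Omega>(1) zH(1) eH(2)])
    qed
  qed
qed

end
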